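(* There is an algorithm which, given as input a finite set $E$ and a finite subset $Z$ of the free group $\langle E\mid\ \rangle$ on $E$ (each element of $Z$ being given by its reduced $E^{\pm1}$-expression), terminates and returns a basis $E''$ of $\langle E\mid\ \rangle$ which maximizes $|E''\cap\langle Z\rangle|$; that is, $|E''\cap\langle Z\rangle|\ge |B\cap\langle Z\rangle|$ for every basis $B$ of $\langle E\mid\ \rangle$.
   Context: $\langle E\mid\ \rangle$ denotes the free group on the set $E$. A basis of $\langle E\mid\ \rangle$ is a free-generating set of $\langle E\mid\ \rangle$. For $Z\subseteq\langle E\mid\ \rangle$, $\langle Z\rangle$ denotes the subgroup generated by $Z$. The output basis $E''$ is given by listing its elements as $E^{\pm1}$-expressions. *)

theory Defs
  imports "HOL-Algebra.Generated_Groups" "HOL-Library.Nat_Bijection"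
begin

section \<open>Free groups\<close>

text \<open>
  The letter \<open>(a, True)\<close> stands for \<open>a\<close> and \<open>(a, False)\<close> for the formal inverse of \<open>a\<close>.
  An element of the free group on \<open>E\<close> is its reduced word.
\<close>

type_synonym 'a letter = "'a \<times> bool"
type_synonym 'a word = "'a letter list"

definition inv_letter :: "'a letter \<Rightarrow> 'a letter" where
  "inv_letter x = (fst x, \<not> snd x)"

definition words :: "'a set \<Rightarrow> 'a word set" where
  "words E = lists (E \<times> UNIV)"

fun reduced :: "'a word \<Rightarrow> bool" where
  "reduced [] \<longleftrightarrow> True"
| "reduced [x] \<longleftrightarrow> True"
| "reduced (x # y # w) \<longleftrightarrow> y \<noteq> inv_letter x \<and> reduced (y # w)"

fun cons_red :: "'a letter \<Rightarrow> 'a word \<Rightarrow> 'a word" where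
  "cons_red x [] = [x]"
| "cons_red x (y # w) = (if y = inv_letter x then w else x # y # w)"

definition reduce :: "'a word \<Rightarrow> 'a word" where
  "reduce w = foldr cons_red w []"

definition free_group :: "'a set \<Rightarrow> 'a word monoid" where
  "free_group E =
     \<lparr>carrier = {w \<in> words E. reduced w}, mult = (\<lambda>u v. reduce (u @ v)), one = []\<rparr>"

definition letter_val :: "('g, 'm) monoid_scheme \<Rightarrow> 'g letter \<Rightarrow> 'g" where
  "letter_val G x = (if snd x then fst x else inv\<^bsub>G\<^esub> (fst x))"

definition word_val :: "('g, 'm) monoid_scheme \<Rightarrow> 'g word \<Rightarrow> 'g" where
  "word_val G w = foldr (\<lambda>x g. letter_val G x \<otimes>\<^bsub>G\<^esub> g) w \<one>\<^bsub>G\<^esub>"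

text \<open>
  \<open>B\<close> is a free-generating set of \<open>G\<close>: the homomorphism from the free group on \<open>B\<close> to \<open>G\<close>
  that extends the inclusion of \<open>B\<close> is an isomorphism.
\<close>

definition free_basis :: "('g, 'm) monoid_scheme \<Rightarrow> 'g set \<Rightarrow> bool" where
  "free_basis G B \<longleftrightarrow> B \<subseteq> carrier G \<and> word_val G \<in> iso (free_group B) G"

lemma inv_letter_inv [simp]: "inv_letter (inv_letter x) = x"
  by (simp add: inv_letter_def)

lemma inv_letter_neq [simp]: "inv_letter x \<noteq> x" "x \<noteq> inv_letter x"
  by (auto simp: inv_letter_def prod_eq_iff)

lemma reduced_tl: "reduced (x # w) \<Longrightarrow> reduced w"
  by (cases w) auto

lemma reduced_cons_red: "reduced w \<Longrightarrow> reduced (cons_red x w)"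
  by (cases w) (auto dest: reduced_tl)

lemma reduced_foldr: "reduced v \<Longrightarrow> reduced (foldr cons_red u v)"
  by (induction u) (auto intro: reduced_cons_red)

lemma reduced_reduce: "reduced (reduce w)"
  by (simp add: reduce_def reduced_foldr)

lemma reduce_reduced: "reduced w \<Longrightarrow> reduce w = w"
proof (induction w)
  case (Cons x w)
  then have "reduce w = w" by (auto dest: reduced_tl)
  then have "reduce (x # w) = cons_red x w" by (simp add: reduce_def)
  then show ?case using Cons.prems by (cases w) auto
qed (simp add: reduce_def)

lemma cons_red_cancel: "reduced w \<Longrightarrow> cons_red (inv_letter x) (cons_red x w) = w"
proof (cases w)
  case (Cons y v)
  assume "reduced w"
  then show ?thesis using Cons by (cases v) auto
qed simp

lemma foldr_cons_red_step:
  "reduced v \<Longrightarrow> foldr cons_red (cons_red x u) v = cons_red x (foldr cons_red u v)"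
proof (cases u)
  case (Cons y w)
  assume "reduced v"
  then have "reduced (foldr cons_red w v)" by (rule reduced_foldr)
  then show ?thesis
    using Cons cons_red_cancel[of "foldr cons_red w v" "inv_letter x"] by auto
qed simp

lemma foldr_reduce: "reduced v \<Longrightarrow> foldr cons_red (reduce u) v = foldr cons_red u v"
  by (induction u) (auto simp: reduce_def foldr_cons_red_step)

lemma reduce_append: "reduce (u @ v) = foldr cons_red u (reduce v)"
  by (simp add: reduce_def)

lemma reduce_reduce_left: "reduce (reduce u @ v) = reduce (u @ v)"
  by (simp add: reduce_append foldr_reduce reduced_reduce)

lemma reduce_reduce_right: "reduce (u @ reduce v) = reduce (u @ v)"
  by (simp add: reduce_append reduce_reduced reduced_reduce)

lemma cons_red_words: "x \<in> E \<times> UNIV \<Longrightarrow> w \<in> words E \<Longrightarrow> cons_red x w \<in> words E"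
  by (cases w) (auto simp: words_def)

lemma reduce_words: "w \<in> words E \<Longrightarrow> reduce w \<in> words E"
proof (induction w)
  case (Cons x w)
  then have "x \<in> E \<times> UNIV" "w \<in> words E" by (auto simp: words_def)
  then show ?case using Cons.IH by (simp add: reduce_def cons_red_words del: mem_Sigma_iff)
qed (simp add: reduce_def words_def)

lemma reduce_inverse: "reduce (rev (map inv_letter w) @ w) = []"
proof (induction w)
  case (Cons x w)
  have "cons_red (inv_letter x) (cons_red x (reduce w)) = reduce w"
    by (simp add: cons_red_cancel reduced_reduce)
  then have "reduce (rev (map inv_letter (x # w)) @ x # w) = reduce (rev (map inv_letter w) @ w)"
    by (simp add: reduce_def)
  then show ?case using Cons.IH by simp
qed (simp add: reduce_def)

lemma group_free_group: "group (free_group E)"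
proof (rule groupI)
  fix x assume "x \<in> carrier (free_group E)"
  then have x: "x \<in> words E" "reduced x" by (auto simp: free_group_def)
  let ?y = "reduce (rev (map inv_letter x))"
  have "rev (map inv_letter x) \<in> words E"
    using x(1) by (fastforce simp: words_def inv_letter_def)
  then have "?y \<in> carrier (free_group E)"
    by (simp add: free_group_def reduce_words reduced_reduce)
  moreover have "?y \<otimes>\<^bsub>free_group E\<^esub> x = \<one>\<^bsub>free_group E\<^esub>"
    by (simp add: free_group_def reduce_reduce_left reduce_inverse)
  ultimately show "\<exists>y\<in>carrier (free_group E). y \<otimes>\<^bsub>free_group E\<^esub> x = \<one>\<^bsub>free_group E\<^esub>"
    by blast
qed (auto simp: free_group_def reduced_reduce reduce_reduced reduce_reduce_left
      reduce_reduce_right words_def intro!: reduce_words[unfolded words_def])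

section \<open>Algorithms\<close>

text \<open>
  Programs for the partial recursive functions and their evaluation: \<open>computes f xs y\<close> means
  that \<open>f\<close> halts on the arguments \<open>xs\<close> with value \<open>y\<close>.
\<close>

datatype recf =
    Zero
  | Succ
  | Proj nat
  | Comp recf "recf list"
  | PrimRec recf recf
  | Mu recf

inductive computes :: "recf \<Rightarrow> nat list \<Rightarrow> nat \<Rightarrow> bool" where
  zero: "computes Zero xs 0"
| succ: "computes Succ [x] (Suc x)"
| proj: "i < length xs \<Longrightarrow> computes (Proj i) xs (xs ! i)"
| comp: "\<lbrakk>list_all2 (\<lambda>g y. computes g xs y) gs ys; computes f ys z\<rbrakk>
    \<Longrightarrow> computes (Comp f gs) xs z"
| primrec_0: "computes f xs y \<Longrightarrow> computes (PrimRec f g) (0 # xs) y"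
| primrec_Suc: "\<lbrakk>computes (PrimRec f g) (n # xs) r; computes g (n # r # xs) y\<rbrakk>
    \<Longrightarrow> computes (PrimRec f g) (Suc n # xs) y"
| mu: "\<lbrakk>computes f (n # xs) 0; \<forall>m<n. \<exists>y. computes f (m # xs) (Suc y)\<rbrakk>
    \<Longrightarrow> computes (Mu f) xs n"
monos list_all2_mono

lemma computes_functional: "computes f xs y \<Longrightarrow> computes f xs z \<Longrightarrow> y = z"
proof (induction arbitrary: z rule: computes.induct)
  case (comp xs gs ys f w)
  from comp.prems obtain ys' where ys': "list_all2 (\<lambda>g y. computes g xs y) gs ys'"
    "computes f ys' z" by (cases rule: computes.cases) auto
  have "ys = ys'"
    using comp.hyps comp.IH ys'(1)
    by (auto simp: list_all2_conv_all_nth intro!: nth_equalityI)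
  then show ?case using comp.IH ys'(2) by blast
next
  case (mu f n xs)
  from mu.prems have z: "computes f (z # xs) 0" "\<forall>m<z. \<exists>y. computes f (m # xs) (Suc y)"
    by (cases rule: computes.cases, simp_all)+
  have "\<not> z < n" using mu.IH z(1) by fastforce
  moreover have "\<not> n < z" using mu.IH z(2) by fastforce
  ultimately show ?case by simp
next
  case (primrec_Suc f g n xs r y)
  from primrec_Suc.prems obtain r' where "computes (PrimRec f g) (n # xs) r'"
    "computes g (n # r' # xs) z" by (cases rule: computes.cases) auto
  then show ?case using primrec_Suc.IH by blast
qed (erule computes.cases; simp)+

definition letter_code :: "nat letter \<Rightarrow> nat" where
  "letter_code x = prod_encode (fst x, of_bool (snd x))"

definition word_code :: "nat word \<Rightarrow> nat" where
  "word_code w = list_encode (map letter_code w)"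

definition words_code :: "nat word list \<Rightarrow> nat" where
  "words_code ws = list_encode (map word_code ws)"

lemma inj_letter_code: "inj letter_code"
  by (auto simp: inj_def letter_code_def prod_eq_iff)

lemma inj_word_code: "inj word_code"
  by (intro injI) (simp add: word_code_def list_encode_eq inj_map_eq_map[OF inj_letter_code])

lemma inj_words_code: "inj words_code"
  by (intro injI) (simp add: words_code_def list_encode_eq inj_map_eq_map[OF inj_word_code])

end

theory Submission
  imports Defs
begin

text \<open>
  Let \<open>H\<close> be the subgroup generated by \<open>Z\<close>, let \<open>B\<close> be an optimal basis, and let \<open>K\<close> be generated by
  the elements of \<open>B\<close> in \<open>H\<close>.  The edges of the Cayley tree of \<open>B\<close> that are labelled by the remaining
  elements of \<open>B\<close> cut the group into two parts each, invariantly under \<open>K\<close>.  As long as one of these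
  cuts is not given by an edge of the Cayley tree of the current basis, an innermost-disc argument
  yields a Whitehead move that brings the current basis closer to \<open>B\<close>.  The surgery is done along a
  \<open>K\<close>-invariant cut, so it does not increase the number of edges in the image of the Stallings graph of \<open>K\<close>
  in that of \<open>H\<close>.  Replacing \<open>H\<close> at each move by the subgroup carried by this image, one reaches an
  optimal basis through subgroups with boundedly many edges.  If, in the coordinates of the current basis, the
  same subgroup occurs twice, the moves in between can be left out.  Hence the number of moves has a computable
  bound, and the algorithm tries all sequences of moves up to that length.  It decides membership in
  \<open>H\<close> by the actions on a finite set of bounded size (Marshall Hall).
\<close>

section \<open>Free groups and their Cayley trees\<close>

text \<open>Crossings with the cuts of \<open>B\<close> make the descent end, but \<open>B\<close>
  is unknown and may be arbitrarily complicated, so they give no computable bound. That bound comes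
  from a second quantity, the weight, which is bounded in terms of \<open>Z\<close> alone. A move
  that suits \<open>B\<close> may enlarge the Stallings graph of the subgroup; only the part
  traversed by \<open>K\<close> is under control, which is why the subgroup is replaced at each
  move. A subgroup of weight at most \<open>M\<close> is determined by its elements of length at
  most \<open>2 * M + 1\<close>, since these contain Schreier generators; this makes the number of
  subgroups finite and explicit.

  A Whitehead move along \<open>X\<close> needs a letter \<open>b\<close> in \<open>X\<close> whose
  inverse is outside \<open>X\<close>. When the cut itself is used, a parity count supplies
  \<open>b\<close>: the basis element dual to the cut is separated from 0 by exactly one translate.

  At the end distinct cuts belong to distinct letters, and the remaining letters lie in the
  subgroup. They are numerous enough because no basis has more than \<open>card E\<close> elements,
  a rank bound proved by the same descent, started at the trivial subgroup.\<close>

lemmas group_assoc = diff_conv_add_uminus minus_add add.assoc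

typedef 'a fg = "{w :: 'a word. reduced w}" morphisms word Abs_fg
  by (rule exI[of _ "[]"]) simp

lemma reduced_word [simp]: "reduced (word g)"
  using word[of g] by simp

definition of_word :: "'a word \<Rightarrow> 'a fg" where
  "of_word w = Abs_fg (reduce w)"

lemma word_of_word [simp]: "word (of_word w) = reduce w"
  by (simp add: of_word_def Abs_fg_inverse reduced_reduce)

lemma of_word_word [simp]: "of_word (word g) = g"
  by (simp add: of_word_def reduce_reduced word_inverse)

lemma of_word_eq_iff: "of_word u = of_word v \<longleftrightarrow> reduce u = reduce v"
  by (metis word_of_word of_word_def)

instantiation fg :: (type) group_add
begin

definition "0 = of_word []"
definition "g + h = of_word (word g @ word h)"
definition "- g = of_word (rev (map inv_letter (word g)))"
definition "g - h = g + - (h :: 'a fg)"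

instance
proof
  fix a b c :: "'a fg"
  show "a + b + c = a + (b + c)"
    by (simp add: plus_fg_def of_word_eq_iff reduce_reduce_left reduce_reduce_right)
  show "0 + a = a" "a + 0 = a"
    by (simp_all add: plus_fg_def zero_fg_def reduce_def)
  show "- a + a = 0"
    by (simp add: plus_fg_def zero_fg_def uminus_fg_def of_word_eq_iff reduce_reduce_left reduce_inverse)
      (simp add: reduce_def)
  show "a + - b = a - b" by (rule minus_fg_def[symmetric])
qed

end

lemma of_word_append: "of_word (u @ v) = of_word u + of_word v"
  by (simp add: plus_fg_def of_word_eq_iff reduce_reduce_left reduce_reduce_right)

lemma of_word_Nil [simp]: "of_word [] = 0"
  by (simp add: zero_fg_def)

lemma word_zero [simp]: "word 0 = []"
  unfolding zero_fg_def by (simp only: word_of_word) (simp add: reduce_def)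

lemma word_eq_Nil_iff [simp]: "word g = [] \<longleftrightarrow> g = 0"
  by (metis of_word_word of_word_Nil word_zero)

definition ltr :: "'a letter \<Rightarrow> 'a fg" where
  "ltr y = of_word [y]"

lemma word_ltr [simp]: "word (ltr y) = [y]"
  by (simp add: ltr_def reduce_def)

lemma of_word_Cons: "of_word (y # w) = ltr y + of_word w"
  using of_word_append[of "[y]" w] by (simp add: ltr_def)

lemma word_ltr_plus: "word (ltr y + g) = cons_red y (word g)"
  by (simp add: plus_fg_def reduce_def) (metis reduce_def reduce_reduced reduced_word)

lemma ltr_inv: "ltr (inv_letter y) = - ltr y"
  by (simp add: uminus_fg_def ltr_def reduce_def)

lemma ltr_neq_zero [simp]: "ltr y \<noteq> 0" "0 \<noteq> ltr y"
  by (metis word_ltr word_zero list.distinct(1))+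

lemma ltr_eq_iff [simp]: "ltr y = ltr z \<longleftrightarrow> y = z"
  by (metis word_ltr list.inject)

text \<open>The new letter does not cancel, so this induction follows the reduced path from 0
  outwards, one edge at a time.\<close>

lemma fg_induct [case_names zero plus]:
  assumes "P 0" and "\<And>y g. word (ltr y + g) = y # word g \<Longrightarrow> P g \<Longrightarrow> P (ltr y + g)"
  shows "P g"
proof -
  have "reduced w \<Longrightarrow> P (of_word w)" for w
  proof (induction w)
    case (Cons y w)
    then have "reduced w" by (auto dest: reduced_tl)
    with Cons show ?case
      by (metis assms(2) of_word_Cons reduce_reduced word_of_word)
  qed (simp add: assms(1))
  then show ?thesis by (metis of_word_word reduced_word)
qed

lemma inv_letter_eq_iff [simp]: "inv_letter x = inv_letter y \<longleftrightarrow> x = y"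
  by (metis inv_letter_inv)

subsection \<open>The subgroup of words over an alphabet\<close>

definition letters :: "'a set \<Rightarrow> 'a letter set" where
  "letters E = E \<times> UNIV"

definition fgs :: "'a set \<Rightarrow> 'a fg set" where
  "fgs E = {g. word g \<in> words E}"

lemma words_letters: "words E = lists (letters E)"
  by (simp add: words_def letters_def)

lemma inv_in_letters [simp]: "inv_letter y \<in> letters E \<longleftrightarrow> y \<in> letters E"
  by (auto simp: letters_def inv_letter_def mem_Times_iff)

lemma of_word_in_fgs: "w \<in> words E \<Longrightarrow> of_word w \<in> fgs E"
  by (simp add: fgs_def reduce_words)

lemma fgs_zero [simp]: "0 \<in> fgs E"
  by (simp add: fgs_def words_def)

lemma fgs_ltr [simp]: "ltr y \<in> fgs E \<longleftrightarrow> y \<in> letters E"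
  by (simp add: fgs_def words_letters)

lemma fgs_plus [simp]: "g \<in> fgs E \<Longrightarrow> h \<in> fgs E \<Longrightarrow> g + h \<in> fgs E"
  unfolding plus_fg_def by (rule of_word_in_fgs) (auto simp: fgs_def words_def)

lemma fgs_uminus [simp]: "g \<in> fgs E \<Longrightarrow> - g \<in> fgs E"
  unfolding uminus_fg_def
  by (rule of_word_in_fgs) (fastforce simp: fgs_def words_def inv_letter_def)

lemma fgs_minus [simp]: "g \<in> fgs E \<Longrightarrow> h \<in> fgs E \<Longrightarrow> g - h \<in> fgs E"
  unfolding minus_fg_def by (intro fgs_plus fgs_uminus)

lemma fgs_induct [consumes 1, case_names zero plus]:
  assumes "g \<in> fgs E" "P 0"
    and "\<And>y g. y \<in> letters E \<Longrightarrow> g \<in> fgs E \<Longrightarrow> word (ltr y + g) = y # word g \<Longrightarrow> P g \<Longrightarrow> P (ltr y + g)"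
  shows "P g"
  using assms(1)
proof (induction g rule: fg_induct)
  case (plus y g)
  then have "y \<in> letters E" "g \<in> fgs E" by (auto simp: fgs_def words_letters)
  with plus assms(3) show ?case by blast
qed (rule assms(2))

subsection \<open>Half-spaces of the Cayley tree\<close>

text \<open>Edges of the Cayley tree join \<open>g\<close> and \<open>ltr y + g\<close>; the group acts by right translations.\<close>

definition sep :: "'p set \<Rightarrow> 'p \<Rightarrow> 'p \<Rightarrow> bool" where
  "sep C p q \<longleftrightarrow> (p \<in> C) \<noteq> (q \<in> C)"

text \<open>Read from the right, a word is a path from 0, so its last letter is its first edge. The
  half-space is the component beyond the edge from 0 to \<open>ltr y\<close>.\<close>

definition half :: "'a letter \<Rightarrow> 'a fg set" where
  "half y = {g. g \<noteq> 0 \<and> last (word g) = y}"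

definition tr :: "'g::group_add set \<Rightarrow> 'g \<Rightarrow> 'g set" where
  "tr C g = {p. p - g \<in> C}"

lemma mem_tr [simp]: "p \<in> tr C g \<longleftrightarrow> p - g \<in> C"
  by (simp add: tr_def)

lemma tr_tr: "tr (tr C a) g = tr C (a + g)"
  by (auto simp: group_assoc simp del: add_uminus_conv_diff)

lemma tr_zero [simp]: "tr C 0 = C"
  by auto

lemma sep_tr: "sep (tr C g) p q \<longleftrightarrow> sep C (p - g) (q - g)"
  by (simp add: sep_def)

lemma zero_notin_half [simp]: "0 \<notin> half y"
  by (simp add: half_def)

lemma ltr_in_half [simp]: "ltr z \<in> half y \<longleftrightarrow> z = y"
  by (simp add: half_def)

lemma half_disjoint: "g \<in> half y \<Longrightarrow> g \<in> half z \<Longrightarrow> y = z"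
  by (simp add: half_def)

lemma half_cover: "g \<in> fgs E \<Longrightarrow> g = 0 \<or> (\<exists>y\<in>letters E. g \<in> half y)"
  by (auto simp: half_def fgs_def words_letters intro: last_in_set)

text \<open>In a tree a half-space is entered and left only through its single boundary edge, here
  traversed in one of its two directions.\<close>

lemma sep_half: "sep (half y) g (ltr z + g) \<longleftrightarrow> (g = 0 \<and> z = y) \<or> (g = ltr y \<and> z = inv_letter y)"
proof (cases "word g")
  case Nil
  then show ?thesis by (auto simp: sep_def)
next
  case (Cons x w)
  then have "g \<noteq> 0" by auto
  show ?thesis
  proof (cases "z = inv_letter x")
    case True
    then have w: "word (ltr z + g) = w" using Cons by (simp add: word_ltr_plus)
    show ?thesis
    proof (cases "w = []")
      case True
      then have "g = ltr x" using Cons by (metis word_inject word_ltr)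
      moreover have "ltr z + g = 0" using w True word_eq_Nil_iff by metis
      ultimately show ?thesis using \<open>z = inv_letter x\<close> by (auto simp: sep_def)
    next
      case False
      have "g \<noteq> ltr y" using Cons False by auto
      moreover have "ltr z + g \<noteq> 0" using w False by (metis word_zero)
      ultimately
      show ?thesis using \<open>g \<noteq> 0\<close> Cons w False by (simp add: sep_def half_def)
    qed
  next
    case False
    then have "x \<noteq> inv_letter z" by auto
    then have w: "word (ltr z + g) = z # x # w" using Cons by (simp add: word_ltr_plus)
    then have "ltr z + g \<noteq> 0" by auto
    moreover have "\<not> (g = ltr y \<and> z = inv_letter y)" using Cons False by auto
    ultimately show ?thesis using \<open>g \<noteq> 0\<close> Cons w by (simp add: sep_def half_def)
  qed
qed

lemma sep_sym: "sep C p q \<longleftrightarrow> sep C q p"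
  by (auto simp: sep_def)

lemma sep_refl [simp]: "\<not> sep C p p"
  by (simp add: sep_def)

lemma sep_tr_half: "sep (tr (half y) g) p (ltr z + p) \<longleftrightarrow>
    (p = g \<and> z = y) \<or> (p = ltr y + g \<and> z = inv_letter y)"
proof -
  have "ltr z + p - g = ltr z + (p - g)" by (simp add: group_assoc del: add_uminus_conv_diff)
  then show ?thesis
    by (simp add: sep_tr sep_half diff_eq_eq)
qed

text \<open>The two orientations of an edge give complementary half-spaces: along a path from 0 both
  conditions change at the same steps.\<close>

lemma half_inv: "g \<in> half (inv_letter y) \<longleftrightarrow> g + ltr y \<notin> half y"
proof (induction g rule: fg_induct)
  case (plus z g)
  have "sep (half (inv_letter y)) g (ltr z + g) \<longleftrightarrow> sep (half y) (g + ltr y) (ltr z + (g + ltr y))"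
  proof -
    have "g + ltr y = 0 \<longleftrightarrow> g = - ltr y" by (simp add: eq_neg_iff_add_eq_0)
    moreover have "g + ltr y = ltr y \<longleftrightarrow> g = 0" by (metis add_0 add_right_cancel)
    ultimately show ?thesis unfolding sep_half by (auto simp: ltr_inv)
  qed
  then show ?case using plus by (auto simp: sep_def add.assoc)
qed simp

lemma tr_half_inv: "p \<in> tr (half (inv_letter y)) (ltr y + g) \<longleftrightarrow> p \<notin> tr (half y) g"
  by (simp add: half_inv group_assoc del: add_uminus_conv_diff)

text \<open>The reduced path from 0 to a point of the half-space stays in it after its first edge,
  so a set whose boundary contains no edge of the half-space is constant there.\<close>

lemma half_connected:
  assumes "\<And>g z. g \<in> fgs E \<Longrightarrow> z \<in> letters E \<Longrightarrow> g \<in> half y \<Longrightarrow> ltr z + g \<in> half y \<Longrightarrow> \<not> sep U g (ltr z + g)"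
    and "g \<in> fgs E" "g \<in> half y"
  shows "g \<in> U \<longleftrightarrow> ltr y \<in> U"
  using assms(2,3)
proof (induction g rule: fgs_induct)
  case (plus z g)
  show ?case
  proof (cases "g \<in> half y")
    case True
    then show ?thesis using plus assms(1)[of g z] by (auto simp: sep_def)
  next
    case False
    then have "sep (half y) g (ltr z + g)" using plus by (simp add: sep_def)
    then show ?thesis using False by (auto simp: sep_half)
  qed
qed simp

lemma finite_tr_half_sep: "finite {g. sep (tr (half y) g) p q}"
proof -
  have *: "finite {g. sep (tr (half y) g) p (r + p)}" for r
  proof (induction r rule: fg_induct)
    case (plus z r)
    have "{g. sep (tr (half y) g) p (ltr z + r + p)}
      \<subseteq> {g. sep (tr (half y) g) p (r + p)} \<union> {g. sep (tr (half y) g) (r + p) (ltr z + (r + p))}"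
      by (auto simp: add.assoc sep_def)
    moreover have "{g. sep (tr (half y) g) (r + p) (ltr z + (r + p))} \<subseteq> {r + p, - ltr y + (r + p)}"
      by (auto simp: sep_tr_half)
    ultimately show ?case
      using plus by (meson finite.emptyI finite.insertI finite_UnI finite_subset)
  qed simp
  show ?thesis using *[of "q - p"] by simp
qed

subsection \<open>Nestedness of half-spaces and reduced paths\<close>

lemma plus_minus_assoc: "a + b - c = a + (b - c)" for a :: "'g::group_add"
  by (simp add: group_assoc del: add_uminus_conv_diff)

lemma tr_half_connected:
  assumes "h \<in> fgs E"
    and U: "\<And>p z. p \<in> fgs E \<Longrightarrow> z \<in> letters E \<Longrightarrow> p \<in> tr (half y) h \<Longrightarrow> ltr z + p \<in> tr (half y) h \<Longrightarrow> \<not> sep U p (ltr z + p)"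
    and "p \<in> fgs E" "p \<in> tr (half y) h"
  shows "p \<in> U \<longleftrightarrow> ltr y + h \<in> U"
proof -
  have "p - h \<in> tr U (- h) \<longleftrightarrow> ltr y \<in> tr U (- h)"
  proof (rule half_connected[where E=E])
    fix g z assume *: "g \<in> fgs E" "z \<in> letters E" "g \<in> half y" "ltr z + g \<in> half y"
    have "\<not> sep U (g + h) (ltr z + (g + h))"
      by (rule U) (use * assms(1) in \<open>simp_all add: plus_minus_assoc\<close>)
    then show "\<not> sep (tr U (- h)) g (ltr z + g)" by (simp add: sep_tr add.assoc)
  qed (use assms in auto)
  then show ?thesis by simp
qed

definition cross :: "'p set \<Rightarrow> 'p set \<Rightarrow> 'p set \<Rightarrow> bool" where
  "cross X C A \<longleftrightarrow> (\<exists>p\<in>X. p \<in> C \<and> p \<in> A) \<and> (\<exists>p\<in>X. p \<in> C \<and> p \<notin> A) \<and>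
     (\<exists>p\<in>X. p \<notin> C \<and> p \<in> A) \<and> (\<exists>p\<in>X. p \<notin> C \<and> p \<notin> A)"

lemma half_contained:
  assumes "h \<in> fgs E" "\<not> (g \<in> tr (half z) h \<and> ltr y + g \<in> tr (half z) h)"
  shows "(\<forall>p\<in>fgs E. p \<in> tr (half z) h \<longrightarrow> p \<in> tr (half y) g) \<or>
    (\<forall>p\<in>fgs E. p \<in> tr (half z) h \<longrightarrow> p \<notin> tr (half y) g)"
proof -
  have "p \<in> tr (half y) g \<longleftrightarrow> ltr z + h \<in> tr (half y) g" if "p \<in> fgs E" "p \<in> tr (half z) h" for p
  proof (rule tr_half_connected[OF assms(1) _ that])
    fix p x assume "p \<in> tr (half z) h" "ltr x + p \<in> tr (half z) h"
    with assms(2) show "\<not> sep (tr (half y) g) p (ltr x + p)"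
      by (auto simp: sep_tr_half ltr_inv simp del: mem_tr)
  qed
  then show ?thesis by blast
qed

text \<open>The edge defining one cut cannot have both ends on both sides of the other. A side that
  does not contain the whole edge is connected and lies on one side of that edge, which leaves a
  corner empty.\<close>

lemma half_nested:
  assumes "h \<in> fgs E" "z \<in> letters E"
  shows "\<not> cross (fgs E) (tr (half y) g) (tr (half z) h)"
proof -
  consider "\<not> (g \<in> tr (half z) h \<and> ltr y + g \<in> tr (half z) h)"
    | "\<not> (g \<in> tr (half (inv_letter z)) (ltr z + h) \<and> ltr y + g \<in> tr (half (inv_letter z)) (ltr z + h))"
    unfolding tr_half_inv by blast
  then show ?thesis
  proof cases
    case 1
    then show ?thesis using half_contained[OF assms(1) 1] by (auto simp: cross_def simp del: mem_tr)
  next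
    case 2
    have "ltr z + h \<in> fgs E" using assms by simp
    from half_contained[OF this 2] show ?thesis
      unfolding tr_half_inv by (auto simp: cross_def simp del: mem_tr)
  qed
qed

section \<open>Edges on the reduced path from 0 to a group element\<close>

lemma length_reduce: "length (reduce u) \<le> length u"
proof (induction u)
  case (Cons x u)
  have "length (cons_red x (reduce u)) \<le> Suc (length (reduce u))" by (cases "reduce u") auto
  then show ?case using Cons by (simp add: reduce_def)
qed (simp add: reduce_def)

lemma length_word_plus: "length (word (g + h)) \<le> length (word g) + length (word h)"
  using length_reduce[of "word g @ word h"] by (simp add: plus_fg_def)

lemma length_word_uminus: "length (word (- g)) \<le> length (word g)"
  using length_reduce[of "rev (map inv_letter (word g))"] by (simp add: uminus_fg_def)

lemma word_ConsE:
  assumes "word s = z # w"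
  obtains s' where "s = ltr z + s'" "word s' = w"
proof -
  have "reduced w" using assms reduced_word[of s] by (auto dest: reduced_tl)
  then have "word (of_word w) = w" by (simp add: reduce_reduced)
  moreover have "s = ltr z + of_word w" using assms by (metis of_word_Cons of_word_word)
  ultimately show ?thesis using that by blast
qed

text \<open>A separating edge lies on the reduced path from 0 to \<open>s\<close>, and the vertices
  of that path are the suffixes of the word.\<close>

lemma sep_tr_half_suffix:
  assumes "sep (tr (half y) g) 0 s"
  shows "(\<exists>u. word s = u @ word g) \<and> (\<exists>u. word s = u @ word (ltr y + g))"
  using assms
proof (induction s rule: fg_induct)
  case (plus z s)
  show ?case
  proof (cases "sep (tr (half y) g) 0 s")
    case True
    then show ?thesis using plus by (metis append_Cons)
  next
    case False
    then have "sep (tr (half y) g) s (ltr z + s)" using plus.prems by (auto simp: sep_def)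
    then consider "s = g" "z = y" | "s = ltr y + g" "z = inv_letter y" by (auto simp: sep_tr_half)
    then show ?thesis
    proof cases
      case 1
      then show ?thesis using plus.hyps by (metis append_Cons append_Nil)
    next
      case 2
      then have "ltr z + s = g" by (simp add: ltr_inv)
      then show ?thesis using plus.hyps 2 by (metis append_Cons append_Nil)
    qed
  qed
qed simp

text \<open>A reduced path never recrosses an edge: crossing back would make a longer word a suffix
  of a shorter one.\<close>

lemma sep_tr_half_Cons:
  assumes "word (ltr z + s) = z # word s" "sep (tr (half y) g) 0 s"
  shows "sep (tr (half y) g) 0 (ltr z + s)"
proof (rule ccontr)
  assume "\<not> ?thesis"
  then have "sep (tr (half y) g) s (ltr z + s)" using assms(2) by (auto simp: sep_def)
  then consider "s = g" "z = y" | "s = ltr y + g" "z = inv_letter y" by (auto simp: sep_tr_half)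
  then show False
  proof cases
    case 1
    then obtain u where "word s = u @ word (ltr z + s)" using sep_tr_half_suffix[OF assms(2)] by auto
    then have "length (word s) \<ge> length (word (ltr z + s))" by (metis length_append le_add2)
    then show False using assms(1) by simp
  next
    case 2
    then have "ltr z + s = g" by (simp add: ltr_inv)
    then obtain u where "word s = u @ word (ltr z + s)" using sep_tr_half_suffix[OF assms(2)] by auto
    then have "length (word s) \<ge> length (word (ltr z + s))" by (metis length_append le_add2)
    then show False using assms(1) by simp
  qed
qed

lemma sep_tr_half_append:
  assumes "word s = u @ word v" "sep (tr (half y) g) 0 v"
  shows "sep (tr (half y) g) 0 s"
  using assms(1)
proof (induction u arbitrary: s)
  case Nil
  then have "s = v" by (simp add: word_inject)
  then show ?case using assms(2) by simp
next
  case (Cons z u)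
  then have "word s = z # (u @ word v)" by simp
  then obtain s' where s': "s = ltr z + s'" "word s' = u @ word v" by (rule word_ConsE)
  then show ?case using Cons sep_tr_half_Cons[of z s'] by auto
qed

text \<open>Each edge of the path is counted once for each orientation; this is the source of the
  factor 2 in the weight of a generated subgroup.\<close>

lemma card_sep_pairs:
  "finite {(y, g). sep (tr (half y) g) 0 s} \<and> card {(y, g). sep (tr (half y) g) 0 s} \<le> 2 * length (word s)"
proof (induction s rule: fg_induct)
  case (plus z s)
  let ?A = "\<lambda>s. {(y, g). sep (tr (half y) g) 0 s}"
  have sub: "?A (ltr z + s) \<subseteq> ?A s \<union> {(z, s), (inv_letter z, ltr z + s)}"
  proof
    fix p assume p: "p \<in> ?A (ltr z + s)"
    obtain y g where yg: "p = (y, g)" by (cases p)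
    show "p \<in> ?A s \<union> {(z, s), (inv_letter z, ltr z + s)}"
    proof (cases "(y, g) \<in> {(z, s), (inv_letter z, ltr z + s)}")
      case False
      then have "\<not> sep (tr (half y) g) s (ltr z + s)" by (auto simp: sep_tr_half ltr_inv)
      then show ?thesis using p yg by (auto simp: sep_def)
    qed (use yg in auto)
  qed
  have "card (?A (ltr z + s)) \<le> card (?A s \<union> {(z, s), (inv_letter z, ltr z + s)})"
    by (rule card_mono[OF _ sub]) (use plus in simp)
  also have "\<dots> \<le> card (?A s) + card {(z, s), (inv_letter z, ltr z + s)}" by (rule card_Un_le)
  also have "\<dots> \<le> 2 * length (word s) + 2" using plus by (intro add_mono) (auto simp: card_insert_if)
  finally show ?case using plus finite_subset[OF sub] by simp
qed simp

subsection \<open>Edges of Stallings graphs\<close>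

definition subgp :: "'g::group_add set \<Rightarrow> bool" where
  "subgp J \<longleftrightarrow> 0 \<in> J \<and> (\<forall>a\<in>J. \<forall>b\<in>J. a + b \<in> J) \<and> (\<forall>a\<in>J. - a \<in> J)"

lemma subgpD: "subgp J \<Longrightarrow> 0 \<in> J" "subgp J \<Longrightarrow> a \<in> J \<Longrightarrow> b \<in> J \<Longrightarrow> a + b \<in> J"
  "subgp J \<Longrightarrow> a \<in> J \<Longrightarrow> - a \<in> J"
  by (auto simp: subgp_def)

text \<open>Left addition walks along edges and the group acts from the right, so these sets are the
  vertices of the quotient graph by \<open>J\<close>.\<close>

definition coset :: "'g::group_add \<Rightarrow> 'g set \<Rightarrow> 'g set" where
  "coset g J = (\<lambda>j. g + j) ` J"

lemma mem_coset: "p \<in> coset g J \<longleftrightarrow> - g + p \<in> J"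
  unfolding coset_def by (metis add_minus_cancel imageE imageI minus_add_cancel)

lemma coset_eq_iff: "subgp J \<Longrightarrow> coset g J = coset h J \<longleftrightarrow> - g + h \<in> J"
proof
  assume J: "subgp J" and "coset g J = coset h J"
  moreover have "h \<in> coset h J" using J by (simp add: mem_coset subgpD)
  ultimately show "- g + h \<in> J" by (simp add: mem_coset[symmetric])
next
  assume J: "subgp J" and *: "- g + h \<in> J"
  have "- g + p \<in> J \<longleftrightarrow> - h + p \<in> J" for p
  proof
    assume p: "- g + p \<in> J"
    have "- (- g + h) + (- g + p) \<in> J" by (rule subgpD(2)[OF J subgpD(3)[OF J *] p])
    then show "- h + p \<in> J" by (simp add: minus_add add.assoc)
  next
    assume p: "- h + p \<in> J"
    have "(- g + h) + (- h + p) \<in> J" by (rule subgpD(2)[OF J * p])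
    then show "- g + p \<in> J" by (simp add: add.assoc)
  qed
  then show "coset g J = coset h J" by (auto simp: mem_coset)
qed

lemma coset_plus_right: "subgp J \<Longrightarrow> j \<in> J \<Longrightarrow> coset (g + j) J = coset g J"
  by (subst coset_eq_iff) (auto simp: minus_add add.assoc subgpD)

text \<open>
  With \<open>C\<close> a half-space, \<open>cut_cosets E J K C\<close> is the set of those edges of the given label that
  paths representing elements of \<open>K\<close> traverse in the Stallings graph of \<open>J\<close>.
\<close>

definition cut_cosets :: "'a set \<Rightarrow> 'a fg set \<Rightarrow> 'a fg set \<Rightarrow> 'a fg set \<Rightarrow> 'a fg set set" where
  "cut_cosets E J K C = {coset g J | g. g \<in> fgs E \<and> (\<exists>s\<in>K. sep (tr C g) 0 s)}"

text \<open>Every geometric edge contributes once for each orientation. An infinite set would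
  contribute 0, so weight bounds are always accompanied by finiteness conditions.\<close>

definition weight :: "'a set \<Rightarrow> 'a fg set \<Rightarrow> 'a fg set \<Rightarrow> nat" where
  "weight E J K = (\<Sum>y\<in>letters E. card (cut_cosets E J K (half y)))"

definition carried :: "'a set \<Rightarrow> 'a fg set \<Rightarrow> ('a letter \<Rightarrow> 'a fg set set) \<Rightarrow> 'a fg set" where
  "carried E J T = {s \<in> J. \<forall>y\<in>letters E. \<forall>g\<in>fgs E. sep (tr (half y) g) 0 s \<longrightarrow> coset g J \<in> T y}"

text \<open>The path to \<open>a + b\<close> is contained in the path to \<open>b\<close> followed
  by the translate by \<open>b\<close> of the path to \<open>a\<close>. As \<open>b\<close> is in
  \<open>J\<close>, the translate traverses the same edges modulo \<open>J\<close>.\<close>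

lemma subgp_carried:
  assumes "subgp J" "J \<subseteq> fgs E"
  shows "subgp (carried E J T)"
  unfolding subgp_def
proof (intro conjI ballI)
  show "0 \<in> carried E J T" using assms by (simp add: carried_def subgpD)
next
  fix a b assume a: "a \<in> carried E J T" and b: "b \<in> carried E J T"
  have ab: "a \<in> J" "b \<in> J" "b \<in> fgs E" using a b assms by (auto simp: carried_def)
  have "coset g J \<in> T y" if "y \<in> letters E" "g \<in> fgs E" "sep (tr (half y) g) 0 (a + b)" for y g
  proof (cases "sep (tr (half y) g) 0 b")
    case True
    then show ?thesis using b that by (simp add: carried_def)
  next
    case False
    then have "sep (tr (half y) g) b (a + b)" using that by (auto simp: sep_def)
    then have "sep (tr (half y) (g - b)) 0 a"
      by (simp add: sep_tr group_assoc del: add_uminus_conv_diff)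
    then have "coset (g - b) J \<in> T y" using a that ab by (simp add: carried_def)
    then show ?thesis using coset_plus_right[OF assms(1), of "- b" g] ab assms(1) by (simp add: subgpD)
  qed
  then show "a + b \<in> carried E J T" using ab assms by (simp add: carried_def subgpD)
next
  fix a assume a: "a \<in> carried E J T"
  have ab: "a \<in> J" "a \<in> fgs E" using a assms by (auto simp: carried_def)
  have "coset g J \<in> T y" if "y \<in> letters E" "g \<in> fgs E" "sep (tr (half y) g) 0 (- a)" for y g
  proof -
    have "sep (tr (half y) (g + a)) 0 a" using that(3)
      by (simp add: sep_tr group_assoc sep_sym del: add_uminus_conv_diff)
    then have "coset (g + a) J \<in> T y" using a that ab by (simp add: carried_def)
    then show ?thesis using coset_plus_right[OF assms(1), of a g] ab assms(1) by simp
  qed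
  then show "- a \<in> carried E J T" using ab assms by (simp add: carried_def subgpD)
qed

text \<open>\<open>L\<close> is the subgroup carried by the image of the Stallings graph of \<open>K\<close> in that of \<open>J\<close>.\<close>

lemma ex_carried_subgroup:
  assumes J: "subgp J" "J \<subseteq> fgs E" and K: "K \<subseteq> J"
    and fin: "finite E" "\<And>y. y \<in> letters E \<Longrightarrow> finite (cut_cosets E J K (half y))"
  obtains L where "subgp L" "K \<subseteq> L" "L \<subseteq> J" "weight E L L \<le> weight E J K"
    "\<And>y. y \<in> letters E \<Longrightarrow> finite (cut_cosets E L L (half y))"
proof -
  define L where "L = carried E J (\<lambda>y. cut_cosets E J K (half y))"
  have L: "subgp L" "L \<subseteq> J" unfolding L_def using subgp_carried[OF J] by (auto simp: carried_def)
  have "K \<subseteq> L" using K by (auto simp: L_def carried_def cut_cosets_def)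
  have path: "g \<in> fgs E \<Longrightarrow> y \<in> letters E \<Longrightarrow> s \<in> L \<Longrightarrow> sep (tr (half y) g) 0 s \<Longrightarrow> coset g J \<in> cut_cosets E J K (half y)" for g y s
    by (simp add: L_def carried_def)
  \<comment> \<open>The projection from the vertices of the graph of \<open>L\<close> to those of
    the graph of \<open>J\<close>.\<close>
  define f where "f c = (\<Union>p\<in>c. coset p J)" for c :: "'a fg set"
  have f: "f (coset g L) = coset g J" for g
    unfolding f_def
  proof (intro equalityI subsetI)
    fix x assume "x \<in> (\<Union>p\<in>coset g L. coset p J)"
    then obtain l where "l \<in> L" "x \<in> coset (g + l) J" by (auto simp: coset_def)
    then show "x \<in> coset g J" using L coset_plus_right[OF J(1), of l g] by auto
  next
    fix x assume "x \<in> coset g J"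
    moreover have "g \<in> coset g L" using L by (simp add: mem_coset subgpD)
    ultimately show "x \<in> (\<Union>p\<in>coset g L. coset p J)" by blast
  qed
  \<comment> \<open>Going out along one path of \<open>L\<close> and back along another to an edge
    with the same image in the graph of \<open>J\<close> gives an element of \<open>J\<close>
    carried by the same edges. Hence the projection identifies no two edges traversed by
    \<open>L\<close>.\<close>
  have inL: "- g + h \<in> L" if *: "g \<in> fgs E" "h \<in> fgs E" "y \<in> letters E" "s \<in> L" "sep (tr (half y) g) 0 s"
      "s' \<in> L" "sep (tr (half y) h) 0 s'" "coset g J = coset h J" for g h y s s'
  proof -
    have gh: "- g + h \<in> J" using * coset_eq_iff[OF J(1)] by simp
    have pg: "coset x J \<in> cut_cosets E J K (half z)" if "x \<in> fgs E" "z \<in> letters E" "sep (tr (half z) x) 0 g" for x z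
      using sep_tr_half_suffix[OF *(5)] sep_tr_half_append[OF _ that(3)] path[OF that(1,2) *(4)] by blast
    have ph: "coset x J \<in> cut_cosets E J K (half z)" if "x \<in> fgs E" "z \<in> letters E" "sep (tr (half z) x) 0 h" for x z
      using sep_tr_half_suffix[OF *(7)] sep_tr_half_append[OF _ that(3)] path[OF that(1,2) *(6)] by blast
    have "coset x J \<in> cut_cosets E J K (half z)" if x: "x \<in> fgs E" "z \<in> letters E" "sep (tr (half z) x) 0 (- g + h)" for x z
    proof (cases "sep (tr (half z) x) 0 h")
      case False
      then have "sep (tr (half z) x) h (- g + h)" using x(3) by (auto simp: sep_def)
      then have "sep (tr (half z) (x - h + g)) 0 g"
        by (simp add: sep_tr group_assoc sep_sym del: add_uminus_conv_diff)
      then have "coset (x - h + g) J \<in> cut_cosets E J K (half z)" by (intro pg) (use * x in auto)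
      moreover have "- h + g \<in> J" using subgpD(3)[OF J(1) gh] by (simp add: minus_add)
      ultimately show ?thesis using coset_plus_right[OF J(1), of "- h + g" x]
        by (simp add: group_assoc del: add_uminus_conv_diff)
    qed (use ph x in blast)
    then show ?thesis using gh by (simp add: L_def carried_def)
  qed
  have inj: "inj_on f (cut_cosets E L L (half y))" if "y \<in> letters E" for y
  proof (rule inj_onI)
    fix c d assume "c \<in> cut_cosets E L L (half y)" "d \<in> cut_cosets E L L (half y)" "f c = f d"
    then obtain g s h s' where *: "g \<in> fgs E" "h \<in> fgs E" "s \<in> L" "sep (tr (half y) g) 0 s"
      "s' \<in> L" "sep (tr (half y) h) 0 s'" "coset g J = coset h J" "c = coset g L" "d = coset h L"
      unfolding cut_cosets_def by (smt (verit, best) f mem_Collect_eq)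
    then show "c = d" using inL[OF *(1,2) that *(3-7)] coset_eq_iff[OF L(1)] by simp
  qed
  have im: "f ` cut_cosets E L L (half y) \<subseteq> cut_cosets E J K (half y)" if "y \<in> letters E" for y
    using path[OF _ that] by (auto simp: cut_cosets_def[of E L] f)
  have "card (cut_cosets E L L (half y)) \<le> card (cut_cosets E J K (half y))" if "y \<in> letters E" for y
    using card_inj_on_le[OF inj[OF that] im[OF that] fin(2)[OF that]] .
  then have "weight E L L \<le> weight E J K" unfolding weight_def by (rule sum_mono)
  moreover have "finite (cut_cosets E L L (half y))" if "y \<in> letters E" for y
    using inj_on_finite[OF inj[OF that] im[OF that] fin(2)[OF that]] .
  ultimately show ?thesis using that L \<open>K \<subseteq> L\<close> by blast
qed

subsection \<open>Subgroups of bounded weight\<close>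

lemma finite_letters: "finite E \<Longrightarrow> finite (letters E)"
  by (simp add: letters_def)

text \<open>Schreier's method: at most \<open>M\<close> oriented edges leave at most
  \<open>M + 1\<close> vertices, each joined to the base vertex by a path of length at most
  \<open>M\<close>. The loops formed by a representative, one edge and the way back have length at
  most \<open>2 * M + 1\<close> and generate.\<close>

lemma bounded_weight_short:
  assumes J: "subgp J" "J \<subseteq> fgs E" and fin: "finite E" "\<And>y. y \<in> letters E \<Longrightarrow> finite (cut_cosets E J J (half y))"
    and w: "weight E J J \<le> M" and G: "subgp G" "\<And>s. s \<in> J \<Longrightarrow> length (word s) \<le> 2 * M + 1 \<Longrightarrow> s \<in> G"
  shows "J \<subseteq> G"
proof -
  \<comment> \<open>The path from 0 to \<open>v\<close> projects into the part of the Stallings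
    graph that is traversed by elements of \<open>J\<close>.\<close>
  define good where "good v \<longleftrightarrow> v \<in> fgs E \<and> (\<forall>y\<in>letters E. \<forall>g\<in>fgs E. sep (tr (half y) g) 0 v \<longrightarrow> coset g J \<in> cut_cosets E J J (half y))" for v
  have good_J: "good s" if "s \<in> J" for s using that J by (auto simp: good_def cut_cosets_def)
  have good_suffix: "good v" if "good s" "word s = u @ word v" for s u v
    using that sep_tr_half_append[OF that(2)] by (auto simp: good_def fgs_def words_letters)
  define D where "D = (SIGMA y:letters E. cut_cosets E J J (half y))"
  have D: "finite D" "card D \<le> M"
    using w finite_letters[OF fin(1)] fin(2) by (auto simp: D_def weight_def card_SigmaI)
  \<comment> \<open>The vertices of that part: the base vertex and the end of every oriented
    edge.\<close>
  define P where "P = insert (coset 0 J) ((\<lambda>(y, c). (\<lambda>p. ltr y + p) ` c) ` D)"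
  have P: "finite P" "card P \<le> M + 1"
    using D card_image_le[OF D(1), of "\<lambda>(y, c). (\<lambda>p. ltr y + p) ` c"] by (auto simp: P_def card_insert_if)
  have good_P: "coset v J \<in> P" if "good v" for v
  proof (cases "word v")
    case (Cons y w)
    then obtain v' where v': "v = ltr y + v'" "word v' = w" by (rule word_ConsE)
    have mem: "y \<in> letters E" "v' \<in> fgs E" using that Cons v' by (auto simp: good_def fgs_def words_letters)
    have "\<not> sep (tr (half y) v') 0 v'"
    proof
      assume "sep (tr (half y) v') 0 v'"
      then obtain u where "word v' = u @ word v" using sep_tr_half_suffix v' by blast
      then have "length (word v') \<ge> length (word v)" by simp
      then show False using Cons v' by simp
    qed
    moreover have "sep (tr (half y) v') v' v" using v' by (simp add: sep_tr_half)
    ultimately have "sep (tr (half y) v') 0 v" by (auto simp: sep_def)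
    then have "coset v' J \<in> cut_cosets E J J (half y)" using that mem by (simp add: good_def)
    then have "(y, coset v' J) \<in> D" using mem by (simp add: D_def)
    moreover have "coset v J = (\<lambda>p. ltr y + p) ` coset v' J" by (auto simp: coset_def v' image_image add.assoc)
    ultimately show ?thesis unfolding P_def by force
  qed (auto simp: P_def)
  define rp where "rp v = (ARG_MIN (\<lambda>r. length (word r)) r. good r \<and> coset r J = coset v J)" for v
  have rp: "good (rp v)" "coset (rp v) J = coset v J"
    and rp_min: "\<And>r. good r \<Longrightarrow> coset r J = coset v J \<Longrightarrow> length (word (rp v)) \<le> length (word r)" if "good v" for v
    using arg_min_nat_lemma[of "\<lambda>r. good r \<and> coset r J = coset v J" v "\<lambda>r. length (word r)"] that
    unfolding rp_def by auto
  have short: "length (word (rp v)) \<le> M" if "good v" for v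
  proof (rule ccontr)
    let ?w = "word (rp v)"
    let ?s = "\<lambda>i. of_word (drop i ?w)"
    assume "\<not> ?thesis"
    then have len: "length ?w > M" by simp
    have red: "reduced (drop i w)" if "reduced w" for i and w :: "'a word"
      using that
    proof (induction i arbitrary: w)
      case (Suc i)
      then show ?case by (cases w) (auto dest: reduced_tl)
    qed simp
    have ws: "word (?s i) = drop i ?w" for i by (simp add: reduce_reduced red)
    have gs: "good (?s i)" for i
      by (rule good_suffix[OF rp(1)[OF that], of "take i ?w"]) (simp add: reduce_reduced red)
    \<comment> \<open>The path has at least \<open>M + 2\<close> suffixes but only
      \<open>M + 1\<close> vertices to visit. Cutting out the loop between two visits of a vertex
      gives a shorter representative.\<close>
    have "\<not> inj_on (\<lambda>i. coset (?s i) J) {..M+1}"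
    proof
      assume "inj_on (\<lambda>i. coset (?s i) J) {..M+1}"
      then have "card {..M+1} \<le> card P" by (rule card_inj_on_le) (use good_P gs P in auto)
      then show False using P by simp
    qed
    then obtain i j where ij: "i < j" "j \<le> M + 1" "coset (?s i) J = coset (?s j) J"
      unfolding inj_on_def by (metis atMost_iff nat_neq_iff)
    define r where "r = of_word (take i ?w) + ?s j"
    have rpe: "rp v = of_word (take i ?w) + ?s i" by (simp flip: of_word_append)
    have dJ: "- ?s i + ?s j \<in> J" using ij coset_eq_iff[OF J(1)] by blast
    have "- rp v + r = - ?s i + ?s j" unfolding r_def by (subst rpe)
      (simp add: group_assoc del: add_uminus_conv_diff)
    then have cr: "coset r J = coset v J" using dJ rp(2)[OF that] coset_eq_iff[OF J(1), of "rp v" r] by simp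
    have "good r" unfolding good_def
    proof (intro conjI ballI impI)
      have wE: "\<forall>x\<in>set ?w. x \<in> letters E" using rp(1)[OF that] by (auto simp: good_def fgs_def words_letters)
      have inF: "of_word (take i ?w) \<in> fgs E" "?s j \<in> fgs E" "?s i \<in> fgs E"
        using wE set_take_subset[of i ?w] set_drop_subset[of i ?w] set_drop_subset[of j ?w]
        unfolding words_letters lists_eq_set
        by (intro of_word_in_fgs; unfold words_letters lists_eq_set; blast)+
      then show "r \<in> fgs E" by (simp add: r_def)
      fix y g assume yg: "y \<in> letters E" "g \<in> fgs E" "sep (tr (half y) g) 0 r"
      show "coset g J \<in> cut_cosets E J J (half y)"
      proof (cases "sep (tr (half y) g) 0 (?s j)")
        case True
        then show ?thesis using gs yg by (simp add: good_def)
      next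
        case False
        then have "sep (tr (half y) g) (?s j) r" using yg by (auto simp: sep_def)
        then have *: "sep (tr (half y) (g - ?s j + ?s i)) (?s i) (rp v)"
          by (subst rpe) (simp add: r_def sep_tr group_assoc del: add_uminus_conv_diff)
        have "sep (tr (half y) (g - ?s j + ?s i)) 0 (rp v)"
        proof (rule ccontr)
          assume n: "\<not> ?thesis"
          then have "sep (tr (half y) (g - ?s j + ?s i)) 0 (?s i)" using * by (auto simp: sep_def)
          then have "sep (tr (half y) (g - ?s j + ?s i)) 0 (rp v)"
            by (rule sep_tr_half_append[rotated, of _ _ _ _ "take i ?w"]) (simp add: reduce_reduced red)
          then show False using n by simp
        qed
        then have "coset (g - ?s j + ?s i) J \<in> cut_cosets E J J (half y)"
          using rp(1)[OF that] yg inF by (simp add: good_def)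
        moreover have "- ?s j + ?s i \<in> J" using subgpD(3)[OF J(1) dJ] by (simp add: minus_add)
        ultimately show ?thesis using coset_plus_right[OF J(1), of "- ?s j + ?s i" g]
          by (simp add: group_assoc del: add_uminus_conv_diff)
      qed
    qed
    from rp_min[OF that this cr] have "length ?w \<le> length (word r)" .
    also have "\<dots> \<le> length (take i ?w @ drop j ?w)"
      unfolding r_def of_word_append[symmetric] word_of_word by (rule length_reduce)
    also have "\<dots> < length ?w" using ij len by simp
    finally show False by simp
  qed
  have main: "good v \<Longrightarrow> - rp v + v \<in> G" for v
  proof (induction v rule: fg_induct)
    case zero
    have "length (word (rp 0)) \<le> length (word (0 :: 'a fg))" by (rule rp_min) (use zero in auto)
    then have "rp 0 = 0" by simp
    then show ?case using G by (simp add: subgpD)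
  next
    case (plus y v)
    have gv: "good v" by (rule good_suffix[OF plus.prems, of "[y]"]) (simp add: plus.hyps)
    \<comment> \<open>The Schreier generator belonging to the last edge of the path; the remaining
      factor is covered by induction.\<close>
    let ?t = "- rp (ltr y + v) + (ltr y + rp v)"
    have "- (ltr y + v) + (ltr y + rp v) = - v + rp v"
      by (simp add: group_assoc del: add_uminus_conv_diff)
    moreover have "- v + rp v \<in> J" using rp(2)[OF gv] coset_eq_iff[OF J(1)] by metis
    ultimately have "coset (ltr y + v) J = coset (ltr y + rp v) J" using coset_eq_iff[OF J(1)] by metis
    then have "?t \<in> J" using rp(2)[OF plus.prems] coset_eq_iff[OF J(1)] by metis
    moreover have "length (word ?t) \<le> 2 * M + 1"
    proof -
      have "length (word ?t) \<le> length (word (- rp (ltr y + v))) + (length (word (ltr y)) + length (word (rp v)))"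
        by (meson length_word_plus add_left_mono order_trans)
      also have "\<dots> \<le> M + (1 + M)"
        using length_word_uminus[of "rp (ltr y + v)"] short[OF plus.prems] short[OF gv] by simp
      finally show ?thesis by simp
    qed
    ultimately have "?t \<in> G" by (rule G(2))
    then have "?t + (- rp v + v) \<in> G" using plus.IH[OF gv] G(1) by (simp add: subgpD)
    then show ?case by (simp add: add.assoc)
  qed
  show ?thesis
  proof
    fix s assume s: "s \<in> J"
    have "length (word (rp s)) \<le> length (word (0 :: 'a fg))"
      by (rule rp_min) (use s good_J coset_eq_iff[OF J(1)] subgpD(1)[OF J(1)] subgpD(3)[OF J(1)] in auto)
    then have "rp s = 0" by simp
    then show "s \<in> G" using main[OF good_J[OF s]] by simp
  qed
qed

section \<open>Whitehead moves\<close>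

subsection \<open>Homomorphisms and Whitehead automorphisms\<close>

lemma inv_letter_Pair [simp]: "inv_letter (e, s) = (e, \<not> s)"
  by (simp add: inv_letter_def)

lemma fst_inv_letter [simp]: "fst (inv_letter y) = fst y"
  by (simp add: inv_letter_def)

lemma fst_eq_letter: "fst z = fst y \<longleftrightarrow> z = y \<or> z = inv_letter y"
  by (cases z; cases y) auto

definition lift_letter :: "('a \<Rightarrow> 'g::group_add) \<Rightarrow> 'a letter \<Rightarrow> 'g" where
  "lift_letter f y = (if snd y then f (fst y) else - f (fst y))"

definition lift :: "('a \<Rightarrow> 'g::group_add) \<Rightarrow> 'a fg \<Rightarrow> 'g" where
  "lift f g = foldr (\<lambda>y r. lift_letter f y + r) (word g) 0"

lemma lift_letter_inv: "lift_letter f (inv_letter y) = - lift_letter f y"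
  by (simp add: lift_letter_def inv_letter_def)

lemma lift_zero [simp]: "lift f 0 = 0"
  by (simp add: lift_def)

lemma lift_ltr [simp]: "lift f (ltr y) = lift_letter f y"
  by (simp add: lift_def)

lemma lift_ltr_plus: "lift f (ltr y + g) = lift_letter f y + lift f g"
proof (cases "word g")
  case (Cons x w)
  then show ?thesis
    by (auto simp: lift_def word_ltr_plus lift_letter_inv simp flip: add.assoc)
qed (simp add: lift_def word_ltr_plus)

lemma lift_plus: "lift f (g + h) = lift f g + lift f h"
proof (induction g rule: fg_induct)
  case (plus y g)
  then show ?case by (simp add: lift_ltr_plus add.assoc)
qed simp

lemma lift_uminus: "lift f (- g) = - lift f g"
  by (metis add_eq_0_iff2 add.left_inverse lift_plus lift_zero minus_unique neg_eq_iff_add_eq_0)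

lemma lift_minus: "lift f (g - h) = lift f g - lift f h"
  by (simp add: diff_conv_add_uminus lift_plus lift_uminus del: add_uminus_conv_diff)

lemma lift_in_subgp:
  assumes "subgp S" "\<And>e. e \<in> E \<Longrightarrow> f e \<in> S" "g \<in> fgs E"
  shows "lift f g \<in> S"
  using assms(3)
proof (induction g rule: fgs_induct)
  case (plus y g)
  then have "lift_letter f y \<in> S"
    using assms by (auto simp: lift_letter_def letters_def subgpD)
  then show ?case using plus assms(1) by (simp add: lift_ltr_plus subgpD)
qed (use assms in \<open>simp add: subgpD\<close>)

lemma subgp_fgs: "subgp (fgs E)"
  by (simp add: subgp_def)

lemma lift_lift_id:
  assumes "\<And>e. e \<in> E \<Longrightarrow> lift f (f' e) = ltr (e, True)" "g \<in> fgs E"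
  shows "lift f (lift f' g) = g"
  using assms(2)
proof (induction g rule: fgs_induct)
  case (plus y g)
  have "lift f (lift_letter f' y) = ltr y"
    using plus(1) assms(1) ltr_inv[of "(fst y, True)"]
    by (cases y) (auto simp: lift_letter_def lift_uminus letters_def inv_letter_def)
  then show ?case using plus by (simp add: lift_ltr_plus lift_plus)
qed simp

lemma minus_add_eq_iff: "- a + c = d \<longleftrightarrow> c = a + d" for a :: "'g::group_add"
  by (metis add_minus_cancel minus_add_cancel)

definition lif :: "bool \<Rightarrow> 'a letter \<Rightarrow> 'a fg" where
  "lif P b = (if P then ltr b else 0)"

text \<open>\<open>X\<close> is a set of directions at a vertex. A letter leaving in a direction of
  \<open>X\<close> walks \<open>- ltr b\<close> first; a letter whose direction back, at its far
  end, is in \<open>X\<close> walks \<open>ltr b\<close> afterwards. The two ends of a letter are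
  treated independently.\<close>

definition wh :: "'a letter set \<Rightarrow> 'a letter \<Rightarrow> 'a \<Rightarrow> 'a fg" where
  "wh X b e = (if e = fst b then ltr (e, True)
     else lif ((e, False) \<in> X) b + ltr (e, True) - lif ((e, True) \<in> X) b)"

lemma lift_letter_wh:
  "lift_letter (wh X b) y = (if fst y = fst b then ltr y
     else lif (inv_letter y \<in> X) b + ltr y - lif (y \<in> X) b)"
  using ltr_inv[of "(fst y, True)"]
  by (cases y) (auto simp: lift_letter_def wh_def inv_letter_def group_assoc
      simp del: add_uminus_conv_diff)

lemma lift_wh_lif: "lift (wh X b) (lif P b) = lif P b"
  by (simp add: lif_def lift_letter_wh)

lemma lif_inv: "lif P (inv_letter b) = - lif P b"
  by (simp add: lif_def ltr_inv)

lemma lift_wh_wh_inv: "lift (wh X b) (lift (wh X (inv_letter b)) g) = g"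
proof (rule lift_lift_id[where E=UNIV])
  fix e
  show "lift (wh X b) (wh X (inv_letter b) e) = ltr (e, True)"
  proof (cases "e = fst b")
    case False
    then have "wh X (inv_letter b) e = - lif ((e, False) \<in> X) b + ltr (e, True) + lif ((e, True) \<in> X) b"
      by (simp add: wh_def lif_inv)
    then show ?thesis using False
      by (simp add: lift_plus lift_uminus lift_wh_lif lift_letter_wh)
        (simp add: group_assoc del: add_uminus_conv_diff)
  qed (simp add: wh_def lift_letter_wh)
qed (simp add: fgs_def words_def)

lemma lift_wh_inv_wh: "lift (wh X (inv_letter b)) (lift (wh X b) g) = g"
  using lift_wh_wh_inv[of X "inv_letter b"] by simp

lemma lift_wh_fgs:
  assumes "b \<in> letters E" "g \<in> fgs E"
  shows "lift (wh X b) g \<in> fgs E"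
proof (rule lift_in_subgp[OF subgp_fgs _ assms(2)])
  fix e assume "e \<in> E"
  then have "ltr (e, True) \<in> fgs E" by (simp add: letters_def)
  then show "wh X b e \<in> fgs E" using assms by (auto simp: wh_def lif_def)
qed

section \<open>The effect of a Whitehead automorphism on half-spaces\<close>

definition halves :: "'a letter set \<Rightarrow> 'a fg set" where
  "halves X = (\<Union>y\<in>X. half y)"

lemma sep_halves: "sep (halves X) q (ltr z + q) \<longleftrightarrow> (q = 0 \<and> z \<in> X) \<or> (q = - ltr z \<and> inv_letter z \<in> X)"
proof -
  have mem: "p \<in> halves X \<longleftrightarrow> p \<noteq> 0 \<and> last (word p) \<in> X" for p
    by (auto simp: halves_def half_def)
  show ?thesis
  proof (cases "q = 0 \<or> q = - ltr z")
    case True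
    then show ?thesis
    proof
      assume "q = - ltr z"
      then have "q = ltr (inv_letter z)" "ltr z + q = 0" by (simp_all add: ltr_inv)
      then show ?thesis by (simp add: sep_def mem ltr_inv) (metis ltr_inv word_ltr last.simps)
    qed (auto simp: sep_def mem)
  next
    case False
    then have "ltr z + q \<noteq> 0" by (metis minus_unique)
    have "\<not> sep (half (last (word q))) q (ltr z + q)"
      using False by (auto simp: sep_half ltr_inv)
    then show ?thesis using False \<open>ltr z + q \<noteq> 0\<close> by (auto simp: sep_def mem half_def)
  qed
qed

text \<open>The cut \<open>halves X\<close> becomes the cut at an edge labelled \<open>b\<close> of
  the new basis: along the image of any other letter the crossings of its boundary cancel in pairs,
  because of the inserted steps.\<close>

lemma wh_halves:
  assumes b: "b \<in> X" "inv_letter b \<notin> X"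
  shows "lift (wh X b) p \<in> halves X \<longleftrightarrow> p \<in> half b"
proof (induction p rule: fg_induct)
  case zero
  then show ?case by (simp add: halves_def)
next
  case (plus z p)
  define q where "q = lift (wh X b) p"
  have inj: "q = lift (wh X b) r \<longleftrightarrow> p = r" for r
    unfolding q_def by (metis lift_wh_inv_wh)
  have q0: "q = 0 \<longleftrightarrow> p = 0" using inj[of 0] by simp
  have qb: "q = ltr b \<longleftrightarrow> p = ltr b" using inj[of "ltr b"] by (simp add: lift_letter_wh)
  have "sep (halves X) q (lift_letter (wh X b) z + q) \<longleftrightarrow> sep (half b) p (ltr z + p)"
  proof (cases "fst z = fst b")
    case True
    then consider "z = b" | "z = inv_letter b" by (auto simp: fst_eq_letter)
    then show ?thesis
    proof cases
      case 2
      have "- ltr (inv_letter b) = ltr b" by (simp add: ltr_inv)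
      then show ?thesis using 2 b q0 qb by (auto simp: lift_letter_wh sep_halves sep_half)
    qed (use b q0 in \<open>auto simp: lift_letter_wh sep_halves sep_half\<close>)
  next
    case False
    \<comment> \<open>The image of the letter \<open>z\<close> is a path of at most three edges,
      from \<open>q\<close> through \<open>q1\<close> and \<open>q2\<close>. A crossing on the
      middle edge is undone by one on the first or on the last edge.\<close>
    define q1 where "q1 = - lif (z \<in> X) b + q"
    define q2 where "q2 = ltr z + q1"
    have e: "lift_letter (wh X b) z + q = lif (inv_letter z \<in> X) b + q2"
      using False by (simp add: lift_letter_wh q1_def q2_def group_assoc del: add_uminus_conv_diff)
    have s1: "sep (halves X) q q1 \<longleftrightarrow> z \<in> X \<and> q1 = 0"
    proof (cases "z \<in> X")
      case True
      have "sep (halves X) q (ltr (inv_letter b) + q) \<longleftrightarrow> q = ltr b"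
        unfolding sep_halves using b by (simp add: ltr_inv)
      moreover have "q1 = ltr (inv_letter b) + q" using True by (simp add: q1_def lif_def ltr_inv)
      moreover have "q1 = 0 \<longleftrightarrow> q = ltr b" using True by (simp add: q1_def lif_def add_eq_0_iff2) (metis neg_equal_iff_equal minus_minus)
      ultimately show ?thesis using True by simp
    qed (simp add: q1_def lif_def)
    have s2: "sep (halves X) q1 q2 \<longleftrightarrow> (q1 = 0 \<and> z \<in> X) \<or> (q1 = - ltr z \<and> inv_letter z \<in> X)"
      unfolding q2_def by (rule sep_halves)
    have s3: "sep (halves X) q2 (lif (inv_letter z \<in> X) b + q2) \<longleftrightarrow> inv_letter z \<in> X \<and> q1 = - ltr z"
    proof (cases "inv_letter z \<in> X")
      case True
      have "sep (halves X) q2 (ltr b + q2) \<longleftrightarrow> q2 = 0" unfolding sep_halves using b by simp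
      moreover have "q2 = 0 \<longleftrightarrow> q1 = - ltr z" unfolding q2_def by (metis add.right_inverse minus_unique)
      ultimately show ?thesis using True by (simp add: lif_def)
    qed (simp add: lif_def)
    have "\<not> sep (halves X) q (lift_letter (wh X b) z + q)"
    proof (cases "q1 = 0")
      case True
      then have "q1 \<noteq> - ltr z" by (metis ltr_neq_zero(1) neg_equal_0_iff_equal)
      then show ?thesis using s1 s2 s3 True unfolding e by (auto simp: sep_def)
    next
      case False
      then show ?thesis using s1 s2 s3 unfolding e by (auto simp: sep_def)
    qed
    moreover have "\<not> sep (half b) p (ltr z + p)" using False by (auto simp: sep_half)
    ultimately show ?thesis by simp
  qed
  then show ?case using plus.IH unfolding lift_ltr_plus q_def[symmetric] by (auto simp: sep_def)
qed

text \<open>The inserted steps never cross \<open>half y\<close>, as their letter differs from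
  \<open>y\<close>. If \<open>y\<close> is in \<open>X\<close>, the \<open>y\<close>-edge in the
  image of \<open>ltr y\<close> starts at \<open>- ltr b\<close> instead of 0, which accounts for
  the shift.\<close>

lemma wh_half:
  assumes y: "fst y \<noteq> fst b"
  shows "lift (wh X b) p + lif (y \<in> X) b \<in> half y \<longleftrightarrow> p \<in> half y"
proof (induction p rule: fg_induct)
  case zero
  then show ?case using y by (auto simp: lif_def)
next
  case (plus z p)
  define q where "q = lift (wh X b) p"
  let ?l = "lif (y \<in> X) b"
  have inj: "q = lift (wh X b) r \<longleftrightarrow> p = r" for r
    unfolding q_def by (metis lift_wh_inv_wh)
  have nob: "\<not> sep (half y) r (lif P b + r)" "\<not> sep (half y) r (- lif P b + r)" for r P
    using y sep_half[of y r b] sep_half[of y r "inv_letter b"]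
    by (auto simp: lif_def ltr_inv)
  have "sep (half y) (q + ?l) (lift_letter (wh X b) z + (q + ?l)) \<longleftrightarrow> sep (half y) p (ltr z + p)"
  proof (cases "fst z = fst b")
    case True
    then have "z \<noteq> y" "z \<noteq> inv_letter y" using y by auto
    then show ?thesis using True by (simp add: lift_letter_wh sep_half)
  next
    case False
    define q1 where "q1 = - lif (z \<in> X) b + (q + ?l)"
    have e: "lift_letter (wh X b) z + (q + ?l) = lif (inv_letter z \<in> X) b + (ltr z + q1)"
      using False by (simp add: lift_letter_wh q1_def group_assoc del: add_uminus_conv_diff)
    have "sep (half y) (q + ?l) (lift_letter (wh X b) z + (q + ?l)) \<longleftrightarrow> sep (half y) q1 (ltr z + q1)"
      unfolding e using nob(2)[of "q + ?l" "z \<in> X"] nob(1)[of "ltr z + q1" "inv_letter z \<in> X"]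
      unfolding q1_def[symmetric] by (auto simp: sep_def)
    also have "\<dots> \<longleftrightarrow> (q1 = 0 \<and> z = y) \<or> (q1 = ltr y \<and> z = inv_letter y)" by (rule sep_half)
    also have "q1 = 0 \<and> z = y \<longleftrightarrow> p = 0 \<and> z = y"
    proof -
      have "- ?l + (q + ?l) = 0 \<longleftrightarrow> q = 0"
        unfolding minus_add_eq_iff by (metis add.right_neutral add_0 add_right_cancel)
      then show ?thesis using inj[of 0] by (auto simp: q1_def)
    qed
    also have "q1 = ltr y \<and> z = inv_letter y \<longleftrightarrow> p = ltr y \<and> z = inv_letter y"
    proof -
      have "- lif (inv_letter y \<in> X) b + (q + ?l) = ltr y \<longleftrightarrow> q = lif (inv_letter y \<in> X) b + ltr y - ?l"
        unfolding minus_add_eq_iff by (metis add_diff_cancel diff_add_cancel)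
      also have "\<dots> \<longleftrightarrow> p = ltr y" using inj[of "ltr y"] y by (simp add: lift_letter_wh)
      finally show ?thesis by (auto simp: q1_def)
    qed
    finally show ?thesis by (simp add: sep_half)
  qed
  then show ?case using plus.IH unfolding lift_ltr_plus q_def[symmetric] by (auto simp: sep_def add.assoc)
qed

text \<open>The edge cuts of the new basis as seen in the old one, up to translation; only the pair
  belonging to \<open>b\<close> changes.\<close>

definition new_cut :: "'a letter set \<Rightarrow> 'a letter \<Rightarrow> 'a letter \<Rightarrow> 'a fg set" where
  "new_cut X b y = (if y = b then halves X else if y = inv_letter b then - halves X else half y)"

lemma wh_new_cut:
  assumes b: "b \<in> X" "inv_letter b \<notin> X" "b \<in> letters E"
  obtains a where "a \<in> fgs E" "\<And>p. lift (wh X b) p \<in> tr (new_cut X b y) a \<longleftrightarrow> p \<in> half y"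
proof -
  consider "y = b" | "y = inv_letter b" "y \<noteq> b" | "fst y \<noteq> fst b"
    by (auto simp: fst_eq_letter)
  then show ?thesis
  proof cases
    case 1
    then show ?thesis using wh_halves[OF b(1,2)] that[of 0] by (simp add: new_cut_def)
  next
    case 2
    have "lift (wh X b) p \<in> tr (new_cut X b y) (- ltr b) \<longleftrightarrow> p \<in> half y" for p
      using 2 wh_halves[OF b(1,2), of "p + ltr b"]
      by (simp add: new_cut_def half_inv lift_plus lift_letter_wh)
    then show ?thesis using that[of "- ltr b"] b by simp
  next
    case 3
    then have "lift (wh X b) p \<in> tr (new_cut X b y) (- lif (y \<in> X) b) \<longleftrightarrow> p \<in> half y" for p
      using wh_half[of y b X p] by (auto simp: new_cut_def)
    then show ?thesis using that[of "- lif (y \<in> X) b"] b by (simp add: lif_def)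
  qed
qed

subsection \<open>Crossing\<close>

lemma cross_cong:
  assumes "\<And>p. p \<in> X \<Longrightarrow> p \<in> C \<longleftrightarrow> p \<in> C'" "\<And>p. p \<in> X \<Longrightarrow> p \<in> A \<longleftrightarrow> p \<in> A'"
  shows "cross X C A \<longleftrightarrow> cross X C' A'"
  using assms unfolding cross_def by (simp cong: bex_cong)

lemma cross_compl_left [simp]: "cross X (- C) A \<longleftrightarrow> cross X C A"
  by (auto simp: cross_def)

lemma cross_compl_right [simp]: "cross X C (- A) \<longleftrightarrow> cross X C A"
  by (auto simp: cross_def)

lemma cross_bij:
  assumes "f ` X = Y" "\<And>p. p \<in> X \<Longrightarrow> f p \<in> C' \<longleftrightarrow> p \<in> C" "\<And>p. p \<in> X \<Longrightarrow> f p \<in> A' \<longleftrightarrow> p \<in> A"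
  shows "cross Y C' A' \<longleftrightarrow> cross X C A"
proof -
  have "cross (f ` X) C' A' \<longleftrightarrow> cross X C A" using assms(2,3) unfolding cross_def by (simp cong: bex_cong)
  then show ?thesis using assms(1) by simp
qed

text \<open>If the difference crossed \<open>B\<close>, then \<open>U\<close> would meet both sides
  of \<open>B\<close>, so its complement would lie on one side. The point of \<open>h\<close>
  outside \<open>U\<close> would put \<open>h\<close> on that same side, and the other side would
  miss the complement of the difference.\<close>

lemma cross_diff:
  assumes "\<not> cross X U B" "\<not> cross X h B" "\<exists>p\<in>X. p \<in> h \<and> p \<notin> U"
  shows "\<not> cross X (U - h) B"
  using assms unfolding cross_def by blast

lemma cross_Un:
  assumes "\<not> cross X U B" "\<not> cross X h B" "\<exists>p\<in>X. p \<in> h \<and> p \<in> U"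
  shows "\<not> cross X (U \<union> h) B"
proof -
  have "\<not> cross X (- U - h) B" by (rule cross_diff) (use assms in auto)
  moreover have "U \<union> h = - (- U - h)" by auto
  ultimately show ?thesis by (metis cross_compl_left)
qed

definition mixed :: "'p set \<Rightarrow> 'p set \<Rightarrow> 'p set \<Rightarrow> bool" where
  "mixed X C A \<longleftrightarrow> (\<exists>p\<in>X. p \<in> C \<and> p \<in> A) \<and> (\<exists>p\<in>X. p \<in> C \<and> p \<notin> A)"

lemma cross_mixed: "cross X C A \<longleftrightarrow> mixed X C A \<and> mixed X (- C) A"
  by (auto simp: cross_def mixed_def)

definition bdry :: "'a set \<Rightarrow> 'a fg set \<Rightarrow> 'a fg set" where
  "bdry E A = {g \<in> fgs E. \<exists>z\<in>letters E. sep A g (ltr z + g)}"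

lemma finite_bdry:
  assumes "finite E" "\<And>q. q \<in> fgs E \<Longrightarrow> finite {g \<in> fgs E. sep A g (q + g)}"
  shows "finite (bdry E A)"
proof -
  have "bdry E A = (\<Union>z\<in>letters E. {g \<in> fgs E. sep A g (ltr z + g)})" by (auto simp: bdry_def)
  then show ?thesis using assms by (simp add: finite_letters)
qed

lemma mixed_bdry:
  assumes "h \<in> fgs E" "mixed (fgs E) (tr (half y) h) A"
  shows "\<exists>p\<in>bdry E A. p \<in> tr (half y) h"
proof (rule ccontr)
  assume "\<not> ?thesis"
  then have "p \<in> A \<longleftrightarrow> ltr y + h \<in> A" if "p \<in> fgs E" "p \<in> tr (half y) h" for p
    by (intro tr_half_connected[OF assms(1) _ that]) (auto simp: bdry_def simp del: mem_tr)
  then show False using assms(2) by (auto simp: mixed_def simp del: mem_tr)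
qed

lemma compl_tr_half: "- tr (half y) g = tr (half (inv_letter y)) (ltr y + g)"
  using tr_half_inv by blast

text \<open>Both sides of a crossing half-space contain boundary vertices of \<open>A\<close>, so it
  separates two members of a finite set.\<close>

lemma finite_cross:
  assumes "finite (bdry E A)" "y \<in> letters E"
  shows "finite {g \<in> fgs E. cross (fgs E) (tr (half y) g) A}"
proof -
  have "\<exists>p\<in>bdry E A. \<exists>q\<in>bdry E A. sep (tr (half y) g) p q"
    if "g \<in> fgs E" "cross (fgs E) (tr (half y) g) A" for g
  proof -
    have m: "mixed (fgs E) (tr (half y) g) A" "mixed (fgs E) (tr (half (inv_letter y)) (ltr y + g)) A"
      using that(2) unfolding cross_mixed compl_tr_half by auto
    have "ltr y + g \<in> fgs E" using that assms(2) by simp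
    then show ?thesis using mixed_bdry[OF that(1) m(1)] mixed_bdry[OF _ m(2)]
      unfolding tr_half_inv sep_def by blast
  qed
  then have "{g \<in> fgs E. cross (fgs E) (tr (half y) g) A} \<subseteq> (\<Union>p\<in>bdry E A. \<Union>q\<in>bdry E A. {g. sep (tr (half y) g) p q})"
    by blast
  moreover have "finite (\<Union>p\<in>bdry E A. \<Union>q\<in>bdry E A. {g. sep (tr (half y) g) p q})"
    by (intro finite_UN_I finite_tr_half_sep assms)
  ultimately show ?thesis by (rule finite_subset)
qed

lemma minimal_mixed:
  assumes fin: "finite E" "finite (bdry E A)"
    and y0: "y0 \<in> letters E" "g0 \<in> fgs E" "mixed (fgs E) (tr (half y0) g0) A"
  obtains y g where "y \<in> letters E" "g \<in> fgs E" "mixed (fgs E) (tr (half y) g) A"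
    "tr (half y) g \<inter> fgs E \<subseteq> tr (half y0) g0"
    "\<forall>z\<in>letters E. z \<noteq> inv_letter y \<longrightarrow> \<not> mixed (fgs E) (tr (half z) (ltr y + g)) A"
proof -
  define I where "I = {(y, g). y \<in> letters E \<and> g \<in> fgs E \<and> mixed (fgs E) (tr (half y) g) A \<and>
    tr (half y) g \<inter> fgs E \<subseteq> tr (half y0) g0}"
  define Hs where "Hs = (\<lambda>(y, g). tr (half y) g \<inter> fgs E) ` I"
  \<comment> \<open>Each candidate contains a boundary vertex of \<open>A\<close> and misses
    \<open>g0\<close>, so it separates two vertices from a finite list; this ensures that a minimal
    one exists.\<close>
  have "I \<subseteq> (SIGMA y:letters E. \<Union>p\<in>bdry E A. {g. sep (tr (half y) g) p g0})"
  proof clarify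
    fix a s g assume *: "((a, s), g) \<in> I"
    then have "\<exists>p\<in>bdry E A. p \<in> tr (half (a, s)) g" by (intro mixed_bdry) (auto simp: I_def)
    moreover have "g0 \<notin> tr (half (a, s)) g" using * y0(2) by (auto simp: I_def)
    ultimately show "(a, s) \<in> letters E \<and> g \<in> (\<Union>p\<in>bdry E A. {g. sep (tr (half (a, s)) g) p g0})"
      using * unfolding sep_def I_def by blast
  qed
  moreover have "finite (SIGMA y:letters E. \<Union>p\<in>bdry E A. {g. sep (tr (half y) g) p g0})"
    using fin finite_tr_half_sep finite_letters by (intro finite_SigmaI) auto
  ultimately have "finite I" by (rule finite_subset)
  then have "finite Hs" by (simp add: Hs_def)
  moreover have "tr (half y0) g0 \<inter> fgs E \<in> Hs"
    unfolding Hs_def I_def using y0 by (intro image_eqI[of _ _ "(y0, g0)"]) auto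
  ultimately obtain M where M: "M \<in> Hs" "\<And>M'. M' \<in> Hs \<Longrightarrow> M' \<subseteq> M \<Longrightarrow> M = M'"
    using finite_has_minimal2[of Hs] by metis
  then obtain y g where yg: "y \<in> letters E" "g \<in> fgs E" "mixed (fgs E) (tr (half y) g) A"
    "tr (half y) g \<inter> fgs E \<subseteq> tr (half y0) g0" "M = tr (half y) g \<inter> fgs E"
    by (auto simp: Hs_def I_def)
  have "\<not> mixed (fgs E) (tr (half z) (ltr y + g)) A" if z: "z \<in> letters E" "z \<noteq> inv_letter y" for z
  proof
    assume m: "mixed (fgs E) (tr (half z) (ltr y + g)) A"
    have sub: "tr (half z) (ltr y + g) \<subseteq> tr (half y) g"
      using half_disjoint z(2) tr_half_inv[of _ y g] by fastforce
    then have "tr (half z) (ltr y + g) \<inter> fgs E \<in> Hs"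
      unfolding Hs_def I_def using yg z m by (intro image_eqI[of _ _ "(z, ltr y + g)"]) auto
    then have "tr (half y) g \<inter> fgs E = tr (half z) (ltr y + g) \<inter> fgs E" using M(2) sub yg(5) by blast
    moreover have "ltr y + g \<in> tr (half y) g \<inter> fgs E" using yg by (simp add: plus_minus_assoc)
    moreover have "ltr y + g \<notin> tr (half z) (ltr y + g)" by simp
    ultimately show False by blast
  qed
  then show ?thesis using that yg by blast
qed

text \<open>
  Such a vertex is the inner end of a minimal half-space that meets both sides of \<open>A\<close>.
\<close>

lemma innermost_vertex:
  assumes fin: "finite E" "finite (bdry E A)"
  obtains v where "v \<in> fgs E" "\<forall>z\<in>letters E. \<not> mixed (fgs E) (tr (half z) v) A"
  | v c where "v \<in> fgs E" "c \<in> letters E" "cross (fgs E) (tr (half c) v) A"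
    "\<forall>z\<in>letters E. z \<noteq> c \<longrightarrow> \<not> mixed (fgs E) (tr (half z) v) A"
proof -
  consider (cross) y0 g0 where "y0 \<in> letters E" "g0 \<in> fgs E" "cross (fgs E) (tr (half y0) g0) A"
    | (mixed) y0 g0 where "y0 \<in> letters E" "g0 \<in> fgs E" "mixed (fgs E) (tr (half y0) g0) A"
      "\<And>y g. y \<in> letters E \<Longrightarrow> g \<in> fgs E \<Longrightarrow> \<not> cross (fgs E) (tr (half y) g) A"
    | (none) "\<And>y g. y \<in> letters E \<Longrightarrow> g \<in> fgs E \<Longrightarrow> \<not> mixed (fgs E) (tr (half y) g) A"
    by blast
  then show ?thesis
  proof cases
    case cross
    then have "mixed (fgs E) (tr (half y0) g0) A" by (simp add: cross_mixed)
    from minimal_mixed[OF fin cross(1,2) this] obtain y g where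
      yg: "y \<in> letters E" "g \<in> fgs E" "mixed (fgs E) (tr (half y) g) A"
      "tr (half y) g \<inter> fgs E \<subseteq> tr (half y0) g0"
      "\<forall>z\<in>letters E. z \<noteq> inv_letter y \<longrightarrow> \<not> mixed (fgs E) (tr (half z) (ltr y + g)) A"
      by blast
    \<comment> \<open>Shrinking a half-space enlarges its complement, and the complement of the
      starting half-space is already mixed.\<close>
    have "mixed (fgs E) (- tr (half y) g) A"
      using cross(3) yg(4) unfolding cross_mixed mixed_def by blast
    then have "cross (fgs E) (tr (half (inv_letter y)) (ltr y + g)) A"
      using yg(3) by (simp add: cross_mixed flip: compl_tr_half)
    then show ?thesis using that(2)[of "ltr y + g" "inv_letter y"] yg by simp
  next
    case mixed
    obtain y g where yg: "y \<in> letters E" "g \<in> fgs E" "mixed (fgs E) (tr (half y) g) A"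
      "tr (half y) g \<inter> fgs E \<subseteq> tr (half y0) g0"
      "\<forall>z\<in>letters E. z \<noteq> inv_letter y \<longrightarrow> \<not> mixed (fgs E) (tr (half z) (ltr y + g)) A"
      by (rule minimal_mixed[OF fin mixed(1-3)])
    have "\<not> mixed (fgs E) (tr (half (inv_letter y)) (ltr y + g)) A"
      using mixed(4)[OF yg(1,2)] yg(3) by (simp add: cross_mixed compl_tr_half)
    then have "\<not> mixed (fgs E) (tr (half z) (ltr y + g)) A" if "z \<in> letters E" for z
      using yg(5) that by (cases "z = inv_letter y") auto
    then show ?thesis using that(1)[of "ltr y + g"] yg by simp
  next
    case none
    then show ?thesis using that(1)[of 0] fgs_zero by blast
  qed
qed

subsection \<open>Parity of separating translates\<close>

text \<open>The half-spaces at 0 are disjoint, so each of \<open>p\<close> and \<open>q\<close> lies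
  in at most one of them. Exactly two separating ones occur when \<open>p\<close> and
  \<open>q\<close> are in different members of the union, which then does not separate them.\<close>

lemma odd_sep_halves:
  assumes "finite X"
  shows "sep (halves X) p q \<longleftrightarrow> odd (card {y\<in>X. sep (half y) p q})"
proof -
  define S where "S r = {y\<in>X. r \<in> half y}" for r
  have fin: "finite (S r)" for r using assms by (simp add: S_def)
  have S: "card (S r) = of_bool (r \<in> halves X)" for r
  proof (cases "r \<in> halves X")
    case True
    then obtain y where "y \<in> X" "r \<in> half y" by (auto simp: halves_def)
    then have "S r = {y}" unfolding S_def using half_disjoint by blast
    then show ?thesis using True by simp
  next
    case False
    then have "S r = {}" by (auto simp: S_def halves_def)
    then show ?thesis using False by simp
  qed
  have eq: "{y\<in>X. sep (half y) p q} = (S p - S q) \<union> (S q - S p)" by (auto simp: S_def sep_def)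
  have "card {y\<in>X. sep (half y) p q} = card (S p - S q) + card (S q - S p)"
    unfolding eq by (rule card_Un_disjoint) (use fin in auto)
  moreover have "card (S p) = card (S p - S q) + card (S p \<inter> S q)"
    by (metis card_Diff_subset_Int card_Int_Diff fin add.commute)
  moreover have "card (S q) = card (S q - S p) + card (S p \<inter> S q)"
    by (metis card_Int_Diff fin add.commute Int_commute)
  ultimately have "card {y\<in>X. sep (half y) p q} + 2 * card (S p \<inter> S q) = of_bool (p \<in> halves X) + of_bool (q \<in> halves X)"
    using S[of p] S[of q] by simp
  then have "odd (card {y\<in>X. sep (half y) p q}) \<longleftrightarrow> odd (of_bool (p \<in> halves X) + of_bool (q \<in> halves X) :: nat)"
    by presburger
  then show ?thesis by (auto simp: sep_def)
qed

text \<open>Modulo 2 the translates of \<open>halves X\<close> that separate 0 from \<open>x\<close>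
  number as many as those of all \<open>half y\<close> with \<open>y\<close> in \<open>X\<close>. A
  letter and its inverse describe the same edges, so letters of \<open>X\<close> paired with their
  inverses contribute an even amount.\<close>

lemma ex_unpaired_letter:
  assumes X: "X \<subseteq> letters E" "finite E" "x \<in> fgs E"
    and odd: "odd (card {g\<in>fgs E. sep (tr (halves X) g) 0 x})"
  obtains b g where "b \<in> X" "inv_letter b \<notin> X" "g \<in> fgs E" "sep (tr (half b) g) 0 x"
proof -
  define N where "N y = {g\<in>fgs E. sep (tr (half y) g) 0 x}" for y
  have finN: "finite (N y)" for y
    using finite_tr_half_sep[of y 0 x] by (rule rev_finite_subset) (auto simp: N_def)
  have finX: "finite X" using X finite_letters finite_subset by blast
  define U where "U = (\<Union>y\<in>X. N y)"
  have finU: "finite U" using finX finN by (simp add: U_def)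
  define M where "M = {g\<in>fgs E. sep (tr (halves X) g) 0 x}"
  have M: "g \<in> M \<longleftrightarrow> odd (card {y\<in>X. g \<in> N y})" if "g \<in> fgs E" for g
    using that odd_sep_halves[OF finX, of "0 - g" "x - g"] by (simp add: M_def N_def sep_tr)
  have "M \<subseteq> U"
  proof
    fix g assume g: "g \<in> M"
    then have "card {y\<in>X. g \<in> N y} \<noteq> 0" using M by (metis (no_types, lifting) M_def even_zero mem_Collect_eq)
    then have "{y\<in>X. g \<in> N y} \<noteq> {}" by (metis card.empty)
    then show "g \<in> U" by (auto simp: U_def)
  qed
  have U: "U \<subseteq> fgs E" by (auto simp: U_def N_def)
  have "card M = (\<Sum>g\<in>U. of_bool (g \<in> M))"
    using \<open>M \<subseteq> U\<close> finU by (simp add: sum.If_cases of_bool_def Int_absorb1)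
  also have "even (\<dots> + (\<Sum>g\<in>U. card {y\<in>X. g \<in> N y}))"
    unfolding sum.distrib[symmetric] by (rule dvd_sum) (use M U in auto)
  also have "(\<Sum>g\<in>U. card {y\<in>X. g \<in> N y}) = (\<Sum>y\<in>X. card (N y))"
  proof -
    have "(\<Sum>g\<in>U. card {y\<in>X. g \<in> N y}) = (\<Sum>g\<in>U. \<Sum>y\<in>X. of_bool (g \<in> N y))"
      using finX by (simp add: of_bool_def sum.If_cases Int_def)
    also have "\<dots> = (\<Sum>y\<in>X. \<Sum>g\<in>U. of_bool (g \<in> N y))" by (rule sum.swap)
    also have "\<dots> = (\<Sum>y\<in>X. card (N y))"
    proof (rule sum.cong[OF refl])
      fix y assume "y \<in> X"
      then have "N y \<subseteq> U" by (auto simp: U_def)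
      then show "(\<Sum>g\<in>U. of_bool (g \<in> N y)) = card (N y)"
        using finU by (simp add: sum.If_cases of_bool_def Int_absorb1)
    qed
    finally show ?thesis .
  qed
  finally have odd_sum: "odd (\<Sum>y\<in>X. card (N y))" using odd by (simp add: M_def)
  show ?thesis
  proof (rule ccontr)
    assume "\<not> thesis"
    then have empty: "N b = {}" if "b \<in> X" "inv_letter b \<notin> X" for b
      unfolding N_def
      using \<open>\<not> thesis\<close> that \<open>\<And>b g. \<lbrakk>b \<in> X; inv_letter b \<notin> X; g \<in> fgs E; sep (tr (half b) g) 0 x\<rbrakk> \<Longrightarrow> thesis\<close>
      by blast
    have N_inv: "card (N (inv_letter y)) = card (N y)" if "y \<in> letters E" for y
    proof -
      have "(\<lambda>g. ltr y + g) ` N y = N (inv_letter y)"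
      proof (intro equalityI subsetI)
        fix g assume "g \<in> N (inv_letter y)"
        then show "g \<in> (\<lambda>g. ltr y + g) ` N y" using that
          by (intro image_eqI[of _ _ "- ltr y + g"])
            (use tr_half_inv[of _ y "- ltr y + g"] in \<open>auto simp: N_def sep_def simp del: mem_tr\<close>)
      qed (use that tr_half_inv[of _ y] in \<open>auto simp: N_def sep_def simp del: mem_tr\<close>)
      moreover have "inj_on (\<lambda>g. ltr y + g) (N y)" by (auto simp: inj_on_def)
      ultimately show ?thesis by (metis card_image)
    qed
    define P where "P = {y\<in>X. inv_letter y \<in> X}"
    have finP: "finite P" using finX by (simp add: P_def)
    have "(\<Sum>y\<in>X. card (N y)) = (\<Sum>y\<in>P. card (N y))"
      by (rule sum.mono_neutral_right) (use finX empty in \<open>auto simp: P_def\<close>)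
    also have "\<dots> = (\<Sum>y\<in>{y\<in>P. snd y}. card (N y)) + (\<Sum>y\<in>{y\<in>P. \<not> snd y}. card (N y))"
      by (subst sum.union_disjoint[symmetric]) (use finP in \<open>auto intro!: sum.cong\<close>)
    also have "(\<Sum>y\<in>{y\<in>P. \<not> snd y}. card (N y)) = (\<Sum>y\<in>{y\<in>P. snd y}. card (N y))"
      by (rule sum.reindex_bij_witness[of _ inv_letter inv_letter])
        (use N_inv X in \<open>auto simp: P_def\<close>)
    finally have "(\<Sum>y\<in>X. card (N y)) = 2 * (\<Sum>y\<in>{y\<in>P. snd y}. card (N y))" by simp
    then show False using odd_sum by simp
  qed
qed

subsection \<open>Systems of cuts\<close>

text \<open>
  The cuts \<open>A t\<close> come from the edges labelled \<open>t\<close> of the Cayley tree of another basis;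
  \<open>K\<close> is generated by the remaining elements of that basis.
\<close>

definition cut_system :: "'a set \<Rightarrow> 't set \<Rightarrow> ('t \<Rightarrow> 'a fg set) \<Rightarrow> ('t \<Rightarrow> 'a fg) \<Rightarrow> 'a fg set \<Rightarrow> bool" where
  "cut_system E T A x K \<longleftrightarrow> finite T \<and>
     (\<forall>t\<in>T. \<forall>k\<in>K. \<forall>p\<in>fgs E. k + p \<in> A t \<longleftrightarrow> p \<in> A t) \<and>
     (\<forall>t\<in>T. \<forall>u\<in>T. \<forall>g\<in>fgs E. \<not> cross (fgs E) (tr (A t) g) (A u)) \<and>
     (\<forall>t\<in>T. \<forall>q\<in>fgs E. finite {g\<in>fgs E. sep (A t) g (q + g)}) \<and>
     (\<forall>t\<in>T. x t \<in> fgs E \<and> (\<forall>u\<in>T. \<forall>g\<in>fgs E. sep (tr (A u) g) 0 (x t) \<longleftrightarrow> u = t \<and> g = 0))"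

lemma cut_systemD:
  assumes "cut_system E T A x K"
  shows "finite T"
    "\<And>t k p. t \<in> T \<Longrightarrow> k \<in> K \<Longrightarrow> p \<in> fgs E \<Longrightarrow> k + p \<in> A t \<longleftrightarrow> p \<in> A t"
    "\<And>t u g. t \<in> T \<Longrightarrow> u \<in> T \<Longrightarrow> g \<in> fgs E \<Longrightarrow> \<not> cross (fgs E) (tr (A t) g) (A u)"
    "\<And>t q. t \<in> T \<Longrightarrow> q \<in> fgs E \<Longrightarrow> finite {g\<in>fgs E. sep (A t) g (q + g)}"
    "\<And>t. t \<in> T \<Longrightarrow> x t \<in> fgs E"
    "\<And>t u g. t \<in> T \<Longrightarrow> u \<in> T \<Longrightarrow> g \<in> fgs E \<Longrightarrow> sep (tr (A u) g) 0 (x t) \<longleftrightarrow> u = t \<and> g = 0"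
  using assms unfolding cut_system_def by auto

text \<open>Equality of cuts up to translation and exchange of the two sides.\<close>

definition teq :: "'a set \<Rightarrow> 'a fg set \<Rightarrow> 'a fg set \<Rightarrow> bool" where
  "teq E C D \<longleftrightarrow> (\<exists>a\<in>fgs E. (\<forall>p\<in>fgs E. p \<in> C \<longleftrightarrow> p \<in> tr D a) \<or> (\<forall>p\<in>fgs E. p \<in> C \<longleftrightarrow> p \<notin> tr D a))"

definition is_half :: "'a set \<Rightarrow> 'a fg set \<Rightarrow> bool" where
  "is_half E C \<longleftrightarrow> (\<exists>y\<in>letters E. teq E C (half y))"

lemma teq_half_inv:
  assumes "teq E C (half (inv_letter y))" "y \<in> letters E"
  shows "teq E C (half y)"
proof -
  obtain a where a: "a \<in> fgs E" "(\<forall>p\<in>fgs E. p \<in> C \<longleftrightarrow> p \<in> tr (half (inv_letter y)) a) \<or> (\<forall>p\<in>fgs E. p \<in> C \<longleftrightarrow> p \<notin> tr (half (inv_letter y)) a)"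
    using assms by (auto simp: teq_def simp del: mem_tr)
  have "p \<in> tr (half (inv_letter y)) a \<longleftrightarrow> p \<notin> tr (half y) (- ltr y + a)" for p
    using tr_half_inv[of p y "- ltr y + a"] by simp
  then show ?thesis unfolding teq_def using a assms(2) by (intro bexI[of _ "- ltr y + a"]) (auto simp del: mem_tr)
qed

lemma teq_sep:
  assumes "teq E C D"
  obtains a where "a \<in> fgs E" "\<And>p q g. p \<in> fgs E \<Longrightarrow> q \<in> fgs E \<Longrightarrow> g \<in> fgs E \<Longrightarrow> sep (tr D g) p q \<longleftrightarrow> sep (tr C (- a + g)) p q"
proof -
  obtain a where a: "a \<in> fgs E" "(\<forall>p\<in>fgs E. p \<in> C \<longleftrightarrow> p - a \<in> D) \<or> (\<forall>p\<in>fgs E. p \<in> C \<longleftrightarrow> p - a \<notin> D)"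
    using assms by (auto simp: teq_def)
  have "p - (- a + g) - a = p - g" for p g
    by (simp add: group_assoc del: add_uminus_conv_diff)
  then have "(\<forall>p\<in>fgs E. \<forall>g\<in>fgs E. p - (- a + g) \<in> C \<longleftrightarrow> p - g \<in> D) \<or> (\<forall>p\<in>fgs E. \<forall>g\<in>fgs E. p - (- a + g) \<in> C \<longleftrightarrow> p - g \<notin> D)"
    using a by (metis fgs_minus fgs_plus fgs_uminus)
  then show ?thesis using a(1) that[of a] unfolding sep_def mem_tr by blast
qed

text \<open>\<open>S\<close> holds the directions that are allowed to be mixed: none when the cut
  itself is used, and the one crossing direction when surgery is performed.\<close>

lemma halves_at_vertex:
  assumes "v \<in> fgs E" "v \<notin> A" "\<forall>z\<in>letters E - S. \<not> mixed (fgs E) (tr (half z) v) A"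
    and X: "X = {z\<in>letters E - S. \<forall>p\<in>fgs E. p \<in> tr (half z) v \<longrightarrow> p \<in> A}"
    and p: "p \<in> fgs E" "p \<notin> tr (halves S) v"
  shows "p \<in> tr (halves X) v \<longleftrightarrow> p \<in> A"
proof (cases "p = v")
  case True
  then show ?thesis using assms(2) by (simp add: halves_def)
next
  case False
  then have "p - v \<noteq> 0" by simp
  then obtain z where z: "z \<in> letters E" "p - v \<in> half z" using half_cover[of "p - v" E] assms(1) p by auto
  then have "z \<notin> S" using p(2) by (auto simp: halves_def)
  then have nm: "\<not> mixed (fgs E) (tr (half z) v) A" using z assms(3) by blast
  have "p \<in> tr (halves X) v \<longleftrightarrow> z \<in> X" using z half_disjoint unfolding halves_def mem_tr by blast
  also have "\<dots> \<longleftrightarrow> p \<in> A" using nm z \<open>z \<notin> S\<close> p(1) unfolding X mixed_def by auto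
  finally show ?thesis .
qed

text \<open>
  The cut along which the Whitehead move is performed.  If some half-space \<open>half c\<close> at an innermost
  vertex crosses \<open>A t\<close>, surgery of \<open>half c\<close> along \<open>A t\<close> reduces the number of crossings;
  otherwise \<open>A t\<close> itself is used, replacing a half-space that is no cut of the system.
\<close>

lemma choose_cut:
  assumes sys: "cut_system E T A x K" and K: "K \<subseteq> fgs E" and E: "finite E" and t: "t \<in> T" "\<not> is_half E (A t)"
  obtains X b c where "X \<subseteq> letters E" "b \<in> X" "inv_letter b \<notin> X" "c = b \<or> c = inv_letter b"
    "\<forall>g\<in>fgs E. \<forall>s\<in>K. sep (tr (halves X) g) 0 s \<longrightarrow> sep (tr (half c) g) 0 s"
    "\<forall>u\<in>T. \<forall>g\<in>fgs E. cross (fgs E) (tr (halves X) g) (A u) \<longrightarrow> cross (fgs E) (tr (half c) g) (A u)"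
    "(\<exists>g\<in>fgs E. cross (fgs E) (tr (half c) g) (A t) \<and> \<not> cross (fgs E) (tr (halves X) g) (A t)) \<or>
      teq E (A t) (halves X) \<and> (\<forall>u\<in>T. \<not> teq E (A u) (half b))"
proof -
  note cs = cut_systemD[OF sys]
  let ?F = "fgs E"
  have conj: "p - (- v + g) = p - g + v" for p v g :: "'a fg"
    by (simp add: group_assoc del: add_uminus_conv_diff)
  have finb: "finite (bdry E (A t))" by (rule finite_bdry[OF E cs(4)[OF t(1)]])
  from innermost_vertex[OF E finb] consider
    (inner) v where "v \<in> ?F" "\<forall>z\<in>letters E. \<not> mixed ?F (tr (half z) v) (A t)"
  | (cross) v c where "v \<in> ?F" "c \<in> letters E" "cross ?F (tr (half c) v) (A t)"
    "\<forall>z\<in>letters E. z \<noteq> c \<longrightarrow> \<not> mixed ?F (tr (half z) v) (A t)"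
    by metis
  then show ?thesis
  proof cases
    case inner
    \<comment> \<open>A union of half-spaces based at \<open>v\<close> never contains
      \<open>v\<close>, so the side of the cut avoiding \<open>v\<close> is taken.\<close>
    define A1 where "A1 = (if v \<in> A t then - A t else A t)"
    define X where "X = {z\<in>letters E - {}. \<forall>p\<in>?F. p \<in> tr (half z) v \<longrightarrow> p \<in> A1}"
    have "v \<notin> A1" by (simp add: A1_def)
    have nm: "\<forall>z\<in>letters E - {}. \<not> mixed ?F (tr (half z) v) A1"
      using inner(2) by (auto simp: A1_def mixed_def)
    have X1: "p \<in> tr (halves X) v \<longleftrightarrow> p \<in> A1" if "p \<in> ?F" for p
      by (rule halves_at_vertex[OF inner(1) \<open>v \<notin> A1\<close> nm X_def that]) (simp add: halves_def)
    have X2: "p \<in> tr (halves X) g \<longleftrightarrow> p \<in> tr A1 (- v + g)" if "p \<in> ?F" "g \<in> ?F" for p g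
      using X1[of "p - g + v"] that inner(1) by (simp add: conj)
    have sepX: "sep (tr (halves X) g) p q \<longleftrightarrow> sep (tr (A t) (- v + g)) p q" if "p \<in> ?F" "q \<in> ?F" "g \<in> ?F" for p q g
      using X2 that unfolding sep_def by (auto simp: A1_def)
    have "{g\<in>?F. sep (tr (halves X) g) 0 (x t)} = {v}"
    proof -
      have "sep (tr (halves X) g) 0 (x t) \<longleftrightarrow> g = v" if "g \<in> ?F" for g
        using sepX[of 0 "x t" g] cs(5)[OF t(1)] cs(6)[OF t(1) t(1), of "- v + g"] that inner(1)
        by (simp add: minus_add_eq_iff)
      then show ?thesis using inner(1) by auto
    qed
    then have odd: "odd (card {g\<in>?F. sep (tr (halves X) g) 0 (x t)})" by simp
    have XL: "X \<subseteq> letters E" by (auto simp: X_def)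
    \<comment> \<open>Exactly one translate separates 0 from \<open>x t\<close>, and one is odd. The
      letter found also separates 0 from \<open>x t\<close>; a cut of the system equivalent to
      \<open>half b\<close> would therefore have to be \<open>A t\<close>, which is no edge
      cut.\<close>
    obtain b g where b: "b \<in> X" "inv_letter b \<notin> X" "g \<in> ?F" "sep (tr (half b) g) 0 (x t)"
      using ex_unpaired_letter[OF XL E cs(5)[OF t(1)] odd] by blast
    have "\<not> teq E (A u) (half b)" if u: "u \<in> T" for u
    proof
      assume te: "teq E (A u) (half b)"
      then obtain a where a: "a \<in> ?F" "\<And>p q g. p \<in> ?F \<Longrightarrow> q \<in> ?F \<Longrightarrow> g \<in> ?F \<Longrightarrow> sep (tr (half b) g) p q \<longleftrightarrow> sep (tr (A u) (- a + g)) p q"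
        by (rule teq_sep) blast
      then have "sep (tr (A u) (- a + g)) 0 (x t)" using b cs(5)[OF t(1)] by simp
      then have "u = t" using cs(6)[OF t(1) u, of "- a + g"] a b by simp
      then show False using te t(2) b XL by (auto simp: is_half_def)
    qed
    moreover have "teq E (A t) (halves X)"
      unfolding teq_def using X1 inner(1) by (intro bexI[of _ v]) (auto simp: A1_def simp del: mem_tr split: if_splits)
    moreover have "\<not> sep (tr (halves X) g) 0 s" if "g \<in> ?F" "s \<in> K" for g s
    proof -
      have "s \<in> ?F" using K that by blast
      then show ?thesis using sepX[of 0 s g] that inner(1) cs(2)[OF t(1) that(2), of "0 - (- v + g)"]
        by (simp add: sep_def)
    qed
    moreover have "\<not> cross ?F (tr (halves X) g) (A u)" if "u \<in> T" "g \<in> ?F" for u g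
    proof -
      have "cross ?F (tr (halves X) g) (A u) \<longleftrightarrow> cross ?F (tr A1 (- v + g)) (A u)"
        by (rule cross_cong) (use X2 that in auto)
      moreover have "tr (- A t) (- v + g) = - tr (A t) (- v + g)" by auto
      ultimately show ?thesis using cs(3)[OF t(1) that(1), of "- v + g"] that inner(1) by (simp add: A1_def)
    qed
    ultimately show ?thesis using that[of X b b] b XL by blast
  next
    case cross
    define A1 where "A1 = (if v \<in> A t then - A t else A t)"
    define X0 where "X0 = {z\<in>letters E - {c}. \<forall>p\<in>?F. p \<in> tr (half z) v \<longrightarrow> p \<in> A1}"
    have "v \<notin> A1" by (simp add: A1_def)
    have nm: "\<forall>z\<in>letters E - {c}. \<not> mixed ?F (tr (half z) v) A1"
      using cross(4) by (auto simp: A1_def mixed_def)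
    have cr1: "cross ?F (tr (half c) v) A1" using cross(3) by (simp add: A1_def)
    have hc: "halves {c} = half c" by (simp add: halves_def)
    have X1: "p \<in> tr (halves X0) v \<longleftrightarrow> p \<in> A1 \<and> p \<notin> tr (half c) v" if "p \<in> ?F" for p
    proof (cases "p \<in> tr (half c) v")
      case True
      then have "p \<notin> tr (halves X0) v" using half_disjoint unfolding halves_def X0_def mem_tr by blast
      then show ?thesis using True by blast
    next
      case False
      then show ?thesis
        using halves_at_vertex[OF cross(1) \<open>v \<notin> A1\<close> nm X0_def that] unfolding hc by blast
    qed
    \<comment> \<open>Both ways of surgery along the cut, removing the half-space
      \<open>half c\<close> or adding it, are admissible; the choice is dictated by having
      \<open>b\<close> in \<open>X\<close> and its inverse outside.\<close>
    define b where "b = (if inv_letter c \<in> X0 then inv_letter c else c)"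
    define X where "X = (if inv_letter c \<in> X0 then X0 else insert c X0)"
    have "c \<notin> X0" by (simp add: X0_def)
    then have b: "b \<in> X" "inv_letter b \<notin> X" "c = b \<or> c = inv_letter b" "X \<subseteq> letters E"
      using cross(2) by (auto simp: b_def X_def X0_def)
    define U where "U g = tr A1 (- v + g)" for g
    define Q where "Q g = (if inv_letter c \<in> X0 then U g - tr (half c) g else U g \<union> tr (half c) g)" for g
    have X2: "p \<in> tr (halves X) g \<longleftrightarrow> p \<in> Q g" if "p \<in> ?F" "g \<in> ?F" for p g
    proof -
      have "p - g + v - v = p - g" by simp
      then have "p \<in> tr (halves X0) g \<longleftrightarrow> p \<in> U g \<and> p \<notin> tr (half c) g"
        using X1[of "p - g + v"] that cross(1) by (simp add: conj U_def)
      moreover have "halves (insert c X0) = half c \<union> halves X0" by (auto simp: halves_def)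
      ultimately show ?thesis by (auto simp: X_def Q_def)
    qed
    have UK: "0 \<in> U g \<longleftrightarrow> s \<in> U g" if "g \<in> ?F" "s \<in> K" for g s
      using that cross(1) cs(2)[OF t(1) that(2), of "0 - (- v + g)"]
      by (auto simp: U_def A1_def)
    have D: "sep (tr (half c) g) 0 s" if "g \<in> ?F" "s \<in> K" "sep (tr (halves X) g) 0 s" for g s
    proof -
      have "s \<in> ?F" using K that by blast
      then have "sep (Q g) 0 s" using that(3) X2[OF _ that(1)] fgs_zero unfolding sep_def by blast
      then show ?thesis using UK[OF that(1,2)] by (auto simp: sep_def Q_def split: if_splits)
    qed
    have nU: "\<not> cross ?F (U g) (A u)" if "u \<in> T" "g \<in> ?F" for u g
    proof -
      have "tr (- A t) (- v + g) = - tr (A t) (- v + g)" by auto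
      then show ?thesis using cs(3)[OF t(1) that(1), of "- v + g"] that cross(1) by (simp add: A1_def U_def)
    qed
    have meet: "\<exists>p\<in>?F. p \<in> tr (half c) g \<and> p \<in> U g" "\<exists>p\<in>?F. p \<in> tr (half c) g \<and> p \<notin> U g" if "g \<in> ?F" for g
    proof -
      obtain p1 p2 where p: "p1 \<in> ?F" "p1 - v \<in> half c" "p1 \<in> A1" "p2 \<in> ?F" "p2 - v \<in> half c" "p2 \<notin> A1"
        using cr1 by (auto simp: cross_def)
      have *: "p - v + g - (- v + g) = p" for p
        by (simp add: group_assoc del: add_uminus_conv_diff)
      show "\<exists>p\<in>?F. p \<in> tr (half c) g \<and> p \<in> U g"
        by (rule bexI[of _ "p1 - v + g"]) (use p that cross(1) in \<open>simp_all add: U_def *\<close>)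
      show "\<exists>p\<in>?F. p \<in> tr (half c) g \<and> p \<notin> U g"
        by (rule bexI[of _ "p2 - v + g"]) (use p that cross(1) in \<open>simp_all add: U_def *\<close>)
    qed
    have C: "cross ?F (tr (half c) g) (A u)" if "u \<in> T" "g \<in> ?F" "cross ?F (tr (halves X) g) (A u)" for u g
    proof (rule ccontr)
      assume n: "\<not> ?thesis"
      have "\<not> cross ?F (Q g) (A u)"
        unfolding Q_def using cross_diff[OF nU[OF that(1,2)] n meet(2)[OF that(2)]] cross_Un[OF nU[OF that(1,2)] n meet(1)[OF that(2)]]
        by simp
      moreover have "cross ?F (tr (halves X) g) (A u) \<longleftrightarrow> cross ?F (Q g) (A u)"
        by (rule cross_cong) (use X2 that in auto)
      ultimately show False using that(3) by blast
    qed
    \<comment> \<open>At \<open>v\<close> the new cut is contained in \<open>A1\<close> or contains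
      it, so one crossing disappears there.\<close>
    have "\<not> cross ?F (tr (halves X) v) (A t)"
    proof -
      have "cross ?F (tr (halves X) v) A1 \<longleftrightarrow> cross ?F (Q v) A1"
        by (rule cross_cong) (use X2 cross(1) in auto)
      moreover have "\<not> cross ?F (Q v) A1" by (auto simp: Q_def U_def cross_def)
      ultimately show ?thesis by (simp add: A1_def split: if_splits)
    qed
    then show ?thesis using that[of X b c] b D C cross(1,3) by blast
  qed
qed

subsection \<open>Transport along automorphisms\<close>

definition aut_pair :: "'a set \<Rightarrow> ('a fg \<Rightarrow> 'a fg) \<Rightarrow> ('a fg \<Rightarrow> 'a fg) \<Rightarrow> bool" where
  "aut_pair E \<phi> \<psi> \<longleftrightarrow> (\<forall>g h. \<phi> (g + h) = \<phi> g + \<phi> h) \<and>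
     (\<forall>g\<in>fgs E. \<phi> g \<in> fgs E \<and> \<psi> g \<in> fgs E \<and> \<phi> (\<psi> g) = g \<and> \<psi> (\<phi> g) = g)"

lemma aut_pairD:
  assumes "aut_pair E \<phi> \<psi>"
  shows "\<phi> (g + h) = \<phi> g + \<phi> h" "\<phi> 0 = 0" "\<phi> (- g) = - \<phi> g" "\<phi> (g - h) = \<phi> g - \<phi> h"
    "\<And>g. g \<in> fgs E \<Longrightarrow> \<phi> g \<in> fgs E" "\<And>g. g \<in> fgs E \<Longrightarrow> \<psi> g \<in> fgs E"
    "\<And>g. g \<in> fgs E \<Longrightarrow> \<phi> (\<psi> g) = g" "\<And>g. g \<in> fgs E \<Longrightarrow> \<psi> (\<phi> g) = g"
proof -
  show add: "\<phi> (g + h) = \<phi> g + \<phi> h" for g h using assms by (simp add: aut_pair_def)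
  show zero: "\<phi> 0 = 0" by (metis add add_0 add_right_cancel)
  show um: "\<phi> (- g) = - \<phi> g" for g using add[of g "- g"] zero by (metis add.right_inverse minus_unique)
  show "\<phi> (g - h) = \<phi> g - \<phi> h" using add[of g "- h"] um by simp
qed (use assms in \<open>auto simp: aut_pair_def\<close>)

lemma aut_pair_wh: "b \<in> letters E \<Longrightarrow> aut_pair E (lift (wh X b)) (lift (wh X (inv_letter b)))"
  by (simp add: aut_pair_def lift_plus lift_wh_fgs lift_wh_wh_inv lift_wh_inv_wh)

lemma aut_pair_image: "aut_pair E \<phi> \<psi> \<Longrightarrow> \<phi> ` fgs E = fgs E"
proof (intro equalityI subsetI)
  fix g assume "aut_pair E \<phi> \<psi>" "g \<in> fgs E"
  then show "g \<in> \<phi> ` fgs E" by (intro image_eqI[of _ _ "\<psi> g"]) (simp_all add: aut_pairD)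
qed (auto simp: aut_pairD)

lemma aut_pair_inj: "aut_pair E \<phi> \<psi> \<Longrightarrow> inj_on \<phi> (fgs E)"
  by (rule inj_on_inverseI[of _ \<psi>]) (rule aut_pairD(8))

definition pull :: "'a set \<Rightarrow> ('a fg \<Rightarrow> 'a fg) \<Rightarrow> 'a fg set \<Rightarrow> 'a fg set" where
  "pull E \<phi> S = {p\<in>fgs E. \<phi> p \<in> S}"

lemma pull_subset: "pull E \<phi> S \<subseteq> fgs E"
  by (auto simp: pull_def)

lemma image_pull: "aut_pair E \<phi> \<psi> \<Longrightarrow> S \<subseteq> fgs E \<Longrightarrow> \<phi> ` pull E \<phi> S = S"
  unfolding pull_def using aut_pairD(6,7)[of E \<phi> \<psi>] by (fastforce simp: image_iff)

lemma subgp_pull: "aut_pair E \<phi> \<psi> \<Longrightarrow> subgp S \<Longrightarrow> subgp (pull E \<phi> S)"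
  by (simp add: subgp_def pull_def aut_pairD)

lemma cut_system_pull:
  assumes \<phi>: "aut_pair E \<phi> \<psi>" and sys: "cut_system E T A x K"
  shows "cut_system E T (\<lambda>t. \<phi> -` A t) (\<lambda>t. \<psi> (x t)) (pull E \<phi> K)"
proof -
  note cs = cut_systemD[OF sys] and ap = aut_pairD[OF \<phi>]
  have sep: "sep (tr (\<phi> -` C) g) p q \<longleftrightarrow> sep (tr C (\<phi> g)) (\<phi> p) (\<phi> q)" for C g p q
    by (simp add: sep_def ap)
  have "\<not> cross (fgs E) (tr (\<phi> -` A t) g) (\<phi> -` A u)" if "t \<in> T" "u \<in> T" "g \<in> fgs E" for t u g
  proof -
    have "cross (fgs E) (tr (A t) (\<phi> g)) (A u) \<longleftrightarrow> cross (fgs E) (tr (\<phi> -` A t) g) (\<phi> -` A u)"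
      by (rule cross_bij[OF aut_pair_image[OF \<phi>]]) (simp_all add: ap)
    then show ?thesis using cs(3)[of t u "\<phi> g"] that by (simp add: ap)
  qed
  moreover have "finite {g\<in>fgs E. sep (\<phi> -` A t) g (q + g)}" if "t \<in> T" "q \<in> fgs E" for t q
  proof -
    have "\<phi> ` {g\<in>fgs E. sep (\<phi> -` A t) g (q + g)} \<subseteq> {g\<in>fgs E. sep (A t) g (\<phi> q + g)}"
      by (auto simp: sep_def ap)
    then have "finite (\<phi> ` {g\<in>fgs E. sep (\<phi> -` A t) g (q + g)})"
      by (rule finite_subset) (simp add: cs(4) ap that)
    moreover have "inj_on \<phi> {g\<in>fgs E. sep (\<phi> -` A t) g (q + g)}"
      by (rule inj_on_subset[OF aut_pair_inj[OF \<phi>]]) auto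
    ultimately show ?thesis by (rule finite_imageD)
  qed
  moreover have "\<phi> g = 0 \<longleftrightarrow> g = 0" if "g \<in> fgs E" for g
    using ap(2) ap(8)[OF that] ap(8)[of 0] by auto
  ultimately show ?thesis
    unfolding cut_system_def using cs sep by (auto simp: ap pull_def)
qed

text \<open>The common feature of the two counts that a move must control: crossings with the cuts,
  and edges traversed by \<open>K\<close>.\<close>

definition cut_invariant :: "'a set \<Rightarrow> ('a fg set \<Rightarrow> nat) \<Rightarrow> bool" where
  "cut_invariant E f \<longleftrightarrow> (\<forall>C. f (- C) = f C) \<and> (\<forall>C. \<forall>a\<in>fgs E. f (tr C a) = f C)"

lemma cut_invariant_half_inv:
  assumes "cut_invariant E f" "y \<in> letters E"
  shows "f (half (inv_letter y)) = f (half y)"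
proof -
  have "f (half (inv_letter y)) = f (tr (half (inv_letter y)) (ltr y + 0))"
    using assms by (simp add: cut_invariant_def)
  also have "\<dots> = f (half y)"
    unfolding compl_tr_half[symmetric] using assms by (simp add: cut_invariant_def)
  finally show ?thesis .
qed

text \<open>The cuts at \<open>b\<close> and at its inverse are both replaced by
  \<open>halves X\<close> up to complement, whence the factor 2. Comparing the sums before and after
  a move thus reduces to comparing \<open>halves X\<close> with \<open>half b\<close>.\<close>

lemma sum_new_cut:
  assumes f: "cut_invariant E f" and b: "b \<in> letters E" "finite E"
  shows "(\<Sum>y\<in>letters E. f (new_cut X b y)) + 2 * f (half b) = (\<Sum>y\<in>letters E. f (half y)) + 2 * f (halves X)"
proof -
  let ?R = "letters E - {b, inv_letter b}"
  have split: "(\<Sum>y\<in>letters E. g y) = g b + g (inv_letter b) + (\<Sum>y\<in>?R. g y)" for g :: "_ \<Rightarrow> nat"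
  proof -
    have "(\<Sum>y\<in>letters E. g y) = (\<Sum>y\<in>?R. g y) + (\<Sum>y\<in>{b, inv_letter b}. g y)"
      by (rule sum.subset_diff) (use b finite_letters in auto)
    then show ?thesis by simp
  qed
  have "(\<Sum>y\<in>?R. f (new_cut X b y)) = (\<Sum>y\<in>?R. f (half y))"
    by (rule sum.cong) (auto simp: new_cut_def)
  moreover have "f (new_cut X b b) = f (halves X)" "f (new_cut X b (inv_letter b)) = f (halves X)"
    using f by (simp_all add: new_cut_def cut_invariant_def)
  ultimately show ?thesis
    unfolding split[of "\<lambda>y. f (new_cut X b y)"] split[of "\<lambda>y. f (half y)"]
    using cut_invariant_half_inv[OF f b(1)] by simp
qed

section \<open>Counts attached to a cut and their behaviour under automorphisms\<close>

lemma coset_plus_left: "(\<lambda>p. a + p) ` coset g J = coset (a + g) J"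
  by (simp add: coset_def image_image add.assoc)

lemma cut_cosets_compl: "cut_cosets E J K (- C) = cut_cosets E J K C"
proof -
  have "sep (tr (- C) g) p q \<longleftrightarrow> sep (tr C g) p q" for g p q by (auto simp: sep_def)
  then show ?thesis by (simp add: cut_cosets_def)
qed

lemma cut_invariant_cosets: "cut_invariant E (\<lambda>C. card (cut_cosets E J K C))"
proof -
  have "card (cut_cosets E J K (tr C a)) = card (cut_cosets E J K C)" if a: "a \<in> fgs E" for C a
  proof -
    have "(\<lambda>c. (\<lambda>p. a + p) ` c) ` cut_cosets E J K (tr C a) = cut_cosets E J K C"
    proof (intro equalityI subsetI)
      fix c assume "c \<in> cut_cosets E J K C"
      then obtain g s where g: "c = coset g J" "g \<in> fgs E" "s \<in> K" "sep (tr C g) 0 s" by (auto simp: cut_cosets_def)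
      then have "coset (- a + g) J \<in> cut_cosets E J K (tr C a)"
        using a unfolding cut_cosets_def tr_tr by (auto intro!: exI[of _ "- a + g"])
      moreover have "c = (\<lambda>p. a + p) ` coset (- a + g) J" by (simp add: coset_plus_left g)
      ultimately show "c \<in> (\<lambda>c. (\<lambda>p. a + p) ` c) ` cut_cosets E J K (tr C a)" by blast
    next
      fix c assume "c \<in> (\<lambda>c. (\<lambda>p. a + p) ` c) ` cut_cosets E J K (tr C a)"
      then obtain g s where g: "c = coset (a + g) J" "g \<in> fgs E" "s \<in> K" "sep (tr C (a + g)) 0 s"
        unfolding cut_cosets_def tr_tr by (auto simp: coset_plus_left)
      then show "c \<in> cut_cosets E J K C" using a unfolding cut_cosets_def by (auto intro!: exI[of _ "a + g"])
    qed
    moreover have "inj_on (\<lambda>c. (\<lambda>p. a + p) ` c) (cut_cosets E J K (tr C a))"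
      by (rule inj_onI) (simp add: inj_image_eq_iff inj_def)
    ultimately show ?thesis by (metis card_image)
  qed
  then show ?thesis by (simp add: cut_invariant_def cut_cosets_compl)
qed

definition crossings :: "'a set \<Rightarrow> 'a fg set \<Rightarrow> 'a fg set \<Rightarrow> 'a fg set" where
  "crossings E A C = {g\<in>fgs E. cross (fgs E) (tr C g) A}"

lemma card_shift_left:
  assumes "a \<in> fgs E"
  shows "card {g\<in>fgs E. P (a + g)} = card {g\<in>fgs E. P g}"
proof (rule bij_betw_same_card[of "\<lambda>g. a + g"])
  show "bij_betw (\<lambda>g. a + g) {g \<in> fgs E. P (a + g)} {g \<in> fgs E. P g}"
    by (rule bij_betw_byWitness[of _ "\<lambda>g. - a + g"]) (use assms in auto)
qed

lemma cut_invariant_crossings: "cut_invariant E (\<lambda>C. \<Sum>t\<in>T. card (crossings E (A t) C))"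
proof -
  have "tr (- C) g = - tr C g" for C and g :: "'a fg" by auto
  moreover have "card {g \<in> fgs E. cross (fgs E) (tr C (a + g)) B} = card {g \<in> fgs E. cross (fgs E) (tr C g) B}"
    if "a \<in> fgs E" for a C B
    by (rule card_shift_left[OF that, of "\<lambda>g. cross (fgs E) (tr C g) B"])
  ultimately show ?thesis by (simp add: cut_invariant_def crossings_def tr_tr)
qed

text \<open>An automorphism carries one quotient graph to the other, so the weight in new
  coordinates can be computed with the cuts \<open>new_cut\<close> in the old ones.\<close>

lemma cut_cosets_pull:
  assumes \<phi>: "aut_pair E \<phi> \<psi>" and J: "J \<subseteq> fgs E" "K \<subseteq> fgs E"
    and a: "a \<in> fgs E" "\<And>p. p \<in> fgs E \<Longrightarrow> \<phi> p \<in> tr C a \<longleftrightarrow> p \<in> D"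
  shows "bij_betw (\<lambda>c. (\<lambda>p. a + \<phi> p) ` c) (cut_cosets E (pull E \<phi> J) (pull E \<phi> K) D) (cut_cosets E J K C)"
proof -
  note ap = aut_pairD[OF \<phi>]
  let ?f = "\<lambda>c. (\<lambda>p. a + \<phi> p) ` c"
  have fc: "?f (coset g (pull E \<phi> J)) = coset (a + \<phi> g) J" for g
  proof -
    have "?f (coset g (pull E \<phi> J)) = (\<lambda>p. a + \<phi> g + p) ` (\<phi> ` pull E \<phi> J)"
      by (simp add: coset_def image_image ap add.assoc)
    then show ?thesis using image_pull[OF \<phi> J(1)] by (simp add: coset_def)
  qed
  have sep: "sep (tr D g) 0 s \<longleftrightarrow> sep (tr C (a + \<phi> g)) 0 (\<phi> s)" if "g \<in> fgs E" "s \<in> fgs E" for g s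
    using a(2)[of "0 - g"] a(2)[of "s - g"] that
    by (simp add: sep_tr ap) (simp add: sep_def group_assoc del: add_uminus_conv_diff)
  have "?f ` cut_cosets E (pull E \<phi> J) (pull E \<phi> K) D = cut_cosets E J K C"
  proof (intro equalityI subsetI)
    fix c assume "c \<in> ?f ` cut_cosets E (pull E \<phi> J) (pull E \<phi> K) D"
    then obtain g s where gs: "c = ?f (coset g (pull E \<phi> J))" "g \<in> fgs E" "s \<in> pull E \<phi> K" "sep (tr D g) 0 s"
      by (auto simp: cut_cosets_def)
    then have g: "c = coset (a + \<phi> g) J" "g \<in> fgs E" "s \<in> fgs E" "\<phi> s \<in> K" "sep (tr D g) 0 s"
      using fc by (auto simp: pull_def)
    then show "c \<in> cut_cosets E J K C"
      using sep[of g s] a ap unfolding cut_cosets_def by (auto intro!: exI[of _ "a + \<phi> g"])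
  next
    fix c assume "c \<in> cut_cosets E J K C"
    then obtain g s where g: "c = coset g J" "g \<in> fgs E" "s \<in> K" "sep (tr C g) 0 s" by (auto simp: cut_cosets_def)
    define g' where "g' = \<psi> (- a + g)"
    have g': "g' \<in> fgs E" "a + \<phi> g' = g" using a(1) g(2) by (simp_all add: g'_def ap)
    have s: "\<psi> s \<in> pull E \<phi> K" "\<phi> (\<psi> s) = s" using g(3) J(2) by (auto simp: pull_def ap)
    have "coset g' (pull E \<phi> J) \<in> cut_cosets E (pull E \<phi> J) (pull E \<phi> K) D"
    proof -
      have "sep (tr D g') 0 (\<psi> s)" using g' s sep[of g' "\<psi> s"] g by (simp add: pull_def)
      then show ?thesis unfolding cut_cosets_def using g'(1) s(1) by blast
    qed
    moreover have "c = ?f (coset g' (pull E \<phi> J))" using g g' by (simp add: fc)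
    ultimately show "c \<in> ?f ` cut_cosets E (pull E \<phi> J) (pull E \<phi> K) D" by blast
  qed
  moreover have "inj_on ?f (cut_cosets E (pull E \<phi> J) (pull E \<phi> K) D)"
  proof (rule inj_on_subset[of _ "Pow (fgs E)"])
    have "inj_on (\<lambda>p. a + \<phi> p) (fgs E)" using aut_pair_inj[OF \<phi>] by (auto simp: inj_on_def)
    then show "inj_on ?f (Pow (fgs E))" by (rule inj_on_image_Pow)
    show "cut_cosets E (pull E \<phi> J) (pull E \<phi> K) D \<subseteq> Pow (fgs E)"
      by (auto simp: cut_cosets_def coset_def pull_def)
  qed
  ultimately show ?thesis by (simp add: bij_betw_def)
qed

lemma card_crossings_pull:
  assumes \<phi>: "aut_pair E \<phi> \<psi>"
    and a: "a \<in> fgs E" "\<And>p. p \<in> fgs E \<Longrightarrow> \<phi> p \<in> tr C a \<longleftrightarrow> p \<in> D"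
  shows "card (crossings E (\<phi> -` A) D) = card (crossings E A C)"
proof (rule bij_betw_same_card[of "\<lambda>g. a + \<phi> g"])
  note ap = aut_pairD[OF \<phi>]
  have cr: "cross (fgs E) (tr D g) (\<phi> -` A) \<longleftrightarrow> cross (fgs E) (tr C (a + \<phi> g)) A" if g: "g \<in> fgs E" for g
  proof -
    have "\<phi> p \<in> tr C (a + \<phi> g) \<longleftrightarrow> p \<in> tr D g" if "p \<in> fgs E" for p
      using a(2)[of "p - g"] g that
      by (simp add: ap) (simp add: group_assoc del: add_uminus_conv_diff)
    then show ?thesis
      by (intro cross_bij[OF aut_pair_image[OF \<phi>], symmetric]) simp_all
  qed
  show "bij_betw (\<lambda>g. a + \<phi> g) (crossings E (\<phi> -` A) D) (crossings E A C)"
  proof (rule bij_betw_byWitness[of _ "\<lambda>g. \<psi> (- a + g)"])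
    show "(\<lambda>g. \<psi> (- a + g)) ` crossings E A C \<subseteq> crossings E (\<phi> -` A) D"
      using a cr by (auto simp: crossings_def ap)
  qed (use a cr in \<open>auto simp: crossings_def ap\<close>)
qed

lemma teq_pull:
  assumes \<phi>: "aut_pair E \<phi> \<psi>" and te: "teq E A C"
    and a: "a \<in> fgs E" "\<And>p. p \<in> fgs E \<Longrightarrow> \<phi> p \<in> tr C a \<longleftrightarrow> p \<in> D"
  shows "teq E (\<phi> -` A) D"
proof -
  note ap = aut_pairD[OF \<phi>]
  obtain a' where a': "a' \<in> fgs E" "(\<forall>p\<in>fgs E. p \<in> A \<longleftrightarrow> p - a' \<in> C) \<or> (\<forall>p\<in>fgs E. p \<in> A \<longleftrightarrow> p - a' \<notin> C)"
    using te by (auto simp: teq_def)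
  define g where "g = \<psi> (- a + a')"
  have g: "g \<in> fgs E" "\<phi> g = - a + a'" using a a' by (simp_all add: g_def ap)
  have "p - g \<in> D \<longleftrightarrow> \<phi> p - a' \<in> C" if "p \<in> fgs E" for p
    using a(2)[of "p - g"] that g
    by (simp add: ap) (simp add: group_assoc del: add_uminus_conv_diff)
  then show ?thesis unfolding teq_def using a'(2) g ap by (intro bexI[of _ g]) auto
qed

subsection \<open>The Whitehead step\<close>

text \<open>A surgery lowers the number of crossings. Using \<open>A t\<close> itself may leave that
  number unchanged, but then fewer cuts remain that are not edge cuts; hence the lexicographic
  order.\<close>

definition complexity :: "'a set \<Rightarrow> 't set \<Rightarrow> ('t \<Rightarrow> 'a fg set) \<Rightarrow> nat \<times> nat" where
  "complexity E T A = ((\<Sum>y\<in>letters E. \<Sum>t\<in>T. card (crossings E (A t) (half y))), card {t\<in>T. \<not> is_half E (A t)})"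

text \<open>Elements of \<open>K\<close> cross a translate of \<open>halves X\<close> only where
  they cross that of \<open>half c\<close>, so they traverse no more edges than before. The choice
  of \<open>X\<close> depends on \<open>K\<close> and the cuts only, so one move serves every
  \<open>J\<close>.\<close>

lemma whitehead_step:
  assumes sys: "cut_system E T A x K" and K: "K \<subseteq> fgs E" and E: "finite E" and t: "t \<in> T" "\<not> is_half E (A t)"
  obtains X b where "X \<subseteq> letters E" "b \<in> letters E"
    "(complexity E T (\<lambda>t. lift (wh X b) -` A t), complexity E T A) \<in> less_than <*lex*> less_than"
    "\<forall>J. J \<subseteq> fgs E \<longrightarrow> (\<forall>y\<in>letters E. finite (cut_cosets E J K (half y))) \<longrightarrow>
      weight E (pull E (lift (wh X b)) J) (pull E (lift (wh X b)) K) \<le> weight E J K \<and>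
      (\<forall>y\<in>letters E. finite (cut_cosets E (pull E (lift (wh X b)) J) (pull E (lift (wh X b)) K) (half y)))"
proof -
  note cs = cut_systemD[OF sys]
  obtain X b c where X: "X \<subseteq> letters E" "b \<in> X" "inv_letter b \<notin> X" "c = b \<or> c = inv_letter b"
    and D: "\<forall>g\<in>fgs E. \<forall>s\<in>K. sep (tr (halves X) g) 0 s \<longrightarrow> sep (tr (half c) g) 0 s"
    and C: "\<forall>u\<in>T. \<forall>g\<in>fgs E. cross (fgs E) (tr (halves X) g) (A u) \<longrightarrow> cross (fgs E) (tr (half c) g) (A u)"
    and P: "(\<exists>g\<in>fgs E. cross (fgs E) (tr (half c) g) (A t) \<and> \<not> cross (fgs E) (tr (halves X) g) (A t)) \<or>
      teq E (A t) (halves X) \<and> (\<forall>u\<in>T. \<not> teq E (A u) (half b))"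
    by (rule choose_cut[OF sys K E t])
  have b: "b \<in> letters E" and c: "c \<in> letters E" using X by auto
  let ?\<phi> = "lift (wh X b)" and ?\<psi> = "lift (wh X (inv_letter b))"
  have \<phi>: "aut_pair E ?\<phi> ?\<psi>" by (rule aut_pair_wh[OF b])
  have hc: "f (half c) = f (half b)" if "cut_invariant E f" for f
    using X(4) cut_invariant_half_inv[OF that b] by auto
  have finc: "finite (crossings E (A u) (half c))" if "u \<in> T" for u
    unfolding crossings_def by (rule finite_cross[OF finite_bdry[OF E cs(4)[OF that]] c])
  have subc: "crossings E (A u) (halves X) \<subseteq> crossings E (A u) (half c)" if "u \<in> T" for u
    using C that by (auto simp: crossings_def)
  let ?N = "\<lambda>C. \<Sum>u\<in>T. card (crossings E (A u) C)"
  have cinv: "cut_invariant E ?N" by (rule cut_invariant_crossings)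
  have N1: "?N (halves X) \<le> ?N (half b)"
    unfolding hc[OF cinv, symmetric] by (intro sum_mono card_mono finc subc)
  have N2: "?N (halves X) < ?N (half b)"
    if g: "g \<in> fgs E" "cross (fgs E) (tr (half c) g) (A t)" "\<not> cross (fgs E) (tr (halves X) g) (A t)" for g
  proof -
    have "crossings E (A t) (halves X) \<subset> crossings E (A t) (half c)"
      using subc[OF t(1)] g by (auto simp: crossings_def)
    then have lt: "card (crossings E (A t) (halves X)) < card (crossings E (A t) (half c))"
      by (rule psubset_card_mono[OF finc[OF t(1)]])
    show ?thesis unfolding hc[OF cinv, symmetric]
    proof (rule sum_strict_mono_ex1[OF cs(1)])
      show "\<forall>u\<in>T. card (crossings E (A u) (halves X)) \<le> card (crossings E (A u) (half c))"
        using finc subc by (auto intro: card_mono)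
    qed (use t(1) lt in blast)
  qed
  have N3: "(\<Sum>y\<in>letters E. \<Sum>u\<in>T. card (crossings E (?\<phi> -` A u) (half y))) = (\<Sum>y\<in>letters E. ?N (new_cut X b y))"
  proof (intro sum.cong refl)
    fix y u
    obtain a where "a \<in> fgs E" "\<And>p. ?\<phi> p \<in> tr (new_cut X b y) a \<longleftrightarrow> p \<in> half y"
      using wh_new_cut[OF X(2,3) b] by metis
    then show "card (crossings E (?\<phi> -` A u) (half y)) = card (crossings E (A u) (new_cut X b y))"
      by (intro card_crossings_pull[OF \<phi>]) auto
  qed
  note N4 = sum_new_cut[OF cinv b E, of X]
  have cpx: "(complexity E T (\<lambda>t. ?\<phi> -` A t), complexity E T A) \<in> less_than <*lex*> less_than"
    using P
  proof
    assume "\<exists>g\<in>fgs E. cross (fgs E) (tr (half c) g) (A t) \<and> \<not> cross (fgs E) (tr (halves X) g) (A t)"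
    then have "?N (halves X) < ?N (half b)" using N2 by blast
    then show ?thesis using N4 unfolding complexity_def N3 by simp
  next
    assume te: "teq E (A t) (halves X) \<and> (\<forall>u\<in>T. \<not> teq E (A u) (half b))"
    have "is_half E (?\<phi> -` A u)" if u: "u \<in> T" "is_half E (A u) \<or> u = t" for u
    proof -
      obtain y where y: "y \<in> letters E" "teq E (A u) (new_cut X b y)"
      proof (cases "u = t")
        case True
        then show ?thesis using te that[of b] b by (simp add: new_cut_def)
      next
        case False
        then obtain y where y: "y \<in> letters E" "teq E (A u) (half y)" using u by (auto simp: is_half_def)
        \<comment> \<open>No cut of the system is equivalent to \<open>half b\<close>; the edge cuts
          reached so far belong to other letters and survive the move.\<close>
        then have "y \<noteq> b" "y \<noteq> inv_letter b" using te u(1) teq_half_inv[OF _ b] by auto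
        then show ?thesis using that[of y] y by (simp add: new_cut_def)
      qed
      moreover obtain a where "a \<in> fgs E" "\<And>p. ?\<phi> p \<in> tr (new_cut X b y) a \<longleftrightarrow> p \<in> half y"
        using wh_new_cut[OF X(2,3) b] by metis
      ultimately have "teq E (?\<phi> -` A u) (half y)" by (intro teq_pull[OF \<phi>]) auto
      then show ?thesis using y by (auto simp: is_half_def)
    qed
    then have "{u\<in>T. \<not> is_half E (?\<phi> -` A u)} \<subset> {u\<in>T. \<not> is_half E (A u)}" using t by blast
    then have "card {u\<in>T. \<not> is_half E (?\<phi> -` A u)} < card {u\<in>T. \<not> is_half E (A u)}"
      by (rule psubset_card_mono[rotated]) (use cs(1) in simp)
    then show ?thesis using N1 N4 unfolding complexity_def N3 by auto
  qed
  have bij: "\<exists>f. bij_betw f (cut_cosets E (pull E ?\<phi> J) (pull E ?\<phi> K) (half y)) (cut_cosets E J K (new_cut X b y))"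
    if "J \<subseteq> fgs E" for J y
  proof -
    obtain a where "a \<in> fgs E" "\<And>p. ?\<phi> p \<in> tr (new_cut X b y) a \<longleftrightarrow> p \<in> half y"
      using wh_new_cut[OF X(2,3) b] by metis
    then show ?thesis using cut_cosets_pull[OF \<phi> that K, of a "new_cut X b y" "half y"] by blast
  qed
  have sub: "cut_cosets E J K (halves X) \<subseteq> cut_cosets E J K (half c)" for J
    using D unfolding cut_cosets_def by blast
  have w: "weight E (pull E ?\<phi> J) (pull E ?\<phi> K) \<le> weight E J K"
    if J: "J \<subseteq> fgs E" "\<And>y. y \<in> letters E \<Longrightarrow> finite (cut_cosets E J K (half y))" for J
  proof -
    have ci: "cut_invariant E (\<lambda>C. card (cut_cosets E J K C))" by (rule cut_invariant_cosets)
    have "weight E (pull E ?\<phi> J) (pull E ?\<phi> K) = (\<Sum>y\<in>letters E. card (cut_cosets E J K (new_cut X b y)))"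
      unfolding weight_def by (intro sum.cong refl) (use bij[OF J(1)] bij_betw_same_card in blast)
    moreover have "card (cut_cosets E J K (halves X)) \<le> card (cut_cosets E J K (half b))"
      using card_mono[OF J(2)[OF c] sub] hc[OF ci] by simp
    ultimately show ?thesis using sum_new_cut[OF ci b E, of X] unfolding weight_def by simp
  qed
  have f: "finite (cut_cosets E (pull E ?\<phi> J) (pull E ?\<phi> K) (half y))"
    if J: "J \<subseteq> fgs E" "\<And>y. y \<in> letters E \<Longrightarrow> finite (cut_cosets E J K (half y))" and y: "y \<in> letters E" for J y
  proof -
    have "finite (cut_cosets E J K (halves X))" using finite_subset[OF sub J(2)[OF c]] .
    then have "finite (cut_cosets E J K (new_cut X b y))"
      using J(2)[OF y] by (simp add: new_cut_def cut_cosets_compl)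
    then show ?thesis using bij[OF J(1)] bij_betw_finite by blast
  qed
  show ?thesis by (rule that[OF X(1) b cpx]) (use w f in blast)
qed

subsection \<open>Chains of Whitehead moves through subgroups of bounded weight\<close>

definition states :: "'a set \<Rightarrow> nat \<Rightarrow> 'a fg set set" where
  "states E M = {J. subgp J \<and> J \<subseteq> fgs E \<and> (\<forall>y\<in>letters E. finite (cut_cosets E J J (half y))) \<and> weight E J J \<le> M}"

text \<open>\<open>J'\<close> is expressed in the coordinates after the move. An inclusion is
  enough: elements of \<open>J\<close> may be dropped as long as those of \<open>K\<close> are
  kept.\<close>

definition wstep :: "'a set \<Rightarrow> nat \<Rightarrow> ('a fg set \<times> 'a fg set) set" where
  "wstep E M = {(J, J'). J \<in> states E M \<and> J' \<in> states E M \<and>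
     (\<exists>X\<subseteq>letters E. \<exists>b\<in>letters E. lift (wh X b) ` J' \<subseteq> J)}"

text \<open>In terms of the basis that provides the cuts, these are elements whose expressions
  involve no member of \<open>T\<close>.\<close>

definition unseparated :: "'a set \<Rightarrow> 't set \<Rightarrow> ('t \<Rightarrow> 'a fg set) \<Rightarrow> 'a fg set" where
  "unseparated E T A = {g\<in>fgs E. \<forall>t\<in>T. \<forall>u\<in>fgs E. \<not> sep (tr (A t) u) 0 g}"

lemma unseparated_pull:
  assumes \<phi>: "aut_pair E \<phi> \<psi>" and "unseparated E T A \<subseteq> K"
  shows "unseparated E T (\<lambda>t. \<phi> -` A t) \<subseteq> pull E \<phi> K"
proof
  note ap = aut_pairD[OF \<phi>]
  fix g assume g: "g \<in> unseparated E T (\<lambda>t. \<phi> -` A t)"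
  have "\<not> sep (tr (A t) u) 0 (\<phi> g)" if "t \<in> T" "u \<in> fgs E" for t u
  proof -
    have "\<not> sep (tr (\<phi> -` A t) (\<psi> u)) 0 g" using g that ap(6) unfolding unseparated_def by blast
    then show ?thesis using that by (simp add: sep_def ap)
  qed
  then have "\<phi> g \<in> unseparated E T A" using g ap(5) by (simp add: unseparated_def)
  then show "g \<in> pull E \<phi> K" using assms(2) g by (auto simp: pull_def unseparated_def)
qed

lemma cut_cosets_mono: "K \<subseteq> K' \<Longrightarrow> cut_cosets E J K C \<subseteq> cut_cosets E J K' C"
  unfolding cut_cosets_def by blast

text \<open>Induction on \<open>complexity\<close>. The parameter \<open>P\<close> lets the same
  descent run without control of the unseparated elements, as the rank bound requires.\<close>

lemma reach_terminal:
  assumes E: "finite E"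
  shows "cut_system E T A x K \<Longrightarrow> K \<subseteq> J \<Longrightarrow> J \<in> states E M \<Longrightarrow> unseparated E T A \<subseteq> K \<or> P \<Longrightarrow>
    \<exists>J' A' x' K'. (J, J') \<in> (wstep E M)\<^sup>* \<and> cut_system E T A' x' K' \<and> K' \<subseteq> J' \<and>
      (unseparated E T A' \<subseteq> K' \<or> P) \<and> (\<forall>t\<in>T. is_half E (A' t))"
proof (induction "complexity E T A" arbitrary: A x K J rule: wf_induct[OF wf_lex_prod[OF wf_less_than wf_less_than]])
  case (1 A x K J)
  show ?case
  proof (cases "\<forall>t\<in>T. is_half E (A t)")
    case True
    then show ?thesis using 1(2,3,5) by (intro exI[of _ J] exI[of _ A] exI[of _ x] exI[of _ K]) simp
  next
    case False
    then obtain t where t: "t \<in> T" "\<not> is_half E (A t)" by blast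
    have J: "subgp J" "J \<subseteq> fgs E" "weight E J J \<le> M" "\<forall>y\<in>letters E. finite (cut_cosets E J J (half y))"
      using 1(4) by (auto simp: states_def)
    have K: "K \<subseteq> fgs E" using 1(3) J(2) by blast
    obtain X b where X: "X \<subseteq> letters E" "b \<in> letters E"
      "(complexity E T (\<lambda>t. lift (wh X b) -` A t), complexity E T A) \<in> less_than <*lex*> less_than"
      and w: "\<forall>J. J \<subseteq> fgs E \<longrightarrow> (\<forall>y\<in>letters E. finite (cut_cosets E J K (half y))) \<longrightarrow>
        weight E (pull E (lift (wh X b)) J) (pull E (lift (wh X b)) K) \<le> weight E J K \<and>
        (\<forall>y\<in>letters E. finite (cut_cosets E (pull E (lift (wh X b)) J) (pull E (lift (wh X b)) K) (half y)))"
      by (rule whitehead_step[OF 1(2) K E t])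
    let ?\<phi> = "lift (wh X b)"
    have \<phi>: "aut_pair E ?\<phi> (lift (wh X (inv_letter b)))" by (rule aut_pair_wh[OF X(2)])
    have finJK: "\<forall>y\<in>letters E. finite (cut_cosets E J K (half y))"
      using J(4) by (auto intro: finite_subset[OF cut_cosets_mono[OF 1(3)]])
    have "weight E J K \<le> weight E J J"
      unfolding weight_def using J(4) by (intro sum_mono card_mono cut_cosets_mono 1(3)) auto
    note wf = conjunct1[OF mp[OF mp[OF spec[OF w, of J] J(2)] finJK]]
      conjunct2[OF mp[OF mp[OF spec[OF w, of J] J(2)] finJK], rule_format]
    from \<open>weight E J K \<le> weight E J J\<close> have w': "weight E (pull E ?\<phi> J) (pull E ?\<phi> K) \<le> M" using wf(1) J(3) by linarith
    have sub: "pull E ?\<phi> K \<subseteq> pull E ?\<phi> J" using 1(3) by (auto simp: pull_def)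
    \<comment> \<open>All of \<open>pull E ?\<phi> J\<close> may have larger weight than
      \<open>J\<close>; the bound holds for what \<open>K\<close> traverses in it, so only the
      subgroup carried by that part is retained.\<close>
    obtain L where L: "subgp L" "pull E ?\<phi> K \<subseteq> L" "L \<subseteq> pull E ?\<phi> J"
      "weight E L L \<le> weight E (pull E ?\<phi> J) (pull E ?\<phi> K)"
      "\<forall>y\<in>letters E. finite (cut_cosets E L L (half y))"
      using ex_carried_subgroup[OF subgp_pull[OF \<phi> J(1)] pull_subset sub E wf(2)] by metis
    have Ls: "L \<in> states E M" using L w' pull_subset by (force simp: states_def)
    have "(J, L) \<in> wstep E M"
      unfolding wstep_def using 1(4) Ls X(1,2) L(3) by (auto simp: pull_def)
    moreover have "\<exists>J' A' x' K'. (L, J') \<in> (wstep E M)\<^sup>* \<and> cut_system E T A' x' K' \<and> K' \<subseteq> J' \<and>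
      (unseparated E T A' \<subseteq> K' \<or> P) \<and> (\<forall>t\<in>T. is_half E (A' t))"
      using 1(1) X(3) cut_system_pull[OF \<phi> 1(2)] L(2) Ls unseparated_pull[OF \<phi>, of T A K] 1(5) by blast
    ultimately show ?thesis by (meson converse_rtrancl_into_rtrancl)
  qed
qed

text \<open>Among all cuts only \<open>A t\<close> has a translate separating 0 from
  \<open>x t\<close>, so distinct cuts belong to distinct letters. The edge of a letter that belongs
  to no cut crosses none of them.\<close>

lemma terminal_letters:
  assumes sys: "cut_system E T A x K" and half: "\<forall>t\<in>T. is_half E (A t)"
  obtains f where "inj_on f T" "f ` T \<subseteq> E" "\<And>e. e \<in> E - f ` T \<Longrightarrow> ltr (e, True) \<in> unseparated E T A"
proof -
  note cs = cut_systemD[OF sys]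
  obtain Y where Y: "\<forall>t\<in>T. Y t \<in> letters E \<and> teq E (A t) (half (Y t))"
    using half unfolding is_half_def by metis
  have "inj_on (\<lambda>t. fst (Y t)) T"
  proof (rule inj_onI)
    fix t u assume tu: "t \<in> T" "u \<in> T" "fst (Y t) = fst (Y u)"
    then have "teq E (A t) (half (Y u))" using Y teq_half_inv[of E "A t" "Y u"] by (auto simp: fst_eq_letter)
    then obtain a where a: "a \<in> fgs E" "\<And>p q g. p \<in> fgs E \<Longrightarrow> q \<in> fgs E \<Longrightarrow> g \<in> fgs E \<Longrightarrow> sep (tr (half (Y u)) g) p q \<longleftrightarrow> sep (tr (A t) (- a + g)) p q"
      by (rule teq_sep) blast
    have "teq E (A u) (half (Y u))" using Y tu by blast
    then obtain a' where a': "a' \<in> fgs E" "\<And>p q g. p \<in> fgs E \<Longrightarrow> q \<in> fgs E \<Longrightarrow> g \<in> fgs E \<Longrightarrow> sep (tr (half (Y u)) g) p q \<longleftrightarrow> sep (tr (A u) (- a' + g)) p q"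
      by (rule teq_sep) blast
    have "sep (tr (A t) (- a + a)) 0 (x t)" using cs(6)[OF tu(1) tu(1), of 0] by simp
    then have "sep (tr (A u) (- a' + a)) 0 (x t)"
      using a(2)[of 0 "x t" a] a'(2)[of 0 "x t" a] a(1) cs(5)[OF tu(1)] by simp
    then show "t = u" using cs(6)[OF tu(1,2), of "- a' + a"] a(1) a'(1) by simp
  qed
  moreover have "(\<lambda>t. fst (Y t)) ` T \<subseteq> E" using Y by (auto simp: letters_def)
  moreover have "ltr (e, True) \<in> unseparated E T A" if e: "e \<in> E - (\<lambda>t. fst (Y t)) ` T" for e
  proof -
    have eE: "ltr (e, True) \<in> fgs E" using e by (simp add: letters_def)
    have "\<not> sep (tr (A t) u) 0 (ltr (e, True))" if tu: "t \<in> T" "u \<in> fgs E" for t u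
    proof
      assume s: "sep (tr (A t) u) 0 (ltr (e, True))"
      have "teq E (A t) (half (Y t))" using Y tu by blast
      then obtain a where a: "a \<in> fgs E" "\<And>p q g. p \<in> fgs E \<Longrightarrow> q \<in> fgs E \<Longrightarrow> g \<in> fgs E \<Longrightarrow> sep (tr (half (Y t)) g) p q \<longleftrightarrow> sep (tr (A t) (- a + g)) p q"
        by (rule teq_sep) blast
      have "sep (tr (half (Y t)) (a + u)) 0 (ltr (e, True) + 0)"
        using a(2)[of 0 "ltr (e, True)" "a + u"] a(1) tu(2) s eE by (simp flip: add.assoc)
      then have "(e, True) = Y t \<or> (e, True) = inv_letter (Y t)" unfolding sep_tr_half by blast
      then have "e = fst (Y t)" by (metis fst_conv fst_inv_letter)
      then show False using e tu by blast
    qed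
    then show ?thesis using eE by (simp add: unseparated_def)
  qed
  ultimately show ?thesis using that by blast
qed

text \<open>The number of subsets of a ball: a state is determined by its elements of length at most
  \<open>2 * M + 1\<close>, and the base \<open>2 * n + 1\<close> bounds the powers of the
  \<open>2 * n\<close> letters for each of the \<open>2 * M + 2\<close> lengths.\<close>

definition state_bound :: "nat \<Rightarrow> nat \<Rightarrow> nat" where
  "state_bound n M = 2 ^ ((2 * M + 2) * (2 * n + 1) ^ (2 * M + 1))"

lemma finite_states:
  assumes E: "finite E"
  shows "finite (states E M)" "card (states E M) \<le> state_bound (card E) M"
proof -
  define k where "k = 2 * M + 1"
  define B where "B = {g\<in>fgs E. length (word g) \<le> k}"
  have fl: "finite (letters E)" "card (letters E) = 2 * card E"
    using E by (simp_all add: letters_def card_cartesian_product)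
  have sub: "word ` B \<subseteq> {xs. set xs \<subseteq> letters E \<and> length xs \<le> k}"
    by (auto simp: B_def fgs_def words_letters)
  have injw: "inj_on word B" by (auto simp: inj_on_def word_inject)
  have finB: "finite B"
    using finite_imageD[OF finite_subset[OF sub finite_lists_length_le[OF fl(1)]] injw] .
  have "card B = card (word ` B)" using card_image[OF injw] by simp
  also have "\<dots> \<le> card {xs. set xs \<subseteq> letters E \<and> length xs \<le> k}"
    by (rule card_mono[OF finite_lists_length_le[OF fl(1)] sub])
  also have "\<dots> = (\<Sum>i\<le>k. (2 * card E) ^ i)" using card_lists_length_le[OF fl(1)] fl(2) by simp
  also have "\<dots> \<le> (\<Sum>i\<le>k. (2 * card E + 1) ^ k)"
  proof (rule sum_mono)
    fix i assume "i \<in> {..k}"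
    then have "(2 * card E + 1) ^ i \<le> (2 * card E + 1) ^ k" by (intro power_increasing) auto
    moreover have "(2 * card E) ^ i \<le> (2 * card E + 1) ^ i" by (intro power_mono) auto
    ultimately show "(2 * card E) ^ i \<le> (2 * card E + 1) ^ k" by linarith
  qed
  finally have cB: "card B \<le> (2 * M + 2) * (2 * card E + 1) ^ k" by (simp add: k_def)
  have inj: "inj_on (\<lambda>J. J \<inter> B) (states E M)"
  proof (rule inj_onI)
    have *: "J \<subseteq> G" if "J \<in> states E M" "G \<in> states E M" "J \<inter> B = G \<inter> B" for J G
    proof (rule bounded_weight_short[of J E M])
      show "s \<in> G" if "s \<in> J" "length (word s) \<le> 2 * M + 1" for s
        using that \<open>J \<in> states E M\<close> \<open>J \<inter> B = G \<inter> B\<close> by (auto simp: states_def B_def k_def)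
    qed (use that E in \<open>auto simp: states_def\<close>)
    fix J G assume "J \<in> states E M" "G \<in> states E M" "J \<inter> B = G \<inter> B"
    then show "J = G" using *[of J G] *[of G J] by simp
  qed
  have im: "(\<lambda>J. J \<inter> B) ` states E M \<subseteq> Pow B" by blast
  show "finite (states E M)" using inj_on_finite[OF inj im] finB by simp
  have "card (states E M) \<le> card (Pow B)" using card_inj_on_le[OF inj im] finB by simp
  also have "\<dots> = 2 ^ card B" using finB by (simp add: card_Pow)
  also have "\<dots> \<le> state_bound (card E) M"
    unfolding state_bound_def using cB by (intro power_increasing) (auto simp: k_def)
  finally show "card (states E M) \<le> state_bound (card E) M" .
qed

text \<open>Each move is written in the letters of the current basis, so it is composed on the
  inside of \<open>f\<close>.\<close>

primrec reachable :: "'a set \<Rightarrow> nat \<Rightarrow> ('a \<Rightarrow> 'a fg) set" where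
  "reachable E 0 = {\<lambda>e. ltr (e, True)}"
| "reachable E (Suc m) = {\<lambda>e. lift f (wh X b e) | f X b. f \<in> reachable E m \<and> X \<subseteq> letters E \<and> b \<in> letters E}"

lemma lift_comp: "lift (\<lambda>e. lift f (h e)) g = lift f (lift h g)"
proof (induction g rule: fg_induct)
  case (plus y g)
  have "lift_letter (\<lambda>e. lift f (h e)) y = lift f (lift_letter h y)"
    by (simp add: lift_letter_def lift_uminus)
  then show ?case using plus by (simp add: lift_ltr_plus lift_plus)
qed simp

lemma lift_id: "lift (\<lambda>e. ltr (e, True)) g = g"
proof (induction g rule: fg_induct)
  case (plus y g)
  have "lift_letter (\<lambda>e. ltr (e, True)) y = ltr y"
    using ltr_inv[of "(fst y, True)"] by (cases y) (auto simp: lift_letter_def)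
  then show ?case using plus by (simp add: lift_ltr_plus)
qed simp

lemma reachable_aut: "f \<in> reachable E m \<Longrightarrow> \<exists>\<psi>. aut_pair E (lift f) \<psi>"
proof (induction m arbitrary: f)
  case 0
  then show ?case by (auto simp: aut_pair_def lift_id intro!: exI[of _ id])
next
  case (Suc m)
  then obtain f' X b where f: "f = (\<lambda>e. lift f' (wh X b e))" "f' \<in> reachable E m" "b \<in> letters E"
    by auto
  obtain \<psi> where \<psi>: "aut_pair E (lift f') \<psi>" using Suc.IH[OF f(2)] by blast
  note a = aut_pairD[OF \<psi>] and c = aut_pairD[OF aut_pair_wh[OF f(3), of X]]
  have "aut_pair E (lift f) (\<lambda>g. lift (wh X (inv_letter b)) (\<psi> g))"
    unfolding aut_pair_def f(1) lift_comp by (auto simp: a c)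
  then show ?case by blast
qed

lemma relpow_wstep:
  "(J, J') \<in> wstep E M ^^ m \<Longrightarrow> \<exists>f\<in>reachable E m. lift f ` J' \<subseteq> J"
proof (induction m arbitrary: J')
  case 0
  then show ?case by (simp add: lift_id)
next
  case (Suc m)
  then obtain L where L: "(J, L) \<in> wstep E M ^^ m" "(L, J') \<in> wstep E M" by auto
  obtain f where f: "f \<in> reachable E m" "lift f ` L \<subseteq> J" using Suc.IH[OF L(1)] by blast
  obtain X b where Xb: "X \<subseteq> letters E" "b \<in> letters E" "lift (wh X b) ` J' \<subseteq> L"
    using L(2) by (auto simp: wstep_def)
  have "(\<lambda>e. lift f (wh X b e)) \<in> reachable E (Suc m)" using f Xb unfolding reachable.simps by blast
  moreover have "lift (\<lambda>e. lift f (wh X b e)) ` J' \<subseteq> J" using f(2) Xb(3) by (auto simp: lift_comp)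
  ultimately show ?case by blast
qed

text \<open>The elements carried by the edges that \<open>Z\<close> traverses form a subgroup
  containing \<open>Z\<close>, hence all of \<open>H\<close>; so \<open>H\<close> traverses no
  further edges.\<close>

lemma generated_state:
  assumes E: "finite E" and Z: "finite Z" "Z \<subseteq> fgs E"
    and H: "subgp H" "Z \<subseteq> H" "H \<subseteq> fgs E" "\<And>G. subgp G \<Longrightarrow> Z \<subseteq> G \<Longrightarrow> H \<subseteq> G"
  shows "H \<in> states E (2 * (\<Sum>z\<in>Z. length (word z)))"
proof -
  define T where "T y = cut_cosets E H Z (half y)" for y
  have "H \<subseteq> carried E H T"
    by (rule H(4)[OF subgp_carried[OF H(1,3)]]) (use H(2) in \<open>auto simp: carried_def T_def cut_cosets_def\<close>)
  then have sub: "cut_cosets E H H (half y) \<subseteq> T y" if "y \<in> letters E" for y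
    using that unfolding carried_def cut_cosets_def by blast
  define P where "P = (\<Union>z\<in>Z. {(y, g). sep (tr (half y) g) 0 z})"
  have P: "finite P" "card P \<le> 2 * (\<Sum>z\<in>Z. length (word z))"
  proof -
    show "finite P" unfolding P_def using Z card_sep_pairs by blast
    have "card P \<le> (\<Sum>z\<in>Z. card {(y, g). sep (tr (half y) g) 0 z})"
      unfolding P_def by (rule card_UN_le[OF Z(1)])
    also have "\<dots> \<le> (\<Sum>z\<in>Z. 2 * length (word z))" by (intro sum_mono) (use card_sep_pairs in blast)
    finally show "card P \<le> 2 * (\<Sum>z\<in>Z. length (word z))" by (simp add: sum_distrib_left)
  qed
  have SP: "(SIGMA y:letters E. T y) \<subseteq> (\<lambda>(y, g). (y, coset g H)) ` P"
    unfolding P_def T_def cut_cosets_def by fastforce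
  then have finS: "finite (SIGMA y:letters E. T y)" using P(1) finite_subset by blast
  have finT: "finite (T y)" if "y \<in> letters E" for y
  proof -
    have "T y \<subseteq> snd ` (SIGMA y:letters E. T y)" using that by force
    then show ?thesis using finS finite_subset by blast
  qed
  have "weight E H H \<le> (\<Sum>y\<in>letters E. card (T y))"
    unfolding weight_def by (intro sum_mono card_mono finT sub)
  also have "\<dots> = card (SIGMA y:letters E. T y)" using finite_letters[OF E] finT by (simp add: card_SigmaI)
  also have "\<dots> \<le> card ((\<lambda>(y, g). (y, coset g H)) ` P)" by (rule card_mono[OF finite_imageI[OF P(1)] SP])
  also have "\<dots> \<le> card P" by (rule card_image_le[OF P(1)])
  finally have "weight E H H \<le> 2 * (\<Sum>z\<in>Z. length (word z))" using P(2) by linarith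
  moreover have "finite (cut_cosets E H H (half y))" if "y \<in> letters E" for y
    using finite_subset[OF sub[OF that] finT[OF that]] .
  ultimately show ?thesis using H by (simp add: states_def)
qed

text \<open>The descent with the trivial subgroup as state, which has weight 0, turns every cut into
  an edge cut, and distinct cuts end at distinct letters.\<close>

lemma cut_system_card_le:
  assumes E: "finite E" and sys: "cut_system E T A x K"
  shows "card T \<le> card E"
proof -
  have "cut_system E T A x {0}" using sys by (simp add: cut_system_def)
  moreover have "{0} \<in> states E 0"
    by (auto simp: states_def subgp_def weight_def cut_cosets_def)
  ultimately obtain A' x' K' where t: "cut_system E T A' x' K'" "\<forall>t\<in>T. is_half E (A' t)"
    using reach_terminal[OF E, of T A x "{0}" "{0}" 0 True] by blast
  then obtain f where "inj_on f T" "f ` T \<subseteq> E" by (rule terminal_letters)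
  then show ?thesis using E by (rule card_inj_on_le)
qed

theorem short_chain:
  assumes E: "finite E" and H: "H \<in> states E M" and sys: "cut_system E T A x K"
    and K: "K \<subseteq> H" "unseparated E T A \<subseteq> K"
  shows "\<exists>m \<le> state_bound (card E) M ^ 2. \<exists>f\<in>reachable E m. \<exists>S\<subseteq>E. card E - card T \<le> card S \<and> f ` S \<subseteq> H"
proof -
  obtain J' A' x' K' where t: "(H, J') \<in> (wstep E M)\<^sup>*" "cut_system E T A' x' K'" "K' \<subseteq> J'"
    "unseparated E T A' \<subseteq> K'" "\<forall>t\<in>T. is_half E (A' t)"
    using reach_terminal[OF E sys K(1) H, of False] K(2) by blast
  have sub: "wstep E M \<subseteq> states E M \<times> states E M" by (auto simp: wstep_def)
  have fin: "finite (wstep E M)" using finite_subset[OF sub] finite_states(1)[OF E] by blast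
  have "card (wstep E M) \<le> card (states E M \<times> states E M)"
    by (rule card_mono[OF _ sub]) (use finite_states(1)[OF E] in auto)
  also have "\<dots> \<le> state_bound (card E) M ^ 2"
    using finite_states(2)[OF E, of M] by (simp add: card_cartesian_product power2_eq_square mult_mono)
  finally have cw: "card (wstep E M) \<le> state_bound (card E) M ^ 2" .
  \<comment> \<open>The powers of a finite relation up to its cardinality exhaust its closure; this
    is the removal of repetitions. Pairs of states are counted, which explains the square.\<close>
  obtain m where m: "m \<le> card (wstep E M)" "(H, J') \<in> wstep E M ^^ m"
    using t(1) unfolding rtrancl_finite_eq_relpow[OF fin] by blast
  obtain f where f: "f \<in> reachable E m" "lift f ` J' \<subseteq> H" using relpow_wstep[OF m(2)] by blast
  obtain h where h: "inj_on h T" "h ` T \<subseteq> E" "\<And>e. e \<in> E - h ` T \<Longrightarrow> ltr (e, True) \<in> unseparated E T A'"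
    using terminal_letters[OF t(2,5)] by metis
  have "card (E - h ` T) = card E - card T"
    using h E cut_systemD(1)[OF sys] by (simp add: card_Diff_subset card_image)
  moreover have "f e \<in> H" if "e \<in> E - h ` T" for e
  proof -
    have "ltr (e, True) \<in> J'" using h(3)[OF that] t(3,4) by blast
    then have "lift f (ltr (e, True)) \<in> H" using f(2) by blast
    then show ?thesis by (simp add: lift_letter_def)
  qed
  ultimately show ?thesis using m(1) cw f(1)
    by (intro exI[of _ m] conjI bexI[of _ f] exI[of _ "E - h ` T"]) auto
qed

section \<open>Bases meeting a subgroup\<close>

subsection \<open>Cut systems from free bases\<close>

lemma free_group_simps [simp]:
  "carrier (free_group E) = {w \<in> words E. reduced w}" "\<one>\<^bsub>free_group E\<^esub> = []"
  "u \<otimes>\<^bsub>free_group E\<^esub> v = reduce (u @ v)"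
  by (simp_all add: free_group_def)

lemma word_in_carrier [simp]: "word g \<in> carrier (free_group E) \<longleftrightarrow> g \<in> fgs E"
  by (simp add: fgs_def)

lemma of_word_reduce [simp]: "of_word (reduce w) = of_word w"
  by (simp add: of_word_eq_iff reduce_reduced reduced_reduce)

lemma of_word_inv:
  assumes "u \<in> carrier (free_group E)"
  shows "of_word (inv\<^bsub>free_group E\<^esub> u) = - of_word u"
proof -
  interpret G: group "free_group E" by (rule group_free_group)
  have "of_word (inv\<^bsub>free_group E\<^esub> u \<otimes>\<^bsub>free_group E\<^esub> u) = 0" using G.l_inv[OF assms] by simp
  then have "of_word (inv\<^bsub>free_group E\<^esub> u) + of_word u = 0" by (simp add: of_word_append)
  then show ?thesis by (simp add: eq_neg_iff_add_eq_0)
qed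

lemma of_word_word_val:
  assumes "B \<subseteq> carrier (free_group E)" "W \<in> words B"
  shows "word_val (free_group E) W \<in> carrier (free_group E) \<and>
    of_word (word_val (free_group E) W) = lift of_word (of_word W)"
  using assms(2)
proof (induction W)
  case Nil
  then show ?case by (simp add: word_val_def words_def)
next
  case (Cons y W)
  interpret G: group "free_group E" by (rule group_free_group)
  have "fst y \<in> B" and W: "W \<in> words B" using Cons.prems by (auto simp: words_def)
  then have y: "fst y \<in> carrier (free_group E)" using assms(1) by blast
  then have "letter_val (free_group E) y \<in> carrier (free_group E)" by (simp add: letter_val_def del: free_group_simps)
  moreover have "of_word (letter_val (free_group E) y) = lift_letter of_word y"
    using y by (simp add: letter_val_def lift_letter_def of_word_inv del: free_group_simps(1))
  moreover have "word_val (free_group E) (y # W) = letter_val (free_group E) y \<otimes>\<^bsub>free_group E\<^esub> word_val (free_group E) W"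
    by (simp add: word_val_def)
  ultimately show ?case using Cons.IH[OF W] G.m_closed
    by (simp add: of_word_append of_word_Cons lift_ltr_plus del: free_group_simps(1))
qed

lemma word_plus: "word (g + h) = reduce (word g @ word h)"
  by (simp add: plus_fg_def)

lemma bij_word_fgs: "bij_betw word (fgs E) (carrier (free_group E))"
  by (rule bij_betw_byWitness[of _ of_word]) (auto simp: fgs_def reduce_reduced of_word_in_fgs)

text \<open>Evaluation of words over \<open>B\<close> is a homomorphism for any subset of the group,
  so being a basis is a matter of bijectivity alone. The members of \<open>B\<close> serve as
  letters of a second free group.\<close>

lemma free_basis_iff_bij_lift:
  assumes B: "B \<subseteq> carrier (free_group E)"
  shows "free_basis (free_group E) B \<longleftrightarrow> bij_betw (lift of_word) (fgs B) (fgs E)"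
proof -
  let ?G = "free_group E"
  interpret G: group ?G by (rule group_free_group)
  have val: "word_val ?G W = word (lift of_word (of_word W))" if "W \<in> words B" for W
  proof -
    have "reduced (word_val ?G W)" "of_word (word_val ?G W) = lift of_word (of_word W)"
      using of_word_word_val[OF B that] by auto
    then show ?thesis by (metis word_of_word reduce_reduced)
  qed
  have "word_val ?G \<in> hom (free_group B) ?G"
  proof (rule homI)
    fix V W assume "V \<in> carrier (free_group B)" "W \<in> carrier (free_group B)"
    then have VW: "V \<in> words B" "W \<in> words B" "V @ W \<in> words B" by (auto simp: words_def)
    then have "word_val ?G (V \<otimes>\<^bsub>free_group B\<^esub> W) = word (lift of_word (of_word V + of_word W))"
      using val[OF reduce_words[OF VW(3)]] by (simp add: of_word_append)
    also have "\<dots> = word_val ?G V \<otimes>\<^bsub>?G\<^esub> word_val ?G W"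
      unfolding lift_plus word_plus free_group_simps by (simp only: val VW)
    finally show "word_val ?G (V \<otimes>\<^bsub>free_group B\<^esub> W) = word_val ?G V \<otimes>\<^bsub>?G\<^esub> word_val ?G W" .
  qed (use of_word_word_val[OF B] in auto)
  then have "free_basis ?G B \<longleftrightarrow> bij_betw (word_val ?G) (carrier (free_group B)) (carrier ?G)"
    using B by (simp add: free_basis_def iso_def)
  also have "\<dots> \<longleftrightarrow> bij_betw (word_val ?G \<circ> word) (fgs B) (carrier ?G)"
    by (rule bij_betw_comp_iff[OF bij_word_fgs])
  also have "\<dots> \<longleftrightarrow> bij_betw (word \<circ> lift of_word) (fgs B) (carrier ?G)"
    by (rule bij_betw_cong) (use val in \<open>auto simp: fgs_def\<close>)
  also have "\<dots> \<longleftrightarrow> bij_betw (lift of_word) (fgs B) (fgs E)"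
  proof (rule bij_betw_comp_iff2[OF bij_word_fgs, symmetric])
    have "subgp (fgs E)" by (rule subgp_fgs)
    then show "lift of_word ` fgs B \<subseteq> fgs E"
      using lift_in_subgp[of "fgs E" B of_word] B by (auto intro: of_word_in_fgs)
  qed
  finally show ?thesis .
qed

lemma sep_at_letter:
  assumes "word g = u @ y # v"
  shows "sep (tr (half y) (of_word v)) 0 g"
proof -
  have red: "reduced (y # v)" if "reduced (u @ y # v)" for u
    using that by (induction u) (auto dest: reduced_tl)
  then have "reduced (y # v)" using assms by (metis reduced_word)
  then have w: "word (ltr y + of_word v) = y # v" "word (of_word v) = v"
    using reduced_tl[of y v] by (simp_all only: of_word_Cons[symmetric] word_of_word reduce_reduced)
  have "\<not> sep (tr (half y) (of_word v)) 0 (of_word v)"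
  proof
    assume "sep (tr (half y) (of_word v)) 0 (of_word v)"
    then obtain u where "word (of_word v) = u @ word (ltr y + of_word v)" using sep_tr_half_suffix by blast
    then have "v = u @ y # v" unfolding w .
    then have "length v = length (u @ y # v)" by simp
    then show False by simp
  qed
  moreover have "sep (tr (half y) (of_word v)) (of_word v) (ltr y + of_word v)" by (simp add: sep_tr_half)
  ultimately have "sep (tr (half y) (of_word v)) 0 (ltr y + of_word v)" by (auto simp: sep_def)
  then show ?thesis by (rule sep_tr_half_append[rotated, of _ _ _ _ u]) (simp only: assms w)
qed

text \<open>Tree properties of the Cayley tree of \<open>B\<close>, transported by the bijection.
  Adding an element of \<open>K\<close> on the left walks along edges with labels outside
  \<open>T\<close>, so it crosses no cut.\<close>

lemma cut_system_of_basis: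
  assumes bij: "bij_betw (lift f) (fgs B) (fgs E)" and T: "finite T" "T \<subseteq> B"
  defines "A \<equiv> \<lambda>t. lift f ` (half (t, True) \<inter> fgs B)" and "K \<equiv> lift f ` fgs (B - T)"
  shows "cut_system E T A f K" "unseparated E T A \<subseteq> K"
proof -
  let ?\<chi> = "lift f"
  have im: "?\<chi> ` fgs B = fgs E" and inj: "inj_on ?\<chi> (fgs B)" using bij by (auto simp: bij_betw_def)
  have mem: "?\<chi> p \<in> A t \<longleftrightarrow> p \<in> half (t, True)" if "p \<in> fgs B" for p t
    unfolding A_def using inj that by (auto dest: inj_onD)
  have sep: "sep (tr (A t) (?\<chi> g)) (?\<chi> p) (?\<chi> q) \<longleftrightarrow> sep (tr (half (t, True)) g) p q"
    if "g \<in> fgs B" "p \<in> fgs B" "q \<in> fgs B" for t g p q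
    using mem[of "p - g"] mem[of "q - g"] that by (simp add: sep_def lift_minus)
  have sub: "fgs (B - T) \<subseteq> fgs B" by (auto simp: fgs_def words_def)
  have inv: "?\<chi> k + ?\<chi> p \<in> A t \<longleftrightarrow> ?\<chi> p \<in> A t" if "t \<in> T" "k \<in> fgs (B - T)" "p \<in> fgs B" for t k p
    using that(2)
  proof (induction k rule: fgs_induct)
    case (plus y g)
    have gp: "g + p \<in> fgs B" "ltr y + (g + p) \<in> fgs B" using plus that(3) sub by (auto simp: letters_def)
    have "\<not> sep (half (t, True)) (g + p) (ltr y + (g + p))"
      using plus(1) that(1) by (auto simp: sep_half letters_def)
    then have "?\<chi> (ltr y + (g + p)) \<in> A t \<longleftrightarrow> ?\<chi> (g + p) \<in> A t" using mem gp by (simp add: sep_def)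
    then show ?case using plus.IH by (simp only: lift_plus add.assoc)
  qed simp
  have K: "\<forall>t\<in>T. \<forall>k\<in>K. \<forall>p\<in>fgs E. k + p \<in> A t \<longleftrightarrow> p \<in> A t"
    using inv unfolding K_def im[symmetric] by blast
  have nest: "\<not> cross (fgs E) (tr (A t) (?\<chi> g)) (A u)" if "t \<in> T" "u \<in> T" "g \<in> fgs B" for t u g
  proof -
    have "cross (fgs E) (tr (A t) (?\<chi> g)) (A u) \<longleftrightarrow> cross (fgs B) (tr (half (t, True)) g) (half (u, True))"
      by (rule cross_bij[OF im]) (use that mem in \<open>auto simp: lift_minus[symmetric]\<close>)
    moreover have "\<not> cross (fgs B) (tr (half (t, True)) g) (tr (half (u, True)) 0)"
      by (rule half_nested) (use that T in \<open>auto simp: letters_def\<close>)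
    ultimately show ?thesis by simp
  qed
  have fin: "finite {g\<in>fgs E. sep (A t) g (?\<chi> q + g)}" if q: "q \<in> fgs B" for t q
  proof (rule finite_subset)
    show "{g\<in>fgs E. sep (A t) g (?\<chi> q + g)} \<subseteq> (\<lambda>g. ?\<chi> (- g)) ` {g. sep (tr (half (t, True)) g) 0 q}"
    proof
      fix g assume g: "g \<in> {g\<in>fgs E. sep (A t) g (?\<chi> q + g)}"
      then obtain g' where g': "g' \<in> fgs B" "g = ?\<chi> g'" using im by blast
      then have "sep (half (t, True)) g' (q + g')"
        using g mem[of g'] mem[of "q + g'"] q by (simp add: sep_def lift_plus)
      then have "sep (tr (half (t, True)) (- g')) 0 q" by (simp add: sep_tr)
      then show "g \<in> (\<lambda>g. ?\<chi> (- g)) ` {g. sep (tr (half (t, True)) g) 0 q}"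
        using g' by (intro image_eqI[of _ _ "- g'"]) auto
    qed
  qed (simp add: finite_tr_half_sep)
  have x: "f t \<in> fgs E" "?\<chi> (ltr (t, True)) = f t" if "t \<in> T" for t
  proof -
    have "ltr (t, True) \<in> fgs B" using that T by (auto simp: letters_def)
    then have "?\<chi> (ltr (t, True)) \<in> fgs E" using im by blast
    then show "f t \<in> fgs E" "?\<chi> (ltr (t, True)) = f t" by (simp_all add: lift_letter_def)
  qed
  have sx: "sep (tr (A u) (?\<chi> g)) 0 (f t) \<longleftrightarrow> u = t \<and> ?\<chi> g = 0" if "t \<in> T" "u \<in> T" "g \<in> fgs B" for t u g
  proof -
    have "ltr (t, True) \<in> fgs B" using that T by (auto simp: letters_def)
    then have "sep (tr (A u) (?\<chi> g)) 0 (f t) \<longleftrightarrow> sep (tr (half (u, True)) g) 0 (ltr (t, True) + 0)"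
      using sep[of g 0 "ltr (t, True)" u] that x(2) by simp
    also have "\<dots> \<longleftrightarrow> g = 0 \<and> u = t" unfolding sep_tr_half by auto
    also have "g = 0 \<longleftrightarrow> ?\<chi> g = 0" using inj_onD[OF inj, of g 0] that by auto
    finally show ?thesis by blast
  qed
  show "cut_system E T A f K"
  proof -
    have ex: "\<exists>g'\<in>fgs B. g = ?\<chi> g'" if "g \<in> fgs E" for g using that unfolding im[symmetric] by blast
    have "\<forall>t\<in>T. \<forall>u\<in>T. \<forall>g\<in>fgs E. \<not> cross (fgs E) (tr (A t) g) (A u)"
      using nest ex by blast
    moreover have "\<forall>t\<in>T. \<forall>q\<in>fgs E. finite {g\<in>fgs E. sep (A t) g (q + g)}"
    proof (intro ballI)
      fix t q assume "q \<in> fgs E"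
      then obtain q' where "q' \<in> fgs B" "q = ?\<chi> q'" using ex by blast
      then show "finite {g\<in>fgs E. sep (A t) g (q + g)}" using fin by simp
    qed
    moreover have "\<forall>t\<in>T. f t \<in> fgs E \<and> (\<forall>u\<in>T. \<forall>g\<in>fgs E. sep (tr (A u) g) 0 (f t) \<longleftrightarrow> u = t \<and> g = 0)"
    proof (intro ballI conjI)
      fix t u g assume "t \<in> T" "u \<in> T" "g \<in> fgs E"
      moreover obtain g' where "g' \<in> fgs B" "g = ?\<chi> g'" using ex \<open>g \<in> fgs E\<close> by blast
      ultimately show "sep (tr (A u) g) 0 (f t) \<longleftrightarrow> u = t \<and> g = 0" using sx by simp
    qed (rule x(1))
    ultimately show ?thesis unfolding cut_system_def using T(1) K by blast
  qed
  show "unseparated E T A \<subseteq> K"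
  proof
    fix g assume g: "g \<in> unseparated E T A"
    then obtain g' where g': "g' \<in> fgs B" "g = ?\<chi> g'" unfolding unseparated_def im[symmetric] by blast
    \<comment> \<open>A letter from \<open>T\<close> would be an edge of the reduced path of
      \<open>g'\<close>, and the cut at this edge would separate 0 from \<open>g\<close>. A negative
      letter is replaced by its reversed edge.\<close>
    have "fst y \<notin> T" if y: "y \<in> set (word g')" for y
    proof
      assume t: "fst y \<in> T"
      obtain u v where w: "word g' = u @ y # v" using split_list[OF y] by blast
      have v: "of_word v \<in> fgs B" "y \<in> letters B" using g' w by (auto simp: fgs_def words_letters intro!: of_word_in_fgs[unfolded fgs_def words_letters, simplified])
      have s: "sep (tr (half y) (of_word v)) 0 g'" by (rule sep_at_letter[OF w])
      obtain h where h: "h \<in> fgs B" "sep (tr (half (fst y, True)) h) 0 g'"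
      proof (cases "snd y")
        case True
        then show ?thesis using that[of "of_word v"] s v by (metis prod.collapse)
      next
        case False
        then have "inv_letter y = (fst y, True)" by (cases y) simp
        then have "tr (half (fst y, True)) (ltr y + of_word v) = - tr (half y) (of_word v)" by (simp add: compl_tr_half)
        then have "sep (tr (half (fst y, True)) (ltr y + of_word v)) 0 g'" using s by (auto simp: sep_def)
        then show ?thesis using that[of "ltr y + of_word v"] v by simp
      qed
      have "sep (tr (A (fst y)) (?\<chi> h)) (?\<chi> 0) (?\<chi> g')" using sep[of h 0 g' "fst y"] h g' by simp
      moreover have "?\<chi> h \<in> fgs E" using h im by blast
      ultimately show False using g t g' unfolding unseparated_def by auto
    qed
    then have "g' \<in> fgs (B - T)" using g'(1) by (auto simp: fgs_def words_def mem_Times_iff)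
    then show "g \<in> K" using g' by (simp add: K_def)
  qed
qed

subsection \<open>Bases reachable by few moves\<close>

lemma generate_state:
  assumes Z: "Z \<subseteq> carrier (free_group E)"
  defines "H \<equiv> of_word ` generate (free_group E) Z"
  shows "subgp H" "H \<subseteq> fgs E" "of_word ` Z \<subseteq> H"
    "\<And>G. subgp G \<Longrightarrow> of_word ` Z \<subseteq> G \<Longrightarrow> H \<subseteq> G"
    "\<And>u. u \<in> carrier (free_group E) \<Longrightarrow> of_word u \<in> H \<longleftrightarrow> u \<in> generate (free_group E) Z"
proof -
  interpret G: group "free_group E" by (rule group_free_group)
  let ?S = "generate (free_group E) Z"
  have inc: "?S \<subseteq> carrier (free_group E)" by (rule G.generate_incl[OF Z])
  interpret S: subgroup ?S "free_group E" by (rule G.generate_is_subgroup[OF Z])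
  show "subgp H" unfolding subgp_def
  proof (intro conjI ballI)
    show "0 \<in> H" unfolding H_def using S.one_closed by (intro image_eqI[of _ _ "[]"]) auto
    fix a assume "a \<in> H"
    then obtain u where u: "u \<in> ?S" "a = of_word u" by (auto simp: H_def)
    show "- a \<in> H" unfolding H_def
      by (rule image_eqI[OF _ S.m_inv_closed[OF u(1)]]) (use u inc in \<open>auto simp: of_word_inv subset_iff\<close>)
    fix b assume "b \<in> H"
    then obtain v where v: "v \<in> ?S" "b = of_word v" by (auto simp: H_def)
    show "a + b \<in> H" unfolding H_def
      by (rule image_eqI[OF _ S.m_closed[OF u(1) v(1)]]) (simp add: u v of_word_append)
  qed
  show "H \<subseteq> fgs E" using inc by (auto simp: H_def intro: of_word_in_fgs)
  show "of_word ` Z \<subseteq> H" by (auto simp: H_def intro: generate.incl)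
  show "H \<subseteq> G" if G: "subgp G" "of_word ` Z \<subseteq> G" for G
  proof -
    have "of_word u \<in> G" if "u \<in> ?S" for u
      using that
    proof (induction rule: generate.induct)
      case (inv h)
      then have "h \<in> carrier (free_group E)" using Z by blast
      from of_word_inv[OF this] show ?case using inv G by (auto simp: subgpD)
    next
      case (eng h1 h2)
      then show ?case using G by (simp add: of_word_append subgpD)
    qed (use G in \<open>auto simp: subgpD\<close>)
    then show ?thesis by (auto simp: H_def)
  qed
  show "of_word u \<in> H \<longleftrightarrow> u \<in> ?S" if "u \<in> carrier (free_group E)" for u
  proof
    assume "of_word u \<in> H"
    then obtain v where "v \<in> ?S" "of_word u = of_word v" by (auto simp: H_def)
    then show "u \<in> ?S" using that inc by (auto simp: of_word_eq_iff reduce_reduced subset_iff)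
  qed (simp add: H_def)
qed

text \<open>The image of the standard basis under an automorphism. The maps \<open>r\<close> and
  \<open>s\<close> merely rename the letter \<open>e\<close> as the letter \<open>word (f e)\<close>
  and back.\<close>

lemma free_basis_of_reachable:
  assumes f: "f \<in> reachable E m"
  shows "inj_on f E" "f ` E \<subseteq> fgs E" "free_basis (free_group E) (word ` f ` E)"
proof -
  obtain \<psi> where ap: "aut_pair E (lift f) \<psi>" using reachable_aut[OF f] by blast
  have fe: "f e = lift f (ltr (e, True))" for e by (simp add: lift_letter_def)
  have le: "ltr (e, True) \<in> fgs E" if "e \<in> E" for e using that by (simp add: letters_def)
  show inj: "inj_on f E"
  proof (rule inj_onI)
    fix e e' assume "e \<in> E" "e' \<in> E" "f e = f e'"
    then show "e = e'" using inj_onD[OF aut_pair_inj[OF ap] _ le le] fe[of e] fe[of e'] by auto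
  qed
  show im: "f ` E \<subseteq> fgs E" using aut_pairD(5)[OF ap le] fe by auto
  define B where "B = word ` f ` E"
  define r where "r = lift (\<lambda>e. ltr (word (f e), True))"
  define s where "s = lift (\<lambda>b. ltr (the_inv_into E (\<lambda>e. word (f e)) b, True))"
  have injw: "inj_on (\<lambda>e. word (f e)) E" using inj by (auto simp: inj_on_def word_inject)
  have B: "B = (\<lambda>e. word (f e)) ` E" by (auto simp: B_def)
  have sr: "s (r g) = g" if "g \<in> fgs E" for g
    unfolding s_def r_def
    by (rule lift_lift_id[OF _ that]) (simp add: lift_letter_def the_inv_into_f_f[OF injw])
  have rs: "r (s g) = g" if "g \<in> fgs B" for g
    unfolding s_def r_def
    by (rule lift_lift_id[OF _ that]) (auto simp: lift_letter_def B the_inv_into_f_f[OF injw])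
  have rB: "r g \<in> fgs B" if "g \<in> fgs E" for g
    unfolding r_def by (rule lift_in_subgp[OF subgp_fgs _ that]) (auto simp: letters_def B)
  have sE: "s g \<in> fgs E" if "g \<in> fgs B" for g
    unfolding s_def by (rule lift_in_subgp[OF subgp_fgs _ that])
      (auto simp: letters_def B the_inv_into_f_f[OF injw])
  have "lift of_word (r g) = lift f g" for g
    unfolding r_def lift_comp[symmetric] by (simp add: lift_letter_def)
  then have "lift of_word g = lift f (s g)" if "g \<in> fgs B" for g using rs[OF that] by metis
  moreover have "bij_betw s (fgs B) (fgs E)"
    by (rule bij_betw_byWitness[of _ r]) (use sr rs rB sE in auto)
  moreover have "bij_betw (lift f) (fgs E) (fgs E)"
    using aut_pair_inj[OF ap] aut_pair_image[OF ap] by (simp add: bij_betw_def)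
  ultimately have "bij_betw (lift of_word) (fgs B) (fgs E)"
    using bij_betw_trans[of s "fgs B" "fgs E" "lift f" "fgs E"] by (simp add: bij_betw_cong[of "fgs B" "lift of_word" "lift f \<circ> s"])
  moreover have "B \<subseteq> carrier (free_group E)" using im by (auto simp: B_def fgs_def)
  ultimately have "free_basis (free_group E) B" using free_basis_iff_bij_lift by blast
  then show "free_basis (free_group E) (word ` f ` E)" by (simp only: B_def)
qed

text \<open>A basis is not known in advance to be finite, so its finite subsets are bounded, each
  through the cuts of its own members only.\<close>

lemma finite_free_basis:
  assumes E: "finite E" and B: "free_basis (free_group E) B"
  shows "finite B" "card B \<le> card E"
proof -
  have bij: "bij_betw (lift of_word) (fgs B) (fgs E)"
    using B free_basis_iff_bij_lift[of B E] by (auto simp: free_basis_def)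
  have "card T \<le> card E" if "finite T" "T \<subseteq> B" for T
    by (rule cut_system_card_le[OF E cut_system_of_basis(1)[OF bij that]])
  then show "finite B" "card B \<le> card E" by (metis finite_if_finite_subsets_card_bdd subset_refl)+
qed

text \<open>\<open>M\<close> is allowed to exceed the weight obtained from \<open>Z\<close>, because
  the algorithm measures a list in which elements may be repeated.\<close>

theorem reachable_basis_optimal:
  assumes E: "finite E" and Z: "finite Z" "Z \<subseteq> carrier (free_group E)"
    and B: "free_basis (free_group E) B"
    and M: "2 * (\<Sum>z\<in>Z. length z) \<le> M"
  shows "\<exists>m \<le> state_bound (card E) M ^ 2. \<exists>f\<in>reachable E m.
    card (B \<inter> generate (free_group E) Z) \<le> card (word ` f ` E \<inter> generate (free_group E) Z)"
proof -
  let ?G = "free_group E" and ?S = "B \<inter> generate (free_group E) Z"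
  define H where "H = of_word ` generate ?G Z"
  note gs = generate_state[OF Z(2), folded H_def]
  have Bc: "B \<subseteq> carrier ?G" using B by (simp add: free_basis_def)
  have bij: "bij_betw (lift of_word) (fgs B) (fgs E)" using B free_basis_iff_bij_lift[OF Bc] by blast
  note fb = finite_free_basis[OF E B]
  \<comment> \<open>The members of \<open>B\<close> outside the subgroup supply the cuts; the others
    generate the group \<open>K\<close> inside \<open>H\<close>.\<close>
  define T where "T = B - ?S"
  have T: "finite T" "T \<subseteq> B" using fb by (auto simp: T_def)
  have BT: "B - T = ?S" by (auto simp: T_def)
  have KH: "lift of_word ` fgs (B - T) \<subseteq> H"
    using lift_in_subgp[OF gs(1), of ?S of_word] unfolding BT by (auto simp: H_def)
  have "(\<Sum>z\<in>of_word ` Z. length (word z)) \<le> (\<Sum>z\<in>Z. length z)"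
  proof -
    have "(\<Sum>z\<in>of_word ` Z. length (word z)) \<le> (\<Sum>z\<in>Z. length (word (of_word z)))"
      using sum_image_le[of Z "\<lambda>g. length (word g)" of_word] Z(1) by (simp add: o_def)
    also have "\<dots> \<le> (\<Sum>z\<in>Z. length z)" by (rule sum_mono) (simp add: length_reduce)
    finally show ?thesis .
  qed
  moreover have "H \<in> states E (2 * (\<Sum>z\<in>of_word ` Z. length (word z)))"
    by (rule generated_state[OF E _ _ gs(1) gs(3) gs(2) gs(4)]) (use Z gs in auto)
  ultimately have "H \<in> states E M" using M by (auto simp: states_def)
  from short_chain[OF E this cut_system_of_basis(1)[OF bij T] KH cut_system_of_basis(2)[OF bij T]]
  obtain m f S where m: "m \<le> state_bound (card E) M ^ 2" "f \<in> reachable E m"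
    "S \<subseteq> E" "card E - card T \<le> card S" "f ` S \<subseteq> H" by blast
  have "card ?S = card B - card T"
    using fb(1) T by (simp add: BT[symmetric] card_Diff_subset)
  also have "\<dots> \<le> card S" using m(4) fb(2) by linarith
  also have "\<dots> = card (word ` f ` S)"
  proof -
    have "inj_on f S" using free_basis_of_reachable(1)[OF m(2)] m(3) by (rule inj_on_subset)
    then have "inj_on (\<lambda>e. word (f e)) S" by (auto simp: inj_on_def word_inject)
    then show ?thesis by (simp add: card_image image_image)
  qed
  also have "\<dots> \<le> card (word ` f ` E \<inter> generate ?G Z)"
  proof (rule card_mono)
    have "word (f e) \<in> generate ?G Z" if "e \<in> S" for e
    proof -
      have "f e \<in> H" "f e \<in> fgs E" using m(3,5) that free_basis_of_reachable(2)[OF m(2)] by auto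
      then show ?thesis using gs(5)[of "word (f e)"] by (simp only: of_word_word word_in_carrier)
    qed
    then show "word ` f ` S \<subseteq> word ` f ` E \<inter> generate ?G Z" using m(3) by blast
  qed (use E in simp)
  finally show ?thesis using m(1,2) by blast
qed

subsection \<open>Membership via finite permutation representations\<close>

definition inverse_on :: "nat \<Rightarrow> (nat \<Rightarrow> nat) \<Rightarrow> (nat \<Rightarrow> nat) \<Rightarrow> bool" where
  "inverse_on m p q \<longleftrightarrow> (\<forall>x\<le>m. p x \<le> m \<and> q x \<le> m \<and> p (q x) = x \<and> q (p x) = x)"

definition act_letter :: "('a \<Rightarrow> nat \<Rightarrow> nat) \<Rightarrow> ('a \<Rightarrow> nat \<Rightarrow> nat) \<Rightarrow> 'a letter \<Rightarrow> nat \<Rightarrow> nat" where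
  "act_letter P Q y x = (if snd y then P (fst y) x else Q (fst y) x)"

definition act :: "('a \<Rightarrow> nat \<Rightarrow> nat) \<Rightarrow> ('a \<Rightarrow> nat \<Rightarrow> nat) \<Rightarrow> 'a word \<Rightarrow> nat \<Rightarrow> nat" where
  "act P Q w x = foldr (act_letter P Q) w x"

lemma act_simps [simp]: "act P Q [] x = x" "act P Q (y # w) x = act_letter P Q y (act P Q w x)"
  "act P Q (u @ v) x = act P Q u (act P Q v x)"
  by (simp_all add: act_def)

context
  fixes E :: "'a set" and m :: nat and P Q :: "'a \<Rightarrow> nat \<Rightarrow> nat"
  assumes inv: "\<And>e. e \<in> E \<Longrightarrow> inverse_on m (P e) (Q e)"
begin

lemma act_letter_le: "y \<in> letters E \<Longrightarrow> x \<le> m \<Longrightarrow> act_letter P Q y x \<le> m"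
  using inv[of "fst y"] by (auto simp: act_letter_def inverse_on_def letters_def)

lemma act_letter_inv: "y \<in> letters E \<Longrightarrow> x \<le> m \<Longrightarrow> act_letter P Q (inv_letter y) (act_letter P Q y x) = x"
  using inv[of "fst y"] by (cases y) (auto simp: act_letter_def inverse_on_def letters_def)

lemma act_le: "w \<in> words E \<Longrightarrow> x \<le> m \<Longrightarrow> act P Q w x \<le> m"
  by (induction w) (auto simp: words_letters intro: act_letter_le)

lemma act_reduce: "w \<in> words E \<Longrightarrow> x \<le> m \<Longrightarrow> act P Q (reduce w) x = act P Q w x"
proof (induction w)
  case (Cons y w)
  then have y: "y \<in> letters E" and w: "w \<in> words E" by (auto simp: words_letters)
  have rw: "reduce w \<in> words E" by (rule reduce_words[OF w])
  have "act P Q (cons_red y (reduce w)) x = act_letter P Q y (act P Q (reduce w) x)"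
  proof (cases "reduce w")
    case (Cons z v)
    then have v: "v \<in> words E" using rw by (auto simp: words_letters)
    then have "act_letter P Q y (act_letter P Q (inv_letter y) (act P Q v x)) = act P Q v x"
      using act_letter_inv[of "inv_letter y" "act P Q v x"] y act_le[OF v Cons.prems(2)] by simp
    then show ?thesis using Cons by simp
  qed simp
  then show ?case using Cons.IH[OF w Cons.prems(2)] by (simp add: reduce_def)
qed (simp add: reduce_def)

end

text \<open>Domain and image have equally many elements, hence so have their complements in
  \<open>{..m}\<close>, and any bijection between these completes the map.\<close>

lemma extend_partial_injection:
  fixes f :: "nat \<Rightarrow> nat"
  assumes "A \<subseteq> {..m}" "inj_on f A" "f ` A \<subseteq> {..m}"
  obtains p q where "inverse_on m p q" "\<forall>x\<in>A. p x = f x" "\<forall>x\<in>A. q (f x) = x"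
proof -
  have finA: "finite A" using assms(1) finite_subset by blast
  have "card ({..m} - A) = card ({..m} - f ` A)"
    using assms finA by (simp add: card_Diff_subset card_image)
  then obtain g where g: "bij_betw g ({..m} - A) ({..m} - f ` A)"
    using finite_same_card_bij[of "{..m} - A" "{..m} - f ` A"] by auto
  define p where "p x = (if x \<in> A then f x else g x)" for x
  have "bij_betw p (A \<union> ({..m} - A)) (f ` A \<union> ({..m} - f ` A))"
  proof (rule bij_betw_combine)
    show "bij_betw p A (f ` A)"
      using inj_on_imp_bij_betw[OF assms(2)] by (simp add: p_def cong: bij_betw_cong)
    show "bij_betw p ({..m} - A) ({..m} - f ` A)"
    proof -
      have "p x = g x" if "x \<in> {..m} - A" for x using that by (simp add: p_def)
      then show ?thesis using g bij_betw_cong[of "{..m} - A" p g] by blast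
    qed
  qed blast
  moreover have "A \<union> ({..m} - A) = {..m}" "f ` A \<union> ({..m} - f ` A) = {..m}" using assms by auto
  ultimately have p: "bij_betw p {..m} {..m}" by simp
  define q where "q = the_inv_into {..m} p"
  have "inverse_on m p q"
    unfolding inverse_on_def
  proof (intro allI impI conjI)
    fix x assume "x \<le> m"
    then have x: "x \<in> {..m}" by simp
    show "p x \<le> m" using bij_betwE[OF p] x by auto
    show "q x \<le> m" using bij_betwE[OF bij_betw_the_inv_into[OF p]] x by (auto simp: q_def)
    show "p (q x) = x" unfolding q_def by (rule f_the_inv_into_f_bij_betw[OF p]) (use x in simp)
    show "q (p x) = x" unfolding q_def by (rule the_inv_into_f_f) (use p x in \<open>auto simp: bij_betw_def\<close>)
  qed
  moreover have "p x = f x" "q (f x) = x" if "x \<in> A" for x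
  proof -
    show "p x = f x" using that by (simp add: p_def)
    moreover have "q (p x) = x" using \<open>inverse_on m p q\<close> that assms(1) by (auto simp: inverse_on_def)
    ultimately show "q (f x) = x" by simp
  qed
  ultimately show ?thesis using that by blast
qed

text \<open>
  If \<open>w\<close> is not in \<open>H\<close>, the left action on the cosets \<open>v + H\<close>, for \<open>v\<close> a suffix of \<open>w\<close> or of
  a generator, consists of partial injections of a finite set; extend them to permutations.
\<close>

theorem mem_iff_permutations:
  assumes Z: "finite Z" "Z \<subseteq> words E" and w: "w \<in> words E"
    and H: "subgp H" "of_word ` Z \<subseteq> H" "H \<subseteq> fgs E" "\<And>G. subgp G \<Longrightarrow> of_word ` Z \<subseteq> G \<Longrightarrow> H \<subseteq> G"
    and m: "(\<Sum>z\<in>Z. length z) + length w \<le> m"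
  shows "of_word w \<in> H \<longleftrightarrow>
    (\<forall>P Q. (\<forall>e\<in>E. inverse_on m (P e) (Q e)) \<longrightarrow> (\<forall>z\<in>Z. act P Q z 0 = 0) \<longrightarrow> act P Q w 0 = 0)"
proof (intro iffI allI impI)
  fix P Q assume wH: "of_word w \<in> H" and inv: "\<forall>e\<in>E. inverse_on m (P e) (Q e)" and z0: "\<forall>z\<in>Z. act P Q z 0 = 0"
  note inv' = inv[rule_format]
  \<comment> \<open>The stabilizer of the point 0.\<close>
  define G where "G = {g\<in>fgs E. act P Q (word g) 0 = 0}"
  have red: "act P Q (word (of_word u)) 0 = act P Q u 0" if "u \<in> words E" for u
    using act_reduce[of E, OF inv' that] by simp
  have plus: "act P Q (word (g + h)) 0 = act P Q (word g) (act P Q (word h) 0)" if "g \<in> fgs E" "h \<in> fgs E" for g h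
  proof -
    have "word g @ word h \<in> words E" using that by (auto simp: fgs_def words_def)
    then show ?thesis unfolding plus_fg_def by (subst red) simp_all
  qed
  have "subgp G" unfolding subgp_def
  proof (intro conjI ballI)
    show "0 \<in> G" by (simp add: G_def)
    show "a + b \<in> G" if "a \<in> G" "b \<in> G" for a b using that plus by (simp add: G_def)
    show "- a \<in> G" if "a \<in> G" for a using that plus[of "- a" a] by (simp add: G_def)
  qed
  moreover have "of_word ` Z \<subseteq> G" using Z z0 red by (auto simp: G_def intro: of_word_in_fgs)
  ultimately have "of_word w \<in> G" using H(4) wH by blast
  then show "act P Q w 0 = 0" using red[OF w] by (simp add: G_def)
next
  assume *: "\<forall>P Q. (\<forall>e\<in>E. inverse_on m (P e) (Q e)) \<longrightarrow> (\<forall>z\<in>Z. act P Q z 0 = 0) \<longrightarrow> act P Q w 0 = 0"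
  define C where "C v = coset (of_word v) H" for v
  \<comment> \<open>Only nonempty suffixes are listed; the empty one gives the coset
    \<open>C []\<close>, which receives the number 0. At most \<open>m\<close> other cosets remain,
    so the points \<open>0\<close> to \<open>m\<close> suffice.\<close>
  define W where "W = (\<Union>z\<in>Z. (\<lambda>i. drop i z) ` {..<length z}) \<union> (\<lambda>i. drop i w) ` {..<length w}"
  define V where "V = insert (C []) (C ` W)"
  have finW: "finite W" using Z by (simp add: W_def)
  have "card W \<le> (\<Sum>z\<in>Z. length z) + length w"
  proof -
    have "card W \<le> card (\<Union>z\<in>Z. (\<lambda>i. drop i z) ` {..<length z}) + card ((\<lambda>i. drop i w) ` {..<length w})"
      unfolding W_def by (rule card_Un_le)
    moreover have "card (\<Union>z\<in>Z. (\<lambda>i. drop i z) ` {..<length z}) \<le> (\<Sum>z\<in>Z. card ((\<lambda>i. drop i z) ` {..<length z}))"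
      by (rule card_UN_le[OF Z(1)])
    moreover have "(\<Sum>z\<in>Z. card ((\<lambda>i. drop i z) ` {..<length z})) \<le> (\<Sum>z\<in>Z. length z)"
      by (intro sum_mono) (metis card_image_le card_lessThan finite_lessThan)
    moreover have "card ((\<lambda>i. drop i w) ` {..<length w}) \<le> length w"
      by (metis card_image_le card_lessThan finite_lessThan)
    ultimately show ?thesis by linarith
  qed
  then have "card (C ` W - {C []}) \<le> m" using m card_image_le[OF finW, of C]
    by (meson card_mono Diff_subset finW finite_imageI order_trans)
  moreover obtain num0 where num0: "bij_betw num0 (C ` W - {C []}) {1..card (C ` W - {C []})}"
    using finite_same_card_bij[of "C ` W - {C []}" "{1..card (C ` W - {C []})}"] finW by auto
  ultimately have num0': "num0 ` (C ` W - {C []}) \<subseteq> {1..m}" by (auto simp: bij_betw_def)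
  define num where "num c = (if c = C [] then 0 else num0 c)" for c
  have num: "inj_on num V" "num ` V \<subseteq> {..m}" "num (C []) = 0"
  proof -
    show "inj_on num V"
    proof (rule inj_onI)
      fix c d assume cd: "c \<in> V" "d \<in> V" "num c = num d"
      have "num0 c \<noteq> 0" if "c \<in> V" "c \<noteq> C []" for c
      proof -
        have "c \<in> C ` W - {C []}" using that unfolding V_def by blast
        then have "num0 c \<in> {1..m}" using num0' by blast
        then show ?thesis by simp
      qed
      then have nz: "c \<noteq> C [] \<Longrightarrow> num0 c \<noteq> 0" "d \<noteq> C [] \<Longrightarrow> num0 d \<noteq> 0" using cd by blast+
      show "c = d"
      proof (cases "c = C [] \<or> d = C []")
        case True
        then show ?thesis using nz cd(3) by (metis num_def)
      next
        case False
        then have "c \<in> C ` W - {C []}" "d \<in> C ` W - {C []}" "num0 c = num0 d"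
          using cd unfolding V_def by (blast, blast, simp add: num_def)
        then show ?thesis using inj_onD[OF bij_betw_imp_inj_on[OF num0]] by blast
      qed
    qed
    show "num ` V \<subseteq> {..m}"
    proof (rule image_subsetI)
      fix c assume c: "c \<in> V"
      show "num c \<in> {..m}"
      proof (cases "c = C []")
        case False
        then have "c \<in> C ` W - {C []}" using c unfolding V_def by blast
        then have "num0 c \<in> {1..m}" using num0' by blast
        then show ?thesis using False by (simp add: num_def)
      qed (simp add: num_def)
    qed
  qed (simp add: num_def)
  define sh where "sh e c = (\<lambda>p. ltr (e, True) + p) ` c" for e :: 'a and c
  have sh: "sh e (coset g H) = coset (ltr (e, True) + g) H" for e g
    by (simp add: sh_def coset_plus_left)
  have sh_inj: "sh e c = sh e d \<longleftrightarrow> c = d" for e c d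
    unfolding sh_def by (rule inj_image_eq_iff) (simp add: inj_def)
  have "\<exists>p q. inverse_on m p q \<and> (\<forall>c\<in>V. sh e c \<in> V \<longrightarrow> p (num c) = num (sh e c) \<and> q (num (sh e c)) = num c)" for e
  proof -
    define D where "D = {c\<in>V. sh e c \<in> V}"
    define f where "f x = num (sh e (the_inv_into V num x))" for x
    have fnum: "f (num c) = num (sh e c)" if "c \<in> V" for c
      using the_inv_into_f_f[OF num(1) that] by (simp add: f_def)
    have "num ` D \<subseteq> {..m}" using num(2) by (auto simp: D_def)
    moreover have "inj_on f (num ` D)"
    proof (rule inj_onI)
      fix x y assume "x \<in> num ` D" "y \<in> num ` D" "f x = f y"
      then obtain c d where cd: "x = num c" "y = num d" "c \<in> D" "d \<in> D" by blast
      then have "num (sh e c) = num (sh e d)" using \<open>f x = f y\<close> fnum by (simp add: D_def)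
      then have "sh e c = sh e d" using inj_onD[OF num(1)] cd by (simp add: D_def)
      then show "x = y" using sh_inj cd by simp
    qed
    moreover have "f ` num ` D \<subseteq> {..m}" using fnum num(2) by (auto simp: D_def)
    ultimately obtain p q where pq: "inverse_on m p q" "\<forall>x\<in>num ` D. p x = f x" "\<forall>x\<in>num ` D. q (f x) = x"
      by (rule extend_partial_injection)
    have "p (num c) = num (sh e c) \<and> q (num (sh e c)) = num c" if "c \<in> V" "sh e c \<in> V" for c
      using pq(2,3) fnum[OF that(1)] that by (auto simp: D_def)
    then show ?thesis using pq(1) by blast
  qed
  then obtain P Q where PQ: "\<And>e. inverse_on m (P e) (Q e)"
    "\<And>e c. c \<in> V \<Longrightarrow> sh e c \<in> V \<Longrightarrow> P e (num c) = num (sh e c) \<and> Q e (num (sh e c)) = num c"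
    by metis
  \<comment> \<open>Read from the right, the word moves the point 0 through the numbers of the
    cosets of its suffixes, and there the extended permutations agree with translation.\<close>
  have track: "act P Q v 0 = num (C v)" if "\<forall>i<length v. C (drop i v) \<in> V" for v
    using that
  proof (induction v)
    case Nil
    then show ?case using num(3) by simp
  next
    case (Cons y v)
    have IH: "act P Q v 0 = num (C v)" using Cons.prems by (intro Cons.IH) (metis Suc_less_eq drop_Suc_Cons length_Cons)
    have Vy: "C (y # v) \<in> V" using Cons.prems by (metis drop_0 length_Cons zero_less_Suc)
    have Vv: "C v \<in> V"
    proof (cases "v = []")
      case False
      then show ?thesis using Cons.prems by (metis Suc_less_eq drop_0 drop_Suc_Cons length_Cons length_greater_0_conv)
    qed (simp add: V_def)
    show ?case
    proof (cases "snd y")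
      case True
      then have "C (y # v) = sh (fst y) (C v)" by (simp add: C_def sh of_word_Cons) (metis prod.collapse)
      then show ?thesis using PQ(2)[OF Vv, of "fst y"] Vy IH True by (simp add: act_letter_def)
    next
      case False
      then have "ltr (fst y, True) = - ltr y" by (cases y) (simp flip: ltr_inv)
      then have "C v = sh (fst y) (C (y # v))" by (simp add: C_def sh of_word_Cons)
      then show ?thesis using PQ(2)[OF Vy, of "fst y"] Vv IH False by (simp add: act_letter_def)
    qed
  qed
  have "act P Q z 0 = 0" if "z \<in> Z" for z
  proof -
    have "C (drop i z) \<in> V" if "i < length z" for i using that \<open>z \<in> Z\<close> unfolding V_def W_def by blast
    then have "act P Q z 0 = num (C z)" using track by blast
    moreover have "C z = C []"
      using H(1,2) that coset_plus_right[OF H(1), of "of_word z" 0] by (auto simp: C_def)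
    ultimately show ?thesis using num(3) by simp
  qed
  then have "act P Q w 0 = 0" using * PQ(1) by blast
  moreover have "C (drop i w) \<in> V" if "i < length w" for i using that unfolding V_def W_def by blast
  then have "act P Q w 0 = num (C w)" using track by blast
  moreover have "C w \<in> V"
  proof (cases "w = []")
    case False
    then have "drop 0 w \<in> W" unfolding W_def by blast
    then show ?thesis by (simp add: V_def)
  qed (simp add: V_def)
  ultimately have "C w = C []" using num inj_onD[OF num(1), of "C w" "C []"] by (simp add: V_def)
  then show "of_word w \<in> H" using coset_eq_iff[OF H(1), of 0 "of_word w"] by (simp add: C_def)
qed

section \<open>Computable functions\<close>

subsection \<open>Functions on codes\<close>

text \<open>Composition and primitive recursion preserve this notion of total computability, and the
  bounded search of the algorithm stays within them; termination is thus built in.\<close>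

definition rec_fun :: "nat \<Rightarrow> (nat list \<Rightarrow> nat) \<Rightarrow> bool" where
  "rec_fun k f \<longleftrightarrow> (\<exists>r. \<forall>xs. length xs = k \<longrightarrow> computes r xs (f xs))"

lemma rec_zero: "rec_fun k (\<lambda>_. 0)"
  unfolding rec_fun_def by (blast intro: computes.zero)

lemma rec_proj: "i < k \<Longrightarrow> rec_fun k (\<lambda>xs. xs ! i)"
  unfolding rec_fun_def by (blast intro: computes.proj)

lemma rec_comp1:
  assumes "rec_fun 1 g" "rec_fun k f"
  shows "rec_fun k (\<lambda>xs. g [f xs])"
proof -
  obtain r s where r: "\<And>xs. length xs = 1 \<Longrightarrow> computes r xs (g xs)"
    and s: "\<And>xs. length xs = k \<Longrightarrow> computes s xs (f xs)"
    using assms unfolding rec_fun_def by blast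
  have "computes (Comp r [s]) xs (g [f xs])" if "length xs = k" for xs
    by (rule computes.comp[of _ _ "[f xs]"]) (use r s that in auto)
  then show ?thesis unfolding rec_fun_def by blast
qed

lemma rec_comp2:
  assumes "rec_fun 2 g" "rec_fun k f" "rec_fun k f'"
  shows "rec_fun k (\<lambda>xs. g [f xs, f' xs])"
proof -
  obtain r s s' where r: "\<And>xs. length xs = 2 \<Longrightarrow> computes r xs (g xs)"
    and s: "\<And>xs. length xs = k \<Longrightarrow> computes s xs (f xs)" "\<And>xs. length xs = k \<Longrightarrow> computes s' xs (f' xs)"
    using assms unfolding rec_fun_def by blast
  have "computes (Comp r [s, s']) xs (g [f xs, f' xs])" if "length xs = k" for xs
    by (rule computes.comp[of _ _ "[f xs, f' xs]"]) (use r s that in auto)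
  then show ?thesis unfolding rec_fun_def by blast
qed

lemma rec_primrec:
  assumes "rec_fun k f" "rec_fun (Suc (Suc k)) g"
  shows "rec_fun (Suc k) (\<lambda>xs. rec_nat (f (tl xs)) (\<lambda>n r. g (n # r # tl xs)) (hd xs))"
proof -
  obtain r s where r: "\<And>xs. length xs = k \<Longrightarrow> computes r xs (f xs)"
    and s: "\<And>xs. length xs = Suc (Suc k) \<Longrightarrow> computes s xs (g xs)"
    using assms unfolding rec_fun_def by blast
  have *: "computes (PrimRec r s) (n # ys) (rec_nat (f ys) (\<lambda>n r. g (n # r # ys)) n)" if "length ys = k" for n ys
  proof (induction n)
    case (Suc n)
    then show ?case using s[of "n # _ # ys"] that by (auto intro: computes.primrec_Suc)
  qed (use r that in \<open>auto intro: computes.primrec_0\<close>)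
  have "computes (PrimRec r s) xs (rec_nat (f (tl xs)) (\<lambda>n r. g (n # r # tl xs)) (hd xs))" if "length xs = Suc k" for xs
    using *[of "tl xs" "hd xs"] that by (cases xs) auto
  then show ?thesis unfolding rec_fun_def by blast
qed

lemma rec_fun_cong:
  assumes "rec_fun k f" "\<And>xs. length xs = k \<Longrightarrow> f xs = g xs"
  shows "rec_fun k g"
  using assms unfolding rec_fun_def by metis

definition rec1 :: "(nat \<Rightarrow> nat) \<Rightarrow> bool" where
  "rec1 f \<longleftrightarrow> rec_fun 1 (\<lambda>xs. f (hd xs))"

definition rec2 :: "(nat \<Rightarrow> nat \<Rightarrow> nat) \<Rightarrow> bool" where
  "rec2 f \<longleftrightarrow> rec_fun 2 (\<lambda>xs. f (xs ! 0) (xs ! 1))"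

lemma rec1_app: "rec1 f \<Longrightarrow> rec_fun k g \<Longrightarrow> rec_fun k (\<lambda>xs. f (g xs))"
  using rec_comp1[of "\<lambda>xs. f (hd xs)" k g] by (simp add: rec1_def)

lemma rec2_app: "rec2 f \<Longrightarrow> rec_fun k g \<Longrightarrow> rec_fun k h \<Longrightarrow> rec_fun k (\<lambda>xs. f (g xs) (h xs))"
  using rec_comp2[of "\<lambda>xs. f (xs ! 0) (xs ! 1)" k g h] by (simp add: rec2_def)

lemma rec1_Suc: "rec1 Suc"
proof -
  have "computes Succ xs (Suc (hd xs))" if "length xs = 1" for xs
    using that by (cases xs) (auto intro: computes.succ)
  then show ?thesis unfolding rec1_def rec_fun_def by blast
qed

lemma rec2_rec_nat:
  assumes "rec1 f" "rec_fun 3 (\<lambda>xs. g (xs ! 0) (xs ! 1) (xs ! 2))"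
  shows "rec2 (\<lambda>n x. rec_nat (f x) (\<lambda>n r. g n r x) n)"
proof -
  have *: "rec_fun (Suc 1) (\<lambda>xs. rec_nat ((\<lambda>xs. f (hd xs)) (tl xs))
      (\<lambda>n r. (\<lambda>xs. g (xs ! 0) (xs ! 1) (xs ! 2)) (n # r # tl xs)) (hd xs))"
    by (rule rec_primrec) (use assms in \<open>simp_all add: rec1_def numeral_3_eq_3\<close>)
  show ?thesis unfolding rec2_def numeral_2_eq_2
    by (rule rec_fun_cong[OF *[unfolded One_nat_def]]) (auto simp: length_Suc_conv)
qed

lemma rec1_rec_nat:
  assumes "rec2 g"
  shows "rec1 (rec_nat c g)"
proof -
  have "rec_fun 0 (\<lambda>_. c)"
  proof (induction c)
    case (Suc c)
    then show ?case by (rule rec1_app[OF rec1_Suc])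
  qed (rule rec_zero)
  moreover have "rec_fun (Suc (Suc 0)) (\<lambda>xs. g (xs ! 0) (xs ! 1))"
    using assms by (simp add: rec2_def numeral_2_eq_2)
  ultimately have "rec_fun (Suc 0) (\<lambda>xs. rec_nat c (\<lambda>n r. g ((n # r # tl xs) ! 0) ((n # r # tl xs) ! 1)) (hd xs))"
    by (rule rec_primrec)
  then show ?thesis by (simp add: rec1_def)
qed

lemma rec1_const: "rec1 (\<lambda>_. c)"
proof (induction c)
  case (Suc c)
  then show ?case unfolding rec1_def by (rule rec1_app[OF rec1_Suc])
qed (simp add: rec1_def rec_zero)

lemma rec1_id: "rec1 (\<lambda>x. x)"
  unfolding rec1_def by (rule rec_fun_cong[OF rec_proj[of 0 1]]) (auto simp: length_Suc_conv)

lemma rec1_comp: "rec1 f \<Longrightarrow> rec1 g \<Longrightarrow> rec1 (\<lambda>x. f (g x))"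
  unfolding rec1_def[of g] rec1_def[of "\<lambda>x. f (g x)"] by (rule rec1_app)

lemma rec1_comp2: "rec2 f \<Longrightarrow> rec1 g \<Longrightarrow> rec1 h \<Longrightarrow> rec1 (\<lambda>x. f (g x) (h x))"
  unfolding rec1_def by (rule rec2_app)

lemma rec2_swap: "rec2 f \<Longrightarrow> rec2 (\<lambda>x y. f y x)"
  unfolding rec2_def[of "\<lambda>x y. f y x"] by (rule rec2_app) (auto intro: rec_proj)

lemma rec2_comp1: "rec1 f \<Longrightarrow> rec2 g \<Longrightarrow> rec2 (\<lambda>x y. f (g x y))"
  unfolding rec2_def by (rule rec1_app)

lemma rec2_comp2: "rec2 f \<Longrightarrow> rec2 g \<Longrightarrow> rec2 h \<Longrightarrow> rec2 (\<lambda>x y. f (g x y) (h x y))"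
  unfolding rec2_def[of g] rec2_def[of h] rec2_def[of "\<lambda>x y. f (g x y) (h x y)"] by (rule rec2_app)

lemma rec2_fst: "rec1 f \<Longrightarrow> rec2 (\<lambda>x y. f x)"
  unfolding rec2_def by (rule rec1_app) (auto intro: rec_proj)

lemma rec2_snd: "rec1 f \<Longrightarrow> rec2 (\<lambda>x y. f y)"
  unfolding rec2_def by (rule rec1_app) (auto intro: rec_proj)

lemma rec2_plus: "rec2 (+)"
proof -
  have "rec2 (\<lambda>n x. rec_nat x (\<lambda>n r. Suc r) n)"
    by (rule rec2_rec_nat[OF rec1_id]) (intro rec1_app[OF rec1_Suc] rec_proj, simp)
  moreover have "rec_nat x (\<lambda>n r. Suc r) n = n + x" for n x by (induction n) auto
  ultimately show ?thesis by simp
qed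

lemma rec1_pred: "rec1 (\<lambda>x. x - 1)"
proof -
  have "rec1 (rec_nat 0 (\<lambda>n r. n))" by (rule rec1_rec_nat[OF rec2_fst[OF rec1_id]])
  moreover have "rec_nat 0 (\<lambda>n r. n) = (\<lambda>x. x - 1)"
  proof
    show "rec_nat 0 (\<lambda>n r. n) x = x - 1" for x by (cases x) auto
  qed
  ultimately show ?thesis by simp
qed

lemma rec2_minus: "rec2 (-)"
proof -
  have "rec2 (\<lambda>n x. rec_nat x (\<lambda>n r. r - 1) n)"
    by (rule rec2_rec_nat[OF rec1_id]) (intro rec1_app[OF rec1_pred] rec_proj, simp)
  moreover have "rec_nat x (\<lambda>n r. r - 1) n = x - n" for n x by (induction n) auto
  ultimately have "rec2 (\<lambda>n x. x - n)" by simp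
  then show ?thesis by (rule rec2_swap)
qed

lemma rec1_triangle: "rec1 triangle"
proof -
  have "rec1 (rec_nat 0 (\<lambda>n r. r + Suc n))"
    by (intro rec1_rec_nat rec2_comp2[OF rec2_plus] rec2_snd[OF rec1_id] rec2_fst[OF rec1_Suc])
  moreover have "rec_nat 0 (\<lambda>n r. r + Suc n) = triangle"
  proof
    show "rec_nat 0 (\<lambda>n r. r + Suc n) x = triangle x" for x by (induction x) auto
  qed
  ultimately show ?thesis by simp
qed

text \<open>Both branches are total, so they can be evaluated together and selected by
  multiplication with 0 or 1.\<close>

lemma rec_if_zero:
  assumes "rec_fun k c" "rec_fun k f" "rec_fun k g"
  shows "rec_fun k (\<lambda>xs. if c xs = 0 then f xs else g xs)"
proof -
  have sg: "rec1 (\<lambda>x. of_bool (x \<noteq> 0))"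
  proof -
    have "rec1 (rec_nat 0 (\<lambda>n r. 1))" by (rule rec1_rec_nat[OF rec2_fst[OF rec1_const]])
    moreover have "rec_nat 0 (\<lambda>n r. 1) = (\<lambda>x. of_bool (x \<noteq> 0) :: nat)"
    proof
      show "rec_nat 0 (\<lambda>n r. 1) x = (of_bool (x \<noteq> 0) :: nat)" for x :: nat by (cases x) auto
    qed
    ultimately show ?thesis by simp
  qed
  have times: "rec2 (*)"
  proof -
    have "rec2 (\<lambda>n x. rec_nat 0 (\<lambda>n r. r + x) n)"
      by (rule rec2_rec_nat[OF rec1_const]) (intro rec2_app[OF rec2_plus] rec_proj, simp_all)
    moreover have "rec_nat 0 (\<lambda>n r. r + x) n = n * x" for n x by (induction n) auto
    ultimately show ?thesis by simp
  qed
  have "rec_fun k (\<lambda>xs. (1 - of_bool (c xs \<noteq> 0)) * f xs + of_bool (c xs \<noteq> 0) * g xs)"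
    by (intro rec2_app[OF rec2_plus] rec2_app[OF times] assms rec1_app[OF sg]
        rec1_app[OF rec1_comp2[OF rec2_minus rec1_const rec1_id]])
  then show ?thesis by (rule rec_fun_cong) simp
qed

text \<open>The index of the diagonal on which a pair with code \<open>n\<close> lies.\<close>

definition diag :: "nat \<Rightarrow> nat" where
  "diag = rec_nat 0 (\<lambda>n r. if triangle (Suc r) - Suc n = 0 then Suc r else r)"

lemma diag_bounds: "triangle (diag n) \<le> n \<and> n < triangle (Suc (diag n))"
proof (induction n)
  case 0
  then show ?case by (simp add: diag_def)
next
  case (Suc n)
  have "diag (Suc n) = (if triangle (Suc (diag n)) \<le> Suc n then Suc (diag n) else diag n)"
    by (simp add: diag_def)
  then show ?case using Suc by auto
qed

lemma prod_decode_diag: "prod_decode n = (n - triangle (diag n), diag n - (n - triangle (diag n)))"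
proof -
  have "n - triangle (diag n) \<le> diag n" "triangle (diag n) \<le> n" using diag_bounds[of n] by auto
  then have "prod_encode (n - triangle (diag n), diag n - (n - triangle (diag n))) = n"
    by (simp add: prod_encode_def)
  then show ?thesis by (metis prod_encode_inverse)
qed

lemma rec1_diag: "rec1 diag"
  unfolding diag_def
proof (rule rec1_rec_nat)
  show "rec2 (\<lambda>n r. if triangle (Suc r) - Suc n = 0 then Suc r else r)"
    unfolding rec2_def
    by (intro rec_if_zero rec2_app[OF rec2_minus] rec1_app[OF rec1_triangle] rec1_app[OF rec1_Suc] rec_proj) auto
qed

lemma rec1_fst_decode: "rec1 (\<lambda>n. fst (prod_decode n))"
  unfolding prod_decode_diag fst_conv
  by (intro rec1_comp2[OF rec2_minus] rec1_id rec1_comp[OF rec1_triangle] rec1_diag)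

lemma rec1_snd_decode: "rec1 (\<lambda>n. snd (prod_decode n))"
  unfolding prod_decode_diag snd_conv
  by (intro rec1_comp2[OF rec2_minus] rec1_id rec1_comp[OF rec1_triangle] rec1_diag)

lemma rec2_prod_encode: "rec2 (\<lambda>x y. prod_encode (x, y))"
  unfolding prod_encode_def case_prod_conv
  by (intro rec2_comp2[OF rec2_plus] rec2_comp1[OF rec1_triangle] rec2_plus rec2_fst[OF rec1_id])

lemma rec1_if_zero: "rec1 c \<Longrightarrow> rec1 f \<Longrightarrow> rec1 g \<Longrightarrow> rec1 (\<lambda>x. if c x = 0 then f x else g x)"
  unfolding rec1_def by (rule rec_if_zero)

lemma rec2_if_zero: "rec2 c \<Longrightarrow> rec2 f \<Longrightarrow> rec2 g \<Longrightarrow> rec2 (\<lambda>x y. if c x y = 0 then f x y else g x y)"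
  unfolding rec2_def by (rule rec_if_zero)

lemma rec1_funpow:
  assumes "rec1 f" "rec1 n" "rec1 i"
  shows "rec1 (\<lambda>x. (f ^^ n x) (i x))"
proof -
  have "rec2 (\<lambda>n x. rec_nat (i x) (\<lambda>n r. f r) n)"
    by (rule rec2_rec_nat[OF assms(3)]) (intro rec1_app[OF assms(1)] rec_proj, simp)
  moreover have "rec_nat (i x) (\<lambda>n r. f r) k = (f ^^ k) (i x)" for k x by (induction k) auto
  ultimately have "rec2 (\<lambda>k x. (f ^^ k) (i x))" by simp
  then show ?thesis using rec1_comp2[OF _ assms(2) rec1_id] by blast
qed

subsection \<open>Encoded types\<close>

class encodable =
  fixes enc :: "'a \<Rightarrow> nat"
  assumes enc_inject: "enc x = enc y \<longleftrightarrow> x = y"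

instantiation nat :: encodable
begin
definition enc_nat :: "nat \<Rightarrow> nat" where "enc_nat n = n"
instance by standard (simp add: enc_nat_def)
end

instantiation bool :: encodable
begin
definition enc_bool :: "bool \<Rightarrow> nat" where "enc_bool b = of_bool b"
instance by standard (simp add: enc_bool_def)
end

instantiation prod :: (encodable, encodable) encodable
begin
definition enc_prod :: "'a \<times> 'b \<Rightarrow> nat" where "enc_prod p = prod_encode (enc (fst p), enc (snd p))"
instance by standard (auto simp: enc_prod_def enc_inject prod_eq_iff)
end

instantiation list :: (encodable) encodable
begin
definition enc_list :: "'a list \<Rightarrow> nat" where "enc_list xs = list_encode (map enc xs)"
instance
proof
  fix xs ys :: "'a list"
  have "inj (enc :: 'a \<Rightarrow> nat)" by (simp add: inj_def enc_inject)
  then show "enc xs = enc ys \<longleftrightarrow> xs = ys" by (simp add: enc_list_def list_encode_eq inj_map_eq_map)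
qed
end

lemma enc_Nil [simp]: "enc [] = 0"
  and enc_Cons [simp]: "enc (x # xs) = Suc (prod_encode (enc x, enc xs))"
  by (simp_all add: enc_list_def)

lemma length_le_enc: "length xs \<le> enc xs"
proof (induction xs)
  case (Cons x xs)
  then show ?case using le_prod_encode_2[of "enc xs" "enc x"] by simp
qed simp

text \<open>The function on numbers is unconstrained at arguments that are no codes.\<close>

definition effective :: "('a::encodable \<Rightarrow> 'b::encodable) \<Rightarrow> bool" where
  "effective f \<longleftrightarrow> (\<exists>g. rec1 g \<and> (\<forall>x. g (enc x) = enc (f x)))"

lemma effectiveI: "rec1 g \<Longrightarrow> (\<And>x. g (enc x) = enc (f x)) \<Longrightarrow> effective f"
  by (auto simp: effective_def)

lemma effectiveE:
  assumes "effective f" obtains g where "rec1 g" "\<And>x. g (enc x) = enc (f x)"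
  using assms by (auto simp: effective_def)

text \<open>Closure rules following the structure of terms. A function with bound variables is
  required to be effective in the tuple of the environment and these variables.\<close>

named_theorems eff

lemma eff_id [eff]: "effective (\<lambda>x. x)"
  by (rule effectiveI[OF rec1_id]) simp

lemma eff_const [eff]: "effective (\<lambda>_. c)"
  by (rule effectiveI[OF rec1_const]) simp

lemma eff_comp: "effective f \<Longrightarrow> effective g \<Longrightarrow> effective (\<lambda>x. f (g x))"
  by (elim effectiveE, rule effectiveI, erule (1) rec1_comp) simp

lemma eff_code2:
  assumes h: "rec2 h" "\<And>x. h (enc (f x)) (enc (g x)) = enc (k x)" and "effective f" "effective g"
  shows "effective k"
proof -
  obtain a b where "rec1 a" "\<And>x. a (enc x) = enc (f x)" "rec1 b" "\<And>x. b (enc x) = enc (g x)"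
    using assms by (metis effectiveE)
  then show ?thesis by (intro effectiveI[OF rec1_comp2[OF h(1)], of a b]) (simp_all add: h(2))
qed

lemma eff_Pair [eff]:
  assumes "effective f" "effective g" shows "effective (\<lambda>x. (f x, g x))"
  by (rule eff_code2[OF rec2_prod_encode _ assms]) (simp add: enc_prod_def)

lemma eff_fst [eff]: "effective f \<Longrightarrow> effective (\<lambda>x. fst (f x))"
  by (rule eff_comp[of fst], rule effectiveI[OF rec1_fst_decode]) (auto simp: enc_prod_def)

lemma eff_snd [eff]: "effective f \<Longrightarrow> effective (\<lambda>x. snd (f x))"
  by (rule eff_comp[of snd], rule effectiveI[OF rec1_snd_decode]) (auto simp: enc_prod_def)

lemma eff_Suc [eff]: "effective f \<Longrightarrow> effective (\<lambda>x. Suc (f x))"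
  by (rule eff_comp[of Suc], rule effectiveI[OF rec1_Suc]) (auto simp: enc_nat_def)

lemma eff_if [eff]:
  assumes "effective P" "effective f" "effective g"
  shows "effective (\<lambda>x. if P x then f x else g x)"
proof -
  obtain p a b where g: "rec1 p" "\<And>x. p (enc x) = enc (P x)" "rec1 a" "\<And>x. a (enc x) = enc (f x)"
    "rec1 b" "\<And>x. b (enc x) = enc (g x)"
    using assms by (metis effectiveE)
  show ?thesis
    by (rule effectiveI[OF rec1_if_zero[OF g(1,5,3)]]) (simp add: g enc_bool_def)
qed

lemma eff_enc: "effective f \<Longrightarrow> effective (\<lambda>x. enc (f x))"
  by (rule eff_comp[of enc], rule effectiveI[OF rec1_id]) (auto simp: enc_nat_def)

lemma eff_rec2:
  fixes h :: "nat \<Rightarrow> nat \<Rightarrow> nat"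
  assumes "rec2 h" "effective f" "effective g"
  shows "effective (\<lambda>x. h (f x) (g x))"
  by (rule eff_code2[OF assms(1) _ assms(2,3)]) (simp add: enc_nat_def)

lemma eff_le [eff]:
  fixes f g :: "_ \<Rightarrow> nat"
  assumes "effective f" "effective g"
  shows "effective (\<lambda>x. f x \<le> g x)"
proof -
  have "rec2 (\<lambda>x y. of_bool (x \<le> y))"
  proof -
    have "rec2 (\<lambda>x y. if x - y = 0 then 1 else 0)"
      by (intro rec2_if_zero rec2_minus rec2_fst[OF rec1_const])
    moreover have "(\<lambda>x y :: nat. if x - y = 0 then 1 else 0) = (\<lambda>x y. of_bool (x \<le> y) :: nat)"
      by (auto simp: fun_eq_iff)
    ultimately show ?thesis by simp
  qed
  from eff_rec2[OF this assms] have "effective (\<lambda>x. of_bool (f x \<le> g x) :: nat)" .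
  then show ?thesis by (auto simp: effective_def enc_nat_def enc_bool_def)
qed

lemma eff_conj [eff]:
  assumes "effective P" "effective Q" shows "effective (\<lambda>x. P x \<and> Q x)"
proof -
  have "(\<lambda>x. P x \<and> Q x) = (\<lambda>x. if P x then Q x else False)" by auto
  then show ?thesis by (simp only:) (intro eff assms)
qed

lemma eff_not [eff]:
  assumes "effective P" shows "effective (\<lambda>x. \<not> P x)"
proof -
  have "(\<lambda>x. \<not> P x) = (\<lambda>x. if P x then False else True)" by auto
  then show ?thesis by (simp only:) (intro eff assms)
qed

lemma eff_disj [eff]: "effective P \<Longrightarrow> effective Q \<Longrightarrow> effective (\<lambda>x. P x \<or> Q x)"
  using eff_not[OF eff_conj[OF eff_not eff_not, of P Q]] by simp

lemma eff_imp [eff]: "effective P \<Longrightarrow> effective Q \<Longrightarrow> effective (\<lambda>x. P x \<longrightarrow> Q x)"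
  unfolding imp_conv_disj by (intro eff)

lemma eff_eq [eff]:
  assumes "effective f" "effective g"
  shows "effective (\<lambda>x. f x = g x)"
proof -
  have "effective (\<lambda>x. enc (f x) \<le> enc (g x) \<and> enc (g x) \<le> enc (f x))"
    by (intro eff eff_enc assms)
  moreover have "enc (f x) \<le> enc (g x) \<and> enc (g x) \<le> enc (f x) \<longleftrightarrow> f x = g x" for x
    using enc_inject[of "f x" "g x"] by auto
  ultimately show ?thesis by simp
qed

lemma eff_Cons [eff]:
  assumes "effective f" "effective g" shows "effective (\<lambda>x. f x # g x)"
  by (rule eff_code2[OF rec2_comp1[OF rec1_Suc rec2_prod_encode] _ assms]) simp

text \<open>The code of a nonempty list is the successor of the code of its head and tail, so 0
  signals the empty list and the predecessor is decomposed otherwise.\<close>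

lemma eff_case_list [eff]:
  assumes "effective l" "effective a" "effective (\<lambda>p. f (fst p) (fst (snd p)) (snd (snd p)))"
  shows "effective (\<lambda>x. case l x of [] \<Rightarrow> a x | y # ys \<Rightarrow> f x y ys)"
proof -
  obtain c b g where g: "rec1 c" "\<And>x. c (enc x) = enc (l x)" "rec1 b" "\<And>x. b (enc x) = enc (a x)"
    "rec1 g" "\<And>p. g (enc p) = enc (f (fst p) (fst (snd p)) (snd (snd p)))"
  proof -
    obtain c where "rec1 c" "\<forall>x. c (enc x) = enc (l x)" using assms(1) unfolding effective_def by blast
    moreover obtain b where "rec1 b" "\<forall>x. b (enc x) = enc (a x)" using assms(2) unfolding effective_def by blast
    moreover obtain g where "rec1 g" "\<forall>p. g (enc p) = enc (f (fst p) (fst (snd p)) (snd (snd p)))"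
      using assms(3) unfolding effective_def by blast
    ultimately show ?thesis using that by blast
  qed
  have "rec1 (\<lambda>x. if c x = 0 then b x else g (prod_encode (x, c x - 1)))"
    by (intro rec1_if_zero g rec1_comp[OF g(5)] rec1_comp2[OF rec2_prod_encode] rec1_id rec1_comp[OF rec1_pred])
  then show ?thesis
  proof (rule effectiveI)
    fix x
    show "(if c (enc x) = 0 then b (enc x) else g (prod_encode (enc x, c (enc x) - 1))) =
      enc (case l x of [] \<Rightarrow> a x | y # ys \<Rightarrow> f x y ys)"
    proof (cases "l x")
      case (Cons y ys)
      then show ?thesis using g(6)[of "(x, y, ys)"] by (simp add: g(2) enc_prod_def)
    qed (simp add: g)
  qed
qed

section \<open>Iteration, folds and the list functions built from them\<close>

lemma eff_funpow [eff]:
  fixes f :: "'a::encodable \<Rightarrow> 's::encodable \<Rightarrow> 's"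
  assumes "effective (\<lambda>p. f (fst p) (snd p))" "effective n" "effective i"
  shows "effective (\<lambda>x. (f x ^^ n x) (i x))"
proof -
  \<comment> \<open>The environment is carried along in the state, since a fixed function on codes
    is to be iterated.\<close>
  define F where "F p = (fst p, f (fst p) (snd p))" for p
  have "effective F" unfolding F_def by (intro eff assms)
  moreover have "effective (\<lambda>x. (x, i x))" by (intro eff assms)
  ultimately obtain g c j where g: "rec1 g" "\<And>x. g (enc x) = enc (F x)" "rec1 c" "\<And>x. c (enc x) = enc (n x)"
    "rec1 j" "\<And>x. j (enc x) = enc (x, i x)"
  proof -
    assume F: "effective F" and j: "effective (\<lambda>x. (x, i x))"
    obtain g where "rec1 g" "\<forall>x. g (enc x) = enc (F x)" using F unfolding effective_def by blast
    moreover obtain c where "rec1 c" "\<forall>x. c (enc x) = enc (n x)" using assms(2) unfolding effective_def by blast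
    moreover obtain j where "rec1 j" "\<forall>x. j (enc x) = enc (x, i x)" using j unfolding effective_def by blast
    ultimately show ?thesis using that by blast
  qed
  have F: "(F ^^ k) (x, s) = (x, (f x ^^ k) s)" for k x s by (induction k) (auto simp: F_def)
  have G: "(g ^^ k) (enc p) = enc ((F ^^ k) p)" for k p by (induction k) (auto simp: g)
  have "effective (\<lambda>x. (F ^^ n x) (x, i x))"
    by (rule effectiveI[OF rec1_funpow[OF g(1,3,5)]]) (simp add: g G enc_nat_def)
  then have "effective (\<lambda>x. snd ((F ^^ n x) (x, i x)))" by (rule eff_snd)
  then show ?thesis by (simp add: F)
qed

text \<open>The fold is an iteration of a step that consumes one element. The code of the list
  serves as number of steps: it is at least the length, and steps on the empty list change
  nothing.\<close>

lemma eff_foldl: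
  fixes f :: "'a::encodable \<Rightarrow> 's::encodable \<Rightarrow> 'b::encodable \<Rightarrow> 's"
  assumes "effective (\<lambda>p. f (fst p) (fst (snd p)) (snd (snd p)))" "effective i" "effective l"
  shows "effective (\<lambda>x. foldl (f x) (i x) (l x))"
proof -
  define S where "S x s = (case fst s of [] \<Rightarrow> s | y # ys \<Rightarrow> (ys, f x (snd s) y))" for x and s :: "_ list \<times> _"
  have S: "(S x ^^ k) (xs, a) = (drop k xs, foldl (f x) a (take k xs))" for x k xs a
  proof (induction k arbitrary: xs a)
    case (Suc k)
    have "S x ([], a) = ([], a)" "S x (y # ys, a) = (ys, f x a y)" for y ys by (simp_all add: S_def)
    moreover have "(S x ^^ Suc k) (xs, a) = (S x ^^ k) (S x (xs, a))" by (simp add: funpow_swap1)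
    ultimately show ?case using Suc by (cases xs) (simp_all del: funpow.simps)
  qed simp
  have f': "effective (\<lambda>p. f (fst (fst p)) (snd (snd (fst p))) (fst (snd p)))"
    using eff_comp[OF assms(1), of "\<lambda>p. (fst (fst p), snd (snd (fst p)), fst (snd p))"] by (simp add: eff)
  have "effective (\<lambda>p. S (fst p) (snd p))" unfolding S_def
    by (intro eff eff_case_list[where f="\<lambda>p y ys. (ys, f (fst p) (snd (snd p)) y)"] f')
  then have "effective (\<lambda>x. snd ((S x ^^ enc (l x)) (l x, i x)))"
    by (intro eff eff_enc assms)
  moreover have "take (enc (l x)) (l x) = l x" for x by (rule take_all[OF length_le_enc])
  ultimately show ?thesis by (simp only: S snd_conv)
qed

lemma foldl_Cons_rev: "foldl (\<lambda>acc y. y # acc) zs xs = rev xs @ zs"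
  by (induction xs arbitrary: zs) auto

lemma foldr_Cons_map: "foldr (\<lambda>y acc. g y # acc) xs [] = map g xs"
  by (induction xs) auto

lemma foldr_filter: "foldr (\<lambda>y acc. if p y then y # acc else acc) xs [] = filter p xs"
  by (induction xs) auto

lemma foldr_Cons_append: "foldr (\<lambda>y acc. y # acc) xs ys = xs @ ys"
  by (induction xs) auto

lemma foldr_Suc_length: "foldr (\<lambda>y n. Suc n) xs 0 = length xs"
  by (induction xs) auto

lemma foldr_remdups: "foldr (\<lambda>y acc. if y \<in> set acc then acc else y # acc) xs [] = remdups xs"
  by (induction xs) auto

lemma eff_rev [eff]:
  assumes "effective l" shows "effective (\<lambda>x. rev (l x))"
proof -
  have "effective (\<lambda>x. foldl (\<lambda>acc y. y # acc) [] (l x))"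
    by (rule eff_foldl[where f="\<lambda>x acc y. y # acc"]) (intro eff assms)+
  then show ?thesis by (simp add: foldl_Cons_rev)
qed

lemma eff_foldr [eff]:
  assumes "effective (\<lambda>p. f (fst p) (fst (snd p)) (snd (snd p)))" "effective l" "effective i"
  shows "effective (\<lambda>x. foldr (f x) (l x) (i x))"
proof -
  have "effective (\<lambda>p. f (fst p) (snd (snd p)) (fst (snd p)))"
    using eff_comp[OF assms(1), of "\<lambda>p. (fst p, snd (snd p), fst (snd p))"] by (simp add: eff)
  then have "effective (\<lambda>x. foldl (\<lambda>acc y. f x y acc) (i x) (rev (l x)))"
    by (rule eff_foldl[where f="\<lambda>x acc y. f x y acc"]) (intro eff assms)+
  then show ?thesis by (simp add: foldr_conv_foldl)
qed

lemma eff_map [eff]: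
  assumes "effective (\<lambda>p. f (fst p) (snd p))" "effective l"
  shows "effective (\<lambda>x. map (f x) (l x))"
proof -
  have "effective (\<lambda>p. f (fst p) (fst (snd p)))"
    using eff_comp[OF assms(1), of "\<lambda>p. (fst p, fst (snd p))"] by (simp add: eff)
  then have "effective (\<lambda>x. foldr (\<lambda>y acc. f x y # acc) (l x) [])"
    by (intro eff_foldr[where f="\<lambda>x y acc. f x y # acc"] eff assms)
  then show ?thesis by (simp add: foldr_Cons_map)
qed

lemma eff_filter [eff]:
  assumes "effective (\<lambda>p. P (fst p) (snd p))" "effective l"
  shows "effective (\<lambda>x. filter (P x) (l x))"
proof -
  have "effective (\<lambda>p. P (fst p) (fst (snd p)))"
    using eff_comp[OF assms(1), of "\<lambda>p. (fst p, fst (snd p))"] by (simp add: eff)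
  then have "effective (\<lambda>x. foldr (\<lambda>y acc. if P x y then y # acc else acc) (l x) [])"
    by (intro eff_foldr[where f="\<lambda>x y acc. if P x y then y # acc else acc"] eff assms)
  then show ?thesis by (simp add: foldr_filter)
qed

lemma eff_list_all [eff]:
  assumes "effective (\<lambda>p. P (fst p) (snd p))" "effective l"
  shows "effective (\<lambda>x. \<forall>y\<in>set (l x). P x y)"
proof -
  have "effective (\<lambda>x. filter (\<lambda>y. \<not> P x y) (l x) = [])"
    by (intro eff eff_filter[where P="\<lambda>x y. \<not> P x y"] assms)
  then show ?thesis by (simp add: filter_empty_conv)
qed

lemma eff_member [eff]:
  assumes "effective f" "effective l"
  shows "effective (\<lambda>x. f x \<in> set (l x))"
proof -
  have "effective (\<lambda>x. \<not> (\<forall>y\<in>set (l x). f x \<noteq> y))"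
    by (intro eff eff_list_all[where P="\<lambda>x y. f x \<noteq> y"] eff_comp[OF assms(1)] assms)
  then show ?thesis by simp
qed

lemma eff_append [eff]:
  assumes "effective f" "effective g" shows "effective (\<lambda>x. f x @ g x)"
proof -
  have "effective (\<lambda>x. foldr (\<lambda>y acc. y # acc) (f x) (g x))"
    by (intro eff_foldr[where f="\<lambda>x y acc. y # acc"] eff assms)
  then show ?thesis by (simp add: foldr_Cons_append)
qed

lemma eff_concat [eff]:
  assumes "effective f" shows "effective (\<lambda>x. concat (f x))"
  unfolding concat_conv_foldr by (intro eff_foldr[where f="\<lambda>x. append"] eff assms)

lemma eff_length [eff]:
  assumes "effective f" shows "effective (\<lambda>x. length (f x))"
proof -
  have "effective (\<lambda>x. foldr (\<lambda>y n. Suc n) (f x) 0)"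
    by (intro eff_foldr[where f="\<lambda>x y n. Suc n"] eff assms)
  then show ?thesis by (simp add: foldr_Suc_length)
qed

lemma eff_plus [eff]: "effective f \<Longrightarrow> effective g \<Longrightarrow> effective (\<lambda>x. f x + g x :: nat)"
  by (rule eff_rec2[OF rec2_plus])

lemma eff_times [eff]:
  assumes "effective f" "effective g" shows "effective (\<lambda>x. f x * g x :: nat)"
proof -
  have "effective (\<lambda>x. ((\<lambda>a. a + g x) ^^ f x) 0)"
    by (intro eff_funpow[where f="\<lambda>x a. a + g x"] eff eff_comp[OF assms(2)] assms)
  moreover have "((\<lambda>a. a + m) ^^ n) 0 = n * m" for m n :: nat by (induction n) auto
  ultimately show ?thesis by simp
qed

lemma eff_power [eff]:
  assumes "effective f" "effective g" shows "effective (\<lambda>x. f x ^ g x :: nat)"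
proof -
  have "effective (\<lambda>x. ((\<lambda>a. a * f x) ^^ g x) 1)"
    by (intro eff_funpow[where f="\<lambda>x a. a * f x"] eff eff_comp[OF assms(1)] assms)
  moreover have "((\<lambda>a. a * m) ^^ n) 1 = m ^ n" for m n :: nat by (induction n) auto
  ultimately show ?thesis by simp
qed

lemma eff_upt [eff]:
  assumes "effective f" shows "effective (\<lambda>x. [0..<f x])"
proof -
  have "effective (\<lambda>x. ((\<lambda>l. l @ [length l]) ^^ f x) [])"
    by (intro eff_funpow[where f="\<lambda>x l. l @ [length l]"] eff assms)
  moreover have "((\<lambda>l. l @ [length l]) ^^ n) [] = [0..<n]" for n by (induction n) auto
  ultimately show ?thesis by simp
qed

lemma eff_remdups [eff]:
  assumes "effective f" shows "effective (\<lambda>x. remdups (f x))"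
proof -
  have "effective (\<lambda>x. foldr (\<lambda>y acc. if y \<in> set acc then acc else y # acc) (f x) [])"
    by (intro eff_foldr[where f="\<lambda>x y acc. if y \<in> set acc then acc else y # acc"] eff assms)
  then show ?thesis by (simp add: foldr_remdups)
qed

lemma effective_computes:
  fixes f :: "'a::encodable \<times> 'b::encodable \<Rightarrow> 'c::encodable"
  assumes "effective f"
  obtains p where "\<And>x y. computes p [enc x, enc y] (enc (f (x, y)))"
proof -
  obtain g where g: "rec1 g" "\<And>p. g (enc p) = enc (f p)" using assms unfolding effective_def by blast
  have "rec2 (\<lambda>x y. g (prod_encode (x, y)))" by (intro rec2_comp1[OF g(1)] rec2_prod_encode)
  then obtain p where p: "\<And>xs. length xs = 2 \<Longrightarrow> computes p xs (g (prod_encode (xs ! 0, xs ! 1)))"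
    unfolding rec2_def rec_fun_def by blast
  have "computes p [enc x, enc y] (enc (f (x, y)))" for x y
    using p[of "[enc x, enc y]"] g(2)[of "(x, y)"] by (simp add: enc_prod_def)
  then show ?thesis using that by blast
qed

section \<open>The algorithm\<close>

subsection \<open>Enumerating bases\<close>

definition word_inv :: "'a word \<Rightarrow> 'a word" where
  "word_inv w = rev (map (\<lambda>y. (fst y, \<not> snd y)) w)"

definition all_letters :: "'a list \<Rightarrow> 'a letter list" where
  "all_letters es = map (\<lambda>e. (e, True)) es @ map (\<lambda>e. (e, False)) es"

text \<open>A fold instead of a recursion equation, because folds, maps and iterations are the forms
  covered by the closure rules for \<open>effective\<close>. The definitions below follow the same
  pattern.\<close>

definition sublists :: "'b list \<Rightarrow> 'b list list" where
  "sublists xs = foldr (\<lambda>x acc. map (\<lambda>ys. x # ys) acc @ acc) xs [[]]"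

text \<open>A marking lists the letters together with words for their images.\<close>

type_synonym 'a marking = "('a \<times> 'a word) list"

text \<open>With \<open>w0\<close> a word for the image of \<open>b\<close>, this is
  \<open>lift f (wh (set X) b e)\<close> for every letter \<open>e\<close>, written without
  reduction.\<close>

definition move :: "'a \<Rightarrow> 'a word \<Rightarrow> 'a letter list \<Rightarrow> 'a marking \<Rightarrow> 'a marking" where
  "move e0 w0 X al = map (\<lambda>p. (fst p, if fst p = e0 then snd p
     else (if (fst p, False) \<in> set X then w0 else []) @ snd p @
       (if (fst p, True) \<in> set X then word_inv w0 else []))) al"

text \<open>The marking itself is kept, so \<open>n\<close> rounds contain all shorter chains. Both
  orientations of the letter \<open>b\<close> are tried.\<close>

definition next_markings :: "'a marking \<Rightarrow> 'a marking list" where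
  "next_markings al = al # concat (map (\<lambda>p. concat (map (\<lambda>X.
     [move (fst p) (snd p) X al, move (fst p) (word_inv (snd p)) X al])
       (sublists (all_letters (map fst al))))) al)"

definition markings :: "nat \<Rightarrow> 'a list \<Rightarrow> 'a marking list" where
  "markings n es = ((\<lambda>L. concat (map next_markings L)) ^^ n) [map (\<lambda>e. (e, [(e, True)])) es]"

text \<open>The words may be unreduced; only the elements they represent matter, in the membership
  test as well as in the resulting basis.\<close>

definition represents :: "'a list \<Rightarrow> 'a marking \<Rightarrow> ('a \<Rightarrow> 'a fg) \<Rightarrow> bool" where
  "represents es al f \<longleftrightarrow> map fst al = es \<and> (\<forall>p\<in>set al. snd p \<in> words (set es) \<and> of_word (snd p) = f (fst p))"

lemma of_word_word_inv: "of_word (word_inv w) = - of_word w"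
proof (induction w)
  case (Cons y w)
  have "word_inv (y # w) = word_inv w @ [inv_letter y]" by (simp add: word_inv_def inv_letter_def)
  then show ?case using Cons by (simp add: of_word_append of_word_Cons ltr_inv minus_add)
qed (simp add: word_inv_def)

lemma words_word_inv: "w \<in> words E \<Longrightarrow> word_inv w \<in> words E"
  by (fastforce simp: word_inv_def words_def)

lemma set_sublists: "set ` set (sublists xs) = Pow (set xs)"
proof -
  have "sublists xs = subseqs xs" by (induction xs) (simp_all add: sublists_def Let_def)
  then show ?thesis by (simp add: subseqs_powset)
qed

lemma set_all_letters: "set (all_letters es) = letters (set es)"
  by (auto simp: all_letters_def letters_def)

lemma represents_move:
  assumes al: "represents es al f" and w0: "w0 \<in> words (set es)" "of_word w0 = lift f (ltr b)"
  shows "represents es (move (fst b) w0 X al) (\<lambda>e. lift f (wh (set X) b e))"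
  unfolding represents_def
proof (intro conjI ballI)
  show "map fst (move (fst b) w0 X al) = es" using al by (simp add: represents_def move_def comp_def)
  fix p assume "p \<in> set (move (fst b) w0 X al)"
  then obtain q where q: "q \<in> set al" "p = (fst q, if fst q = fst b then snd q
     else (if (fst q, False) \<in> set X then w0 else []) @ snd q @
       (if (fst q, True) \<in> set X then word_inv w0 else []))" by (auto simp: move_def)
  have qf: "snd q \<in> words (set es)" "of_word (snd q) = f (fst q)" using al q(1) by (auto simp: represents_def)
  have "word_inv w0 \<in> words (set es)" by (rule words_word_inv[OF w0(1)])
  then show "snd p \<in> words (set es)" using qf w0(1) q(2) by (auto simp: words_def)
  have lb: "lift f (lif P b) = (if P then of_word w0 else 0)" for P using w0(2) by (simp add: lif_def)
  have fl: "lift f (ltr (e, True)) = f e" for e by (simp add: lift_letter_def)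
  show "of_word (snd p) = lift f (wh (set X) b (fst p))"
    unfolding q(2) wh_def fst_conv snd_conv
    by (auto simp del: lift_ltr simp: of_word_append of_word_word_inv qf lift_plus lift_minus lift_uminus lb fl
        group_assoc simp del: add_uminus_conv_diff)
qed

lemma markings_sound: "al \<in> set (markings n es) \<Longrightarrow> \<exists>m. \<exists>f\<in>reachable (set es) m. represents es al f"
proof (induction n arbitrary: al)
  case 0
  then have "represents es al (\<lambda>e. ltr (e, True))"
    by (auto simp: markings_def represents_def words_def ltr_def comp_def)
  then show ?case by (intro exI[of _ 0]) simp
next
  case (Suc n)
  then obtain al' where al': "al' \<in> set (markings n es)" "al \<in> set (next_markings al')"
    by (auto simp: markings_def)
  obtain m f where f: "f \<in> reachable (set es) m" "represents es al' f" using Suc.IH[OF al'(1)] by blast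
  have step: "\<exists>m. \<exists>f\<in>reachable (set es) m. represents es (move (fst b) w0 X al') f"
    if "w0 \<in> words (set es)" "of_word w0 = lift f (ltr b)" "X \<in> set (sublists (all_letters es))" "fst b \<in> set es" for b w0 X
  proof -
    have "set X \<subseteq> letters (set es)" using that(3) set_sublists set_all_letters by (metis PowD imageI)
    moreover have "b \<in> letters (set es)" using that(4) by (cases b) (simp add: letters_def)
    ultimately have "(\<lambda>e. lift f (wh (set X) b e)) \<in> reachable (set es) (Suc m)"
      unfolding reachable.simps using f(1) by blast
    then show ?thesis using represents_move[OF f(2) that(1,2), of X] by blast
  qed
  have es: "map fst al' = es" using f(2) by (simp add: represents_def)
  from al'(2) consider "al = al'"
    | p X where "p \<in> set al'" "X \<in> set (sublists (all_letters es))"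
        "al = move (fst p) (snd p) X al' \<or> al = move (fst p) (word_inv (snd p)) X al'"
    unfolding next_markings_def es by auto
  then show ?case
  proof cases
    case 1
    then show ?thesis using f by blast
  next
    case 2
    have p: "snd p \<in> words (set es)" "of_word (snd p) = f (fst p)" "fst p \<in> set es"
      using f(2) 2(1) by (auto simp: represents_def)
    have "of_word (snd p) = lift f (ltr (fst p, True))" "of_word (word_inv (snd p)) = lift f (ltr (fst p, False))"
      using p by (simp_all add: lift_letter_def of_word_word_inv)
    then show ?thesis
      using step[of "snd p" "(fst p, True)" X] step[of "word_inv (snd p)" "(fst p, False)" X]
        p words_word_inv[OF p(1)] 2(2,3) by auto
  qed
qed

lemma markings_complete:
  "f \<in> reachable (set es) m \<Longrightarrow> m \<le> n \<Longrightarrow> \<exists>al\<in>set (markings n es). represents es al f"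
proof (induction n arbitrary: f m)
  case 0
  then show ?case by (auto simp: markings_def represents_def words_def ltr_def comp_def)
next
  case (Suc n)
  have sub: "al \<in> set (markings (Suc n) es)" if "al' \<in> set (markings n es)" "al \<in> set (next_markings al')" for al al'
    using that by (auto simp: markings_def)
  show ?case
  proof (cases "m \<le> n")
    case True
    then obtain al where al: "al \<in> set (markings n es)" "represents es al f" using Suc by blast
    moreover have "al \<in> set (next_markings al)" by (simp add: next_markings_def)
    ultimately show ?thesis using sub by blast
  next
    case False
    then have "m = Suc n" using Suc.prems by simp
    then obtain f' X b where f: "f = (\<lambda>e. lift f' (wh X b e))" "f' \<in> reachable (set es) n"
      "X \<subseteq> letters (set es)" "b \<in> letters (set es)"
      using Suc.prems(1) unfolding \<open>m = Suc n\<close> reachable.simps by blast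
    obtain al where al: "al \<in> set (markings n es)" "represents es al f'" using Suc.IH[OF f(2)] by blast
    have es: "map fst al = es" using al(2) by (simp add: represents_def)
    have "X \<in> set ` set (sublists (all_letters es))" using f(3) by (simp add: set_sublists set_all_letters)
    then obtain Xs where Xs: "Xs \<in> set (sublists (all_letters es))" "X = set Xs" by blast
    have "fst b \<in> set (map fst al)" using f(4) es by (auto simp: letters_def)
    then obtain p where p: "p \<in> set al" "fst p = fst b" by auto
    have pf: "snd p \<in> words (set es)" "of_word (snd p) = f' (fst b)" using al(2) p by (auto simp: represents_def)
    define w0 where "w0 = (if snd b then snd p else word_inv (snd p))"
    have w0: "w0 \<in> words (set es)" "of_word w0 = lift f' (ltr b)"
      using pf words_word_inv by (auto simp: w0_def lift_letter_def of_word_word_inv)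
    have "move (fst p) w0 Xs al \<in> set (next_markings al)"
      unfolding next_markings_def es w0_def using p(1) Xs(1) by (cases "snd b") (simp_all, blast+)
    then have "move (fst b) w0 Xs al \<in> set (next_markings al)" by (simp only: p(2))
    then show ?thesis using sub[OF al(1)] represents_move[OF al(2) w0, of Xs] f(1) Xs(2) by blast
  qed
qed

subsection \<open>Deciding membership\<close>

definition lookup :: "('a \<times> nat list) list \<Rightarrow> 'a \<Rightarrow> nat list" where
  "lookup \<tau> e = foldr (\<lambda>p r. if fst p = e then snd p else r) \<tau> []"

text \<open>On a list that enumerates a permutation this is the inverse permutation, so one list
  encodes the action of a letter and of its inverse.\<close>

definition position :: "nat list \<Rightarrow> nat \<Rightarrow> nat" where
  "position xs x = foldr (\<lambda>y i. if y = x then 0 else Suc i) xs 0"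

definition entry :: "nat list \<Rightarrow> nat \<Rightarrow> nat" where
  "entry xs i = (case ((\<lambda>l. case l of [] \<Rightarrow> [] | y # ys \<Rightarrow> ys) ^^ i) xs of [] \<Rightarrow> 0 | y # ys \<Rightarrow> y)"

definition table_act :: "('a \<times> nat list) list \<Rightarrow> 'a word \<Rightarrow> nat \<Rightarrow> nat" where
  "table_act \<tau> w x = foldr (\<lambda>y x. if snd y then entry (lookup \<tau> (fst y)) x else position (lookup \<tau> (fst y)) x) w x"

definition perm_lists :: "nat \<Rightarrow> nat list list" where
  "perm_lists k = filter (\<lambda>xs. length (remdups xs) = length xs)
     (((\<lambda>acc. concat (map (\<lambda>ys. map (\<lambda>y. y # ys) [0..<k]) acc)) ^^ k) [[]])"

definition tables :: "nat \<Rightarrow> 'a list \<Rightarrow> ('a \<times> nat list) list list" where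
  "tables k es = foldr (\<lambda>e acc. concat (map (\<lambda>\<pi>. map (\<lambda>\<tau>. (e, \<pi>) # \<tau>) acc) (perm_lists k))) es [[]]"

definition total_length :: "'b list list \<Rightarrow> nat" where
  "total_length Zs = foldr (\<lambda>z n. length z + n) Zs 0"

text \<open>The points are \<open>0\<close> to \<open>m\<close> for the bound \<open>m\<close> of
  \<open>mem_iff_permutations\<close>, hence the successor.\<close>

definition in_subgroup :: "'a list \<Rightarrow> 'a word list \<Rightarrow> 'a word \<Rightarrow> bool" where
  "in_subgroup es Zs w \<longleftrightarrow> (\<forall>\<tau>\<in>set (tables (Suc (total_length Zs + length w)) es).
     (\<forall>z\<in>set Zs. table_act \<tau> z 0 = 0) \<longrightarrow> table_act \<tau> w 0 = 0)"

lemma entry_nth: "i < length xs \<Longrightarrow> entry xs i = xs ! i"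
proof -
  have "((\<lambda>l. case l of [] \<Rightarrow> [] | y # ys \<Rightarrow> ys) ^^ i) xs = drop i xs" for xs :: "nat list"
  proof (induction i)
    case (Suc i)
    have "drop (Suc i) xs = tl (drop i xs)" by (simp add: drop_Suc drop_tl)
    then show ?case using Suc by (cases "drop i xs") simp_all
  qed simp
  then show "i < length xs \<Longrightarrow> entry xs i = xs ! i"
    unfolding entry_def by (simp add: Cons_nth_drop_Suc[symmetric])
qed

lemma position_nth: "distinct xs \<Longrightarrow> i < length xs \<Longrightarrow> position xs (xs ! i) = i"
proof (induction xs arbitrary: i)
  case (Cons a xs)
  then show ?case by (cases i) (auto simp: position_def)
qed simp

lemma lookup_map: "lookup (map (\<lambda>e. (e, g e)) es) e = (if e \<in> set es then g e else [])"
  by (induction es) (auto simp: lookup_def)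

lemma lookup_in: "e \<in> fst ` set \<tau> \<Longrightarrow> (e, lookup \<tau> e) \<in> set \<tau>"
  by (induction \<tau>) (auto simp: lookup_def)

lemma set_perm_lists: "set (perm_lists k) = {xs. length xs = k \<and> set xs \<subseteq> {..<k} \<and> distinct xs}"
proof -
  have "((\<lambda>acc. concat (map (\<lambda>ys. map (\<lambda>y. y # ys) [0..<k]) acc)) ^^ n) [[]] = List.n_lists n [0..<k]" for n
    by (induction n) auto
  then have "set (perm_lists k) = {xs \<in> set (List.n_lists k [0..<k]). length (remdups xs) = length xs}"
    unfolding perm_lists_def by simp
  then show ?thesis by (auto simp: set_n_lists atLeast0LessThan length_remdups_eq)
qed

lemma set_tables: "set (tables k es) = {\<tau>. map fst \<tau> = es \<and> (\<forall>p\<in>set \<tau>. snd p \<in> set (perm_lists k))}"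
proof (induction es)
  case (Cons e es)
  have "set (tables k (e # es)) = {(e, \<pi>) # \<tau> | \<pi> \<tau>. \<pi> \<in> set (perm_lists k) \<and> \<tau> \<in> set (tables k es)}"
    by (auto simp: tables_def)
  also have "\<dots> = {\<tau>. map fst \<tau> = e # es \<and> (\<forall>p\<in>set \<tau>. snd p \<in> set (perm_lists k))}"
    unfolding Cons.IH by (auto simp: map_eq_Cons_conv)
  finally show ?case .
qed (auto simp: tables_def)

text \<open>A list of \<open>m + 1\<close> distinct numbers below \<open>m + 1\<close> contains all
  of them, so it enumerates a permutation of \<open>{..m}\<close>.\<close>

lemma table_inverse_on:
  assumes "\<tau> \<in> set (tables (Suc m) es)" "e \<in> set es"
  shows "inverse_on m (entry (lookup \<tau> e)) (position (lookup \<tau> e))"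
proof -
  have \<tau>: "map fst \<tau> = es" "\<forall>p\<in>set \<tau>. snd p \<in> set (perm_lists (Suc m))" using assms(1) by (auto simp: set_tables)
  have "e \<in> fst ` set \<tau>" using \<tau>(1) assms(2) by force
  then have "lookup \<tau> e \<in> set (perm_lists (Suc m))" using lookup_in[of e \<tau>] \<tau>(2) by force
  then obtain xs where xs: "lookup \<tau> e = xs" "length xs = Suc m" "set xs \<subseteq> {..<Suc m}" "distinct xs"
    by (simp add: set_perm_lists)
  have set: "set xs = {..<Suc m}"
    by (rule card_subset_eq) (use xs distinct_card[of xs] in auto)
  show ?thesis unfolding inverse_on_def xs(1)
  proof (intro allI impI)
    fix x assume x: "x \<le> m"
    then have "x \<in> set xs" by (simp add: set)
    then obtain i where i: "i < length xs" "xs ! i = x" by (auto simp: in_set_conv_nth)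
    have px: "position xs x = i" using position_nth[OF xs(4) i(1)] i(2) by simp
    have xi: "xs ! x \<in> {..<Suc m}" using x xs(2) nth_mem[of x xs] set by simp
    show "entry xs x \<le> m \<and> position xs x \<le> m \<and> entry xs (position xs x) = x \<and> position xs (entry xs x) = x"
      using px i xi x xs(2) position_nth[OF xs(4), of x] by (simp add: entry_nth)
  qed
qed

lemma ex_table:
  assumes inv: "\<forall>e\<in>set es. inverse_on m (P e) (Q e)"
  obtains \<tau> where "\<tau> \<in> set (tables (Suc m) es)"
    "\<forall>e\<in>set es. \<forall>x\<le>m. entry (lookup \<tau> e) x = P e x \<and> position (lookup \<tau> e) x = Q e x"
proof -
  define g where "g e = map (P e) [0..<Suc m]" for e
  define \<tau> where "\<tau> = map (\<lambda>e. (e, g e)) es"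
  have g: "length (g e) = Suc m" "set (g e) \<subseteq> {..<Suc m}" "distinct (g e)" if "e \<in> set es" for e
  proof -
    have i: "inverse_on m (P e) (Q e)" using inv that by blast
    show "length (g e) = Suc m" by (simp add: g_def)
    have le: "P e x \<le> m" "Q e (P e x) = x" if "x < Suc m" for x
      using i that unfolding inverse_on_def less_Suc_eq_le by blast+
    then show "set (g e) \<subseteq> {..<Suc m}" by (auto simp: g_def less_Suc_eq_le simp del: upt_Suc)
    have "inj_on (P e) {0..<Suc m}" by (rule inj_on_inverseI[of _ "Q e"]) (use le in auto)
    then show "distinct (g e)" by (simp add: g_def distinct_map del: upt_Suc)
  qed
  have "\<tau> \<in> set (tables (Suc m) es)" using g by (auto simp: \<tau>_def set_tables set_perm_lists comp_def)
  moreover have "entry (lookup \<tau> e) x = P e x \<and> position (lookup \<tau> e) x = Q e x" if "e \<in> set es" "x \<le> m" for e x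
  proof -
    have i: "inverse_on m (P e) (Q e)" using inv that by blast
    have l: "lookup \<tau> e = g e" using that by (simp add: \<tau>_def lookup_map)
    have n: "g e ! y = P e y" if "y \<le> m" for y using that by (simp add: g_def del: upt_Suc)
    have q: "Q e x \<le> m" "P e (Q e x) = x" using i that by (auto simp: inverse_on_def)
    then have "position (g e) x = Q e x" using position_nth[OF g(3)[OF that(1)], of "Q e x"] n[of "Q e x"] g(1)[OF that(1)] by simp
    then show ?thesis using l n that g(1)[OF that(1)] by (simp add: entry_nth)
  qed
  ultimately show ?thesis using that by blast
qed

lemma table_act_act: "table_act \<tau> w x = act (\<lambda>e. entry (lookup \<tau> e)) (\<lambda>e. position (lookup \<tau> e)) w x"
  by (simp add: table_act_def act_def act_letter_def[abs_def])

lemma act_cong: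
  assumes "\<And>e. e \<in> E \<Longrightarrow> inverse_on m (P e) (Q e)"
    "\<And>e x. e \<in> E \<Longrightarrow> x \<le> m \<Longrightarrow> P' e x = P e x \<and> Q' e x = Q e x" "w \<in> words E" "x \<le> m"
  shows "act P' Q' w x = act P Q w x"
  using assms(3)
proof (induction w)
  case (Cons y w)
  then have w: "w \<in> words E" and y: "fst y \<in> E" by (auto simp: words_def)
  have "act P Q w x \<le> m" using act_le[of E m P Q w x, OF assms(1) w assms(4)] by simp
  then show ?case using Cons.IH[OF w] assms(2)[OF y] by (simp add: act_letter_def)
qed simp

lemma total_length_ge: "(\<Sum>z\<in>set Zs. length z) \<le> total_length Zs"
proof (induction Zs)
  case (Cons z Zs)
  have "(\<Sum>z\<in>set (z # Zs). length z) \<le> length z + (\<Sum>z\<in>set Zs. length z)"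
    by (cases "z \<in> set Zs") (simp_all add: insert_absorb)
  then show ?case using Cons by (simp add: total_length_def)
qed simp

lemma in_subgroup_iff:
  assumes Z: "set Zs \<subseteq> carrier (free_group (set es))" and w: "w \<in> words (set es)"
  shows "in_subgroup es Zs w \<longleftrightarrow> of_word w \<in> of_word ` generate (free_group (set es)) (set Zs)"
proof -
  let ?m = "total_length Zs + length w" and ?E = "set es"
  note gs = generate_state[OF Z]
  have Zw: "set Zs \<subseteq> words ?E" using Z by auto
  have "of_word w \<in> of_word ` generate (free_group ?E) (set Zs) \<longleftrightarrow>
    (\<forall>P Q. (\<forall>e\<in>?E. inverse_on ?m (P e) (Q e)) \<longrightarrow> (\<forall>z\<in>set Zs. act P Q z 0 = 0) \<longrightarrow> act P Q w 0 = 0)"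
    by (rule mem_iff_permutations[OF _ Zw w gs(1,3,2,4)]) (use total_length_ge[of Zs] in auto)
  also have "\<dots> \<longleftrightarrow> in_subgroup es Zs w"
  proof
    assume *: "\<forall>P Q. (\<forall>e\<in>?E. inverse_on ?m (P e) (Q e)) \<longrightarrow> (\<forall>z\<in>set Zs. act P Q z 0 = 0) \<longrightarrow> act P Q w 0 = 0"
    show "in_subgroup es Zs w" unfolding in_subgroup_def table_act_act
    proof (intro ballI impI)
      fix \<tau> assume \<tau>: "\<tau> \<in> set (tables (Suc ?m) es)"
        and z: "\<forall>z\<in>set Zs. act (\<lambda>e. entry (lookup \<tau> e)) (\<lambda>e. position (lookup \<tau> e)) z 0 = 0"
      have "\<forall>e\<in>?E. inverse_on ?m (entry (lookup \<tau> e)) (position (lookup \<tau> e))"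
        using table_inverse_on[OF \<tau>] by blast
      from mp[OF mp[OF spec[OF spec[OF *]] this] z]
      show "act (\<lambda>e. entry (lookup \<tau> e)) (\<lambda>e. position (lookup \<tau> e)) w 0 = 0" .
    qed
  next
    assume i: "in_subgroup es Zs w"
    show "\<forall>P Q. (\<forall>e\<in>?E. inverse_on ?m (P e) (Q e)) \<longrightarrow> (\<forall>z\<in>set Zs. act P Q z 0 = 0) \<longrightarrow> act P Q w 0 = 0"
    proof (intro allI impI)
      fix P Q assume inv: "\<forall>e\<in>?E. inverse_on ?m (P e) (Q e)" and z: "\<forall>z\<in>set Zs. act P Q z 0 = 0"
      obtain \<tau> where \<tau>: "\<tau> \<in> set (tables (Suc ?m) es)"
        "\<forall>e\<in>?E. \<forall>x\<le>?m. entry (lookup \<tau> e) x = P e x \<and> position (lookup \<tau> e) x = Q e x"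
        by (rule ex_table[OF inv])
      have "table_act \<tau> v 0 = act P Q v 0" if "v \<in> words ?E" for v
        unfolding table_act_act by (rule act_cong[of ?E ?m]) (use inv \<tau>(2) that in auto)
      then show "act P Q w 0 = 0" using i \<tau>(1) z Zw w unfolding in_subgroup_def by (metis subsetD)
    qed
  qed
  finally show ?thesis by blast
qed

subsection \<open>Choosing the best basis\<close>

definition score :: "'a list \<Rightarrow> 'a word list \<Rightarrow> 'a marking \<Rightarrow> nat" where
  "score es Zs al = length (filter (\<lambda>p. in_subgroup es Zs (snd p)) al)"

text \<open>\<open>2 * total_length Zs\<close> bounds the initial weight, and the squared number of
  states bounds the length of a chain without repetitions.\<close>

definition chain_bound :: "'a list \<Rightarrow> 'a word list \<Rightarrow> nat" where
  "chain_bound es Zs = state_bound (length es) (2 * total_length Zs) ^ 2"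

text \<open>The standard basis seeds the fold, so the result is a basis in every case.\<close>

definition best_marking :: "'a list \<Rightarrow> 'a word list \<Rightarrow> 'a marking" where
  "best_marking es Zs = foldr (\<lambda>al best. if score es Zs best \<le> score es Zs al then al else best)
     (markings (chain_bound es Zs) es) (map (\<lambda>e. (e, [(e, True)])) es)"

text \<open>The input list may repeat letters, whereas a marking lists each letter once.\<close>

definition best_basis :: "'a list \<times> 'a word list \<Rightarrow> 'a word list" where
  "best_basis p = map snd (best_marking (remdups (fst p)) (snd p))"

lemma foldr_argmax:
  fixes s :: "'b \<Rightarrow> nat" and xs :: "'b list" and i :: 'b
  defines "r \<equiv> \<lambda>xs. foldr (\<lambda>y best. if s best \<le> s y then y else best) xs i"
  shows "r xs \<in> insert i (set xs)" "\<forall>y\<in>set xs. s y \<le> s (r xs)"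
proof -
  have "r xs \<in> insert i (set xs) \<and> (\<forall>y\<in>set xs. s y \<le> s (r xs))"
    unfolding r_def by (induction xs) auto
  then show "r xs \<in> insert i (set xs)" "\<forall>y\<in>set xs. s y \<le> s (r xs)" by blast+
qed

text \<open>A score counts list entries; since \<open>f\<close> is injective on the distinct
  letters, these are as many as the basis elements in the subgroup.\<close>

lemma score_eq:
  assumes es: "distinct es" and Z: "set Zs \<subseteq> carrier (free_group (set es))"
    and f: "f \<in> reachable (set es) m" and al: "represents es al f"
  shows "score es Zs al = card (word ` f ` set es \<inter> generate (free_group (set es)) (set Zs))"
proof -
  let ?G = "free_group (set es)"
  define H where "H = of_word ` generate ?G (set Zs)"
  note gs = generate_state[OF Z, folded H_def] and fb = free_basis_of_reachable[OF f]
  have fst: "map fst al = es" and snd: "\<And>p. p \<in> set al \<Longrightarrow> snd p \<in> words (set es) \<and> of_word (snd p) = f (fst p)"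
    using al by (auto simp: represents_def)
  have d: "distinct (map fst al)" using es fst by simp
  have "score es Zs al = length (filter (\<lambda>p. f (fst p) \<in> H) al)"
    unfolding score_def
    by (rule arg_cong[of _ _ length], rule filter_cong[OF refl])
      (use snd in_subgroup_iff[OF Z] in \<open>auto simp: H_def\<close>)
  also have "\<dots> = length (filter (\<lambda>e. f e \<in> H) (map fst al))" by (simp add: filter_map comp_def)
  also have "\<dots> = card {e\<in>set es. f e \<in> H}"
    unfolding fst using distinct_card[OF distinct_filter[OF es, of "\<lambda>e. f e \<in> H"]] by simp
  also have "\<dots> = card ((\<lambda>e. word (f e)) ` {e\<in>set es. f e \<in> H})"
    by (rule card_image[symmetric]) (use fb(1) in \<open>auto simp: inj_on_def word_inject\<close>)
  also have "(\<lambda>e. word (f e)) ` {e\<in>set es. f e \<in> H} = word ` f ` set es \<inter> generate ?G (set Zs)"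
  proof -
    have "f e \<in> H \<longleftrightarrow> word (f e) \<in> generate ?G (set Zs)" if "e \<in> set es" for e
    proof -
      have "word (f e) \<in> carrier ?G" using fb(2) that by (subst word_in_carrier) blast
      from gs(5)[OF this] show ?thesis by (simp only: of_word_word)
    qed
    then show ?thesis by auto
  qed
  finally show ?thesis .
qed

theorem best_basis_correct:
  assumes Es: "set Es = E" and Z: "Z \<subseteq> carrier (free_group E)" "set Zs = Z"
  defines "ws \<equiv> best_basis (Es, Zs)"
  shows "set ws \<subseteq> words E" "free_basis (free_group E) (reduce ` set ws)"
    "free_basis (free_group E) B \<Longrightarrow>
      card (B \<inter> generate (free_group E) Z) \<le> card (reduce ` set ws \<inter> generate (free_group E) Z)"
proof -
  define es where "es = remdups Es"
  have es: "distinct es" "set es = E" using Es by (auto simp: es_def)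
  have Z': "set Zs \<subseteq> carrier (free_group (set es))" using Z es by simp
  let ?L = "markings (chain_bound es Zs) es" and ?al = "best_marking es Zs"
  have init: "map (\<lambda>e. (e, [(e, True)])) es \<in> set (markings 0 es)" by (simp add: markings_def)
  have am: "?al \<in> insert (map (\<lambda>e. (e, [(e, True)])) es) (set ?L)" "\<forall>al\<in>set ?L. score es Zs al \<le> score es Zs ?al"
    unfolding best_marking_def by (rule foldr_argmax)+
  then obtain m f where f: "f \<in> reachable E m" "represents es ?al f"
    using markings_sound[OF init] markings_sound[of ?al "chain_bound es Zs" es] es(2) by auto
  have ws: "set ws = snd ` set ?al" by (simp add: ws_def best_basis_def es_def)
  show "set ws \<subseteq> words E" using f(2) es(2) unfolding ws by (auto simp: represents_def)
  have "reduce ` set ws = word ` f ` E"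
  proof -
    have "reduce (snd p) = word (f (fst p))" if "p \<in> set ?al" for p
      using f(2) that word_of_word[of "snd p"] by (auto simp: represents_def)
    then have "reduce ` set ws = (\<lambda>p. word (f (fst p))) ` set ?al" unfolding ws by (simp add: image_image)
    also have "\<dots> = word ` f ` fst ` set ?al" by (simp add: image_image)
    also have "fst ` set ?al = E" using f(2) es(2) by (metis represents_def set_map)
    finally show ?thesis .
  qed
  note rws = this
  show "free_basis (free_group E) (reduce ` set ws)" unfolding rws by (rule free_basis_of_reachable(3)[OF f(1)])
  assume B: "free_basis (free_group E) B"
  have finE: "finite E" using es(2) by auto
  have M: "2 * (\<Sum>z\<in>Z. length z) \<le> 2 * total_length Zs" using total_length_ge[of Zs] Z(2) by simp
  have cE: "card E = length es" using es distinct_card by metis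
  obtain m' f' where f': "m' \<le> chain_bound es Zs" "f' \<in> reachable E m'"
    "card (B \<inter> generate (free_group E) Z) \<le> card (word ` f' ` E \<inter> generate (free_group E) Z)"
    using reachable_basis_optimal[OF finE _ Z(1) B M] Z(2) unfolding chain_bound_def cE by auto
  obtain al where al: "al \<in> set ?L" "represents es al f'" using markings_complete[of f' es m'] f' es(2) by blast
  have "card (word ` f' ` E \<inter> generate (free_group E) Z) = score es Zs al"
    using score_eq[OF es(1) Z' _ al(2)] f'(2) es(2) Z(2) by simp
  also have "\<dots> \<le> score es Zs ?al" using am(2) al(1) by blast
  also have "\<dots> = card (reduce ` set ws \<inter> generate (free_group E) Z)"
    using score_eq[OF es(1) Z' _ f(2)] f(1) es(2) Z(2) unfolding rws by simp
  finally show "card (B \<inter> generate (free_group E) Z) \<le> card (reduce ` set ws \<inter> generate (free_group E) Z)"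
    using f'(3) by linarith
qed

subsection \<open>Computability of the algorithm\<close>

text \<open>Once all definitions are unfolded, only constructions with closure rules remain.\<close>

lemma eff_best_basis: "effective best_basis"
  unfolding best_basis_def[abs_def] best_marking_def chain_bound_def state_bound_def score_def
    in_subgroup_def total_length_def tables_def perm_lists_def table_act_def entry_def position_def
    lookup_def markings_def next_markings_def move_def sublists_def all_letters_def word_inv_def
  by (intro eff)

lemma enc_word_code: "enc w = word_code w" for w :: "nat word"
proof -
  have "enc = letter_code" by (simp add: fun_eq_iff letter_code_def enc_prod_def enc_nat_def enc_bool_def)
  then show ?thesis by (simp add: word_code_def enc_list_def)
qed

lemma enc_words_code: "enc ws = words_code ws" for ws :: "nat word list"
proof -
  have "enc = word_code" by (rule ext) (rule enc_word_code)
  then show ?thesis by (simp add: words_code_def enc_list_def[of ws])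
qed

lemma enc_nat_list: "enc xs = list_encode xs" for xs :: "nat list"
proof -
  have "map enc xs = xs" by (rule map_idI) (simp add: enc_nat_def)
  then show ?thesis by (simp add: enc_list_def)
qed

theorem mainTheorem1:
  shows "\<exists>p :: recf. \<forall>(E :: nat set) (Z :: nat word set) Es Zs.
    finite E \<and> finite Z \<and> Z \<subseteq> carrier (free_group E) \<and> set Es = E \<and> set Zs = Z \<longrightarrow>
    (\<exists>ws :: nat word list. \<exists>E'' :: nat word set.
       computes p [list_encode Es, words_code Zs] (words_code ws) \<and>
       set ws \<subseteq> words E \<and> E'' = reduce ` set ws \<and>
       free_basis (free_group E) E'' \<and>
       (\<forall>B. free_basis (free_group E) B \<longrightarrow>
          card (B \<inter> generate (free_group E) Z) \<le> card (E'' \<inter> generate (free_group E) Z)))"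
proof -
  obtain p where p: "\<And>Es Zs. computes p [enc Es, enc Zs] (enc (best_basis (Es :: nat list, Zs)))"
    using effective_computes[OF eff_best_basis] by blast
  show ?thesis
  proof (intro exI[of _ p] allI impI, elim conjE)
    fix E :: "nat set" and Z :: "nat word set" and Es Zs
    assume Z: "Z \<subseteq> carrier (free_group E)" and Es: "set Es = E" and Zs: "set Zs = Z"
    show "\<exists>ws :: nat word list. \<exists>E'' :: nat word set.
       computes p [list_encode Es, words_code Zs] (words_code ws) \<and>
       set ws \<subseteq> words E \<and> E'' = reduce ` set ws \<and>
       free_basis (free_group E) E'' \<and>
       (\<forall>B. free_basis (free_group E) B \<longrightarrow>
          card (B \<inter> generate (free_group E) Z) \<le> card (E'' \<inter> generate (free_group E) Z))"
      using p[of Es Zs] best_basis_correct[OF Es Z Zs]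
      unfolding enc_nat_list enc_words_code by blast
  qed
qed

end
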